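(* Let $G$ be an $\mathcal{M}$-group. If $G$ is virtually nilpotent, then $\mathrm{RF}_G\preceq\log^k$ for some $k\in\mathbb{N}$; otherwise $r\preceq\mathrm{RF}_G$.
   Context: An $\mathcal{M}$-group is a finitely generated group $G$ that fits in a short exact sequence $1\to K\to G\to H\to 1$ with $K$ torsion-free nilpotent of finite Pr\"ufer rank and $H$ virtually abelian; such groups are residually finite. The Pr\"ufer rank of a group is the least value $\rho\in\mathbb{N}\cup\{\infty\}$ such that every finitely generated subgroup can be generated by at most $\rho$ elements. For a group $G$ with finite generating set $S$, $\|g\|_{G,S}$ is the word norm and $B_{G,S}(r)=\{g\in G:\|g\|_{G,S}\le r\}$. If $G$ is residually finite, then for $e\ne g\in G$ put $D_G(g)=\min\{[G:N] : N\lhd G,\ g\notin N\}$, and $\mathrm{RF}_{G,S}(r)=\max\{D_G(g) : e\neq g\in B_{G,S}(r)\}$ for $r\in\mathbb{R}_{\geq 1}$. For non-decreasing functions $f,g$ on $\mathbb{R}_{\ge1}$, $f\preceq g$ means that there is $C>0$ with $f(r)\le C g(Cr)$ for all $r\ge\max\{1,1/C\}$, and $f\approx g$ means $f\preceq g$ and $g\preceq f$. Up to $\approx$, $\mathrm{RF}_{G,S}$ does not depend on $S$ and is written $\mathrm{RF}_G$ (the residual finiteness growth). Here $r$ denotes the function $r\mapsto r$, and $\log^k$ the function $r\mapsto(\log r)^k$. *)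

theory Defs
  imports Complex_Main "HOL-Library.Extended_Nat" "HOL-Algebra.Algebra"
begin

definition generating_set :: "('a, 'b) monoid_scheme \<Rightarrow> 'a set \<Rightarrow> bool" where
  "generating_set G S \<longleftrightarrow> S \<subseteq> carrier G \<and> generate G S = carrier G"

definition finitely_generated :: "('a, 'b) monoid_scheme \<Rightarrow> bool" where
  "finitely_generated G \<longleftrightarrow> group G \<and> (\<exists>S. finite S \<and> generating_set G S)"

definition finite_index :: "('a, 'b) monoid_scheme \<Rightarrow> 'a set \<Rightarrow> bool" where
  "finite_index G H \<longleftrightarrow> finite (rcosets\<^bsub>G\<^esub> H)"

definition virtually ::
  "(('a, 'b) monoid_scheme \<Rightarrow> bool) \<Rightarrow> ('a, 'b) monoid_scheme \<Rightarrow> bool" where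
  "virtually P G \<longleftrightarrow>
     group G \<and> (\<exists>H. subgroup H G \<and> finite_index G H \<and> P (G\<lparr>carrier := H\<rparr>))"

(* Indexed from 0: the n-th term is the term usually written gamma_(n+1). *)
primrec lower_central :: "('a, 'b) monoid_scheme \<Rightarrow> nat \<Rightarrow> 'a set" where
  "lower_central G 0 = carrier G"
| "lower_central G (Suc n) = generate G
     {x \<otimes>\<^bsub>G\<^esub> y \<otimes>\<^bsub>G\<^esub> inv\<^bsub>G\<^esub> x \<otimes>\<^bsub>G\<^esub> inv\<^bsub>G\<^esub> y | x y. x \<in> carrier G \<and> y \<in> lower_central G n}"

definition nilpotent_group :: "('a, 'b) monoid_scheme \<Rightarrow> bool" where
  "nilpotent_group G \<longleftrightarrow> group G \<and> (\<exists>n. lower_central G n = {\<one>\<^bsub>G\<^esub>})"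

definition torsion_free :: "('a, 'b) monoid_scheme \<Rightarrow> bool" where
  "torsion_free G \<longleftrightarrow>
     (\<forall>x\<in>carrier G. \<forall>n::nat. n > 0 \<longrightarrow> x [^]\<^bsub>G\<^esub> n = \<one>\<^bsub>G\<^esub> \<longrightarrow> x = \<one>\<^bsub>G\<^esub>)"

definition prufer_rank :: "('a, 'b) monoid_scheme \<Rightarrow> enat" where
  "prufer_rank G = (LEAST \<rho>. \<forall>H. subgroup H G \<and> finitely_generated (G\<lparr>carrier := H\<rparr>) \<longrightarrow>
     (\<exists>T. finite T \<and> enat (card T) \<le> \<rho> \<and> generating_set (G\<lparr>carrier := H\<rparr>) T))"

(* In a short exact sequence 1 -> K -> G -> H -> 1 the group K is identified with its
   image, a normal subgroup of G, and H with the quotient of G by it. *)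
definition M_group :: "('a, 'b) monoid_scheme \<Rightarrow> bool" where
  "M_group G \<longleftrightarrow> finitely_generated G \<and>
     (\<exists>K. K \<lhd> G \<and>
        torsion_free (G\<lparr>carrier := K\<rparr>) \<and>
        nilpotent_group (G\<lparr>carrier := K\<rparr>) \<and>
        prufer_rank (G\<lparr>carrier := K\<rparr>) < \<infinity> \<and>
        virtually comm_group (G Mod K))"

(* Only meaningful for g in the subgroup generated by S. *)
definition word_norm :: "('a, 'b) monoid_scheme \<Rightarrow> 'a set \<Rightarrow> 'a \<Rightarrow> nat" where
  "word_norm G S g = (LEAST n. \<exists>ws. length ws = n \<and>
     set ws \<subseteq> S \<union> (\<lambda>s. inv\<^bsub>G\<^esub> s) ` S \<and> foldr (\<lambda>x y. x \<otimes>\<^bsub>G\<^esub> y) ws \<one>\<^bsub>G\<^esub> = g)"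

definition word_ball :: "('a, 'b) monoid_scheme \<Rightarrow> 'a set \<Rightarrow> real \<Rightarrow> 'a set" where
  "word_ball G S r = {g \<in> carrier G. real (word_norm G S g) \<le> r}"

(* Only meaningful if g lies outside some normal subgroup of finite index. Infinite index
   must be excluded explicitly because card of an infinite set is 0. *)
definition div_index :: "('a, 'b) monoid_scheme \<Rightarrow> 'a \<Rightarrow> nat" where
  "div_index G g = (LEAST d. \<exists>N. N \<lhd> G \<and> finite_index G N \<and> g \<notin> N \<and> d = card (rcosets\<^bsub>G\<^esub> N))"

(* Inserting 0 fixes the value for the trivial group, where the maximum is over the
   empty set; it has no effect otherwise, for r at least 1 and S a generating set. *)
definition RF :: "('a, 'b) monoid_scheme \<Rightarrow> 'a set \<Rightarrow> real \<Rightarrow> real" where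
  "RF G S r = real (Max (insert 0 (div_index G ` (word_ball G S r - {\<one>\<^bsub>G\<^esub>}))))"

definition growth_le :: "(real \<Rightarrow> real) \<Rightarrow> (real \<Rightarrow> real) \<Rightarrow> bool" (infix "\<preceq>" 50) where
  "f \<preceq> g \<longleftrightarrow> (\<exists>C>0. \<forall>r. r \<ge> max 1 (1 / C) \<longrightarrow> f r \<le> C * g (C * r))"

end

theory Submission
  imports Defs "HOL-Computational_Algebra.Fundamental_Theorem_Algebra"
begin

text \<open>If \<open>G\<close> is virtually nilpotent, integer-valued polynomial functions (those killed by iterated
  left differences) separate the points of a finite index subgroup. Such a function \<open>f\<close> takes a value
  of size polynomial in \<open>n\<close> on an element \<open>g\<close> of norm \<open>n\<close>, so some \<open>q = O(log n)\<close> does not divide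
  \<open>f(g) - f(1)\<close>; since \<open>f\<close> is constant modulo \<open>q\<close> on the subgroup \<open>P\<close> generated by the \<open>m\<close>-th powers
  with \<open>m\<close> a fixed multiple of \<open>q\<close>, the element \<open>g\<close> is not in \<open>P\<close>. Finite rank makes the index
  of \<open>P\<close> polynomial in \<open>m\<close>.

  Otherwise, in the first quotient of \<open>G\<close> by a term of the upper central series of \<open>K\<close> that is not
  virtually nilpotent, some element acts on an abelian section with an eigenvalue that is not
  a root of unity. By Kronecker's theorem there are then \<open>a, u\<close> such that the \<open>2\<^sup>n\<close> words of length
  \<open>n\<close> in \<open>a u\<close> and \<open>u\<close> are distinct. For \<open>m = lcm(1, \<dots>, s)\<close>, which is at most exponential in \<open>s\<close>, the
  index of \<open>P\<close> is at most exponential in \<open>s\<close>, so two such words with \<open>n = O(s)\<close> agree modulo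
  \<open>P\<close>, which lies in every normal subgroup of index at most \<open>s\<close>. Their quotient is nontrivial in
  some finite quotient of \<open>G\<close>: modulo the \<open>p\<close>-th powers of the abelian section, for a large prime
  \<open>p\<close>, the group becomes virtually nilpotent and the first part applies.\<close>

section \<open>Least common multiples and Kronecker's theorem\<close>

text \<open>Three obstacles shape the proof. \<open>K\<close> has finite rank but need not be
  finitely generated, so the rank controls only finite subsets; polynomial index bounds are
  therefore stated for every subgroup containing the \<open>m\<close>-th powers and proved by
  counting cosets met by finite subsets. Finite generation is recovered for lower central terms of
  finite index subgroups, as modules under conjugation. Degrees of polynomial functions must survive
  an extension by an element \<open>t\<close> acting by conjugation. Measured along the lower
  central series of the ambient nilpotent group, conjugation by \<open>t\<close> changes a function
  only by one of smaller degree. For the lower bound, the upper central series of \<open>K\<close>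
  is the right one because its factors inherit torsion-freeness, which factors of the lower central
  series may lose. Kronecker's theorem enters through the ideal of integer polynomials annihilating
  an element: if every power of \<open>u\<close> satisfied a relation with coefficients -1, 0, 1,
  then all powers of all eigenvalues would have modulus less than 2.\<close>

lemma prime_power_dvd_Lcm_upto:
  fixes p :: nat
  assumes p: "Factorial_Ring.prime p" and le: "p ^ a \<le> 2 * n"
  shows "p ^ a dvd Lcm {1..n} * (2 * n choose n)"
proof (cases "p ^ a \<le> n")
  case True
  have "1 \<le> p ^ a" using p by (simp add: prime_gt_0_nat Suc_leI)
  with True have "p ^ a dvd Lcm {1..n}" by (intro dvd_Lcm) auto
  thus ?thesis by simp
next
  case False
  define q where "q = p ^ a"
  have q: "n < q" "q \<le> 2 * n" using False le by (auto simp: q_def)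
  hence n: "n > 0" by linarith
  have "a \<noteq> 0" using q n by (cases a) (auto simp: q_def)
  then obtain b where a: "a = Suc b" by (cases a) auto
  \<comment> \<open>Since \<open>p >= 2\<close>, the next lower power is at most \<open>n\<close>
    and divides the lcm. Only one factor \<open>p\<close> has to come from the central binomial
    coefficient.\<close>
  have "p ^ b \<le> n"
  proof -
    have "2 * p ^ b \<le> p * p ^ b" by (rule mult_right_mono[OF prime_ge_2_nat[OF p]]) simp
    also have "\<dots> \<le> 2 * n" using le a by simp
    finally show ?thesis by simp
  qed
  moreover have "1 \<le> p ^ b" using p by (simp add: prime_gt_0_nat Suc_leI)
  ultimately have d1: "p ^ b dvd Lcm {1..n}" by (intro dvd_Lcm) auto
  \<comment> \<open>Vandermonde for \<open>2 n = q + (2 n - q)\<close>: the term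
    \<open>k = 0\<close> vanishes because \<open>2 n - q < n\<close>, and \<open>p\<close> divides
    \<open>q choose k\<close> for \<open>0 < k < q\<close>.\<close>
  have "(2 * n choose n) = (\<Sum>k\<le>n. (q choose k) * ((2 * n - q) choose (n - k)))"
    using vandermonde[of q "2 * n - q" n] q by simp
  also have "p dvd \<dots>"
  proof (rule dvd_sum)
    fix k assume k: "k \<in> {..n}"
    show "p dvd (q choose k) * ((2 * n - q) choose (n - k))"
    proof (cases "k = 0")
      case True
      have "2 * n - q < n" using q by linarith
      thus ?thesis using True by (simp add: binomial_eq_0)
    next
      case False
      have kq: "0 < k" "k < q" using False k q by auto
      obtain k' where k': "k = Suc k'" using False by (cases k) auto
      obtain q' where q': "q = Suc q'" using kq by (cases q) auto
      have "k * (q choose k) = q * (q' choose k')"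
        unfolding k' q' using Suc_times_binomial_eq[of q' k'] by (simp add: mult.commute)
      hence dv: "p ^ a dvd k * (q choose k)" by (simp add: q_def)
      have "\<not> p ^ a dvd k" using kq q_def by (auto dest: dvd_imp_le)
      hence "p dvd (q choose k)"
      proof (rule contrapos_np)
        assume "\<not> p dvd (q choose k)"
        hence "coprime (p ^ a) (q choose k)" using p by (simp add: prime_imp_coprime)
        thus "p ^ a dvd k" using dv by (simp add: coprime_dvd_mult_left_iff)
      qed
      thus ?thesis by simp
    qed
  qed
  finally have "p dvd (2 * n choose n)" .
  from mult_dvd_mono[OF d1 this] show ?thesis by (simp add: a mult.commute)
qed

text \<open>Each \<open>k\<close> up to \<open>2 n\<close> is checked prime by prime; its prime
  powers are themselves at most \<open>2 n\<close>.\<close>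

lemma Lcm_upto_even_dvd: "Lcm {1..2 * n} dvd Lcm {1..n} * (2 * n choose n :: nat)"
proof (rule Lcm_least)
  fix k :: nat assume k: "k \<in> {1..2 * n}"
  define R where "R = Lcm {1..n} * (2 * n choose n)"
  have R: "R \<noteq> 0" by (auto simp: R_def Lcm_0_iff)
  have "k dvd R"
  proof (rule multiplicity_le_imp_dvd)
    show "k \<noteq> 0" using k by auto
    fix p :: nat assume p: "Factorial_Ring.prime p"
    have "p ^ multiplicity p k dvd k" by (rule multiplicity_dvd)
    hence "p ^ multiplicity p k \<le> 2 * n" using k by (auto dest!: dvd_imp_le)
    hence "p ^ multiplicity p k dvd R" unfolding R_def by (rule prime_power_dvd_Lcm_upto[OF p])
    thus "multiplicity p k \<le> multiplicity p R" 
      using p R by (intro multiplicity_geI) auto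
  qed
  thus "k dvd Lcm {1..n} * (2 * n choose n)" by (simp add: R_def)
qed

lemma Suc_double_le_four_power: "2 * n + 1 \<le> (4::nat) ^ n"
  by (induction n) auto

lemma Lcm_upto_pos: "0 < Lcm {1..n::nat}"
  by (rule Nat.gr0I) (simp add: Lcm_0_iff)

text \<open>Halving costs the central binomial coefficient, at most \<open>4 ^ m\<close>. For odd
  \<open>n = 2 m + 1\<close> the extra number costs another \<open>4 ^ m\<close>, and
  \<open>16 ^ m * 4 ^ m * 4 ^ m = 16 ^ (2 * m)\<close> closes the induction; hence the base
  16.\<close>

lemma Lcm_upto_le: "Lcm {1..n} \<le> 16 ^ (n::nat)"
proof (induction n rule: less_induct)
  case (less n)
  have even: "Lcm {1..2 * m} \<le> 16 ^ m * (4::nat) ^ m" if "2 * m \<le> n" for m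
  proof (cases "m = 0")
    case False
    have "Lcm {1..2 * m} \<le> Lcm {1..m} * (2 * m choose m)"
      by (rule dvd_imp_le[OF Lcm_upto_even_dvd]) (use Lcm_upto_pos[of m] in simp)
    also have "\<dots> \<le> 16 ^ m * 2 ^ (2 * m)"
      using less.IH[of m] False that by (intro mult_mono binomial_le_pow2) auto
    finally show ?thesis by (simp add: power_mult)
  qed auto
  show ?case
  proof (cases "even n")
    case True
    then obtain m where m: "n = 2 * m" by auto
    have "Lcm {1..n} \<le> 16 ^ m * 4 ^ m" using even[of m] m by simp
    also have "\<dots> \<le> 16 ^ m * 16 ^ m" by (intro mult_mono power_mono) auto
    also have "\<dots> = 16 ^ n" by (simp add: m mult_2 power_add)
    finally show ?thesis .
  next
    case False
    then obtain m where m: "n = 2 * m + 1" by (auto elim: oddE)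
    have "{1..n} = insert n {1..2 * m}" using m by auto
    hence "Lcm {1..n} = lcm n (Lcm {1..2 * m})" by simp
    also have "\<dots> \<le> n * Lcm {1..2 * m}"
    proof (rule dvd_imp_le)
      show "0 < n * Lcm {1..2 * m}" using m Lcm_upto_pos[of "2 * m"] by simp
    qed (intro lcm_least dvd_triv_left dvd_triv_right)
    also have "\<dots> \<le> 4 ^ m * (16 ^ m * 4 ^ m)"
      using even[of m] m Suc_double_le_four_power[of m] by (intro mult_mono) auto
    also have "\<dots> = 16 ^ m * 16 ^ m" by (simp flip: power_mult_distrib)
    also have "\<dots> \<le> 16 ^ n" by (simp add: m mult_2 flip: power_add)
    finally show ?thesis .
  qed
qed

text \<open>The beta integral \<open>\<integral> x\<^sup>a (1 - x)\<^sup>b dx = a! b! / (a + b + 1)!\<close> is an integer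
  combination of the fractions \<open>1 / k\<close> with \<open>k \<le> a + b + 1\<close>.\<close>

lemma Lcm_beta_Ints:
  assumes "a + b + 1 \<le> n"
  shows "real (Lcm {1..n}) * (fact a * fact b / fact (a + b + 1)) \<in> \<int>"
  using assms
proof (induction b arbitrary: a)
  case 0
  have "a + 1 dvd Lcm {1..n}" using 0 by (intro dvd_Lcm) auto
  then obtain k where k: "Lcm {1..n} = (a + 1) * k" by blast
  have "(fact a * fact 0 / fact (a + 0 + 1) :: real) = 1 / real (a + 1)"
    by simp
  hence "real (Lcm {1..n}) * (fact a * fact 0 / fact (a + 0 + 1)) = real k"
    unfolding k by (simp add: divide_simps) (simp add: algebra_simps)
  thus ?case by (metis Ints_of_nat)
next
  case (Suc b)
  \<comment> \<open>As integrands: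
    \<open>x^a (1-x)^(b+1) = x^a (1-x)^b - x^(a+1) (1-x)^b\<close>.\<close>
  have eq: "(fact a * fact (Suc b) / fact (a + Suc b + 1) :: real) =
      fact a * fact b / fact (a + b + 1) - fact (Suc a) * fact b / fact (Suc a + b + 1)"
  proof -
    define F where "F = (fact (a + b + 1) :: real)"
    have F: "F > 0" by (simp add: F_def)
    have 1: "fact (a + Suc b + 1) = (real a + real b + 2) * F"
      "fact (Suc a + b + 1) = (real a + real b + 2) * F"
      by (simp_all add: F_def algebra_simps)
    have 2: "fact (Suc b) = (real b + 1) * fact b" "fact (Suc a) = (real a + 1) * fact a"
      by (simp_all add: algebra_simps)
    define t where "t = real a + real b + 2"
    have t: "t > 0" "real b + 1 = t - (real a + 1)" by (simp_all add: t_def)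
    show ?thesis unfolding 1 2 F_def[symmetric] t_def[symmetric] t(2) using F t(1)
      by (simp add: divide_simps) (simp add: algebra_simps)
  qed
  show ?case unfolding eq right_diff_distrib
    by (intro Ints_diff Suc.IH) (use Suc.prems in auto)
qed

text \<open>With \<open>I\<close> the beta integral of \<open>x^k (1-x)^k\<close>, the number
  \<open>L * I\<close> is a positive integer, while \<open>I <= 4^-k\<close> because
  \<open>x (1-x) <= 1/4\<close> on the unit interval; the latter bound is proved here by induction
  on factorials.\<close>

lemma Lcm_upto_ge: "4 ^ k \<le> Lcm {1..2 * k + 1 :: nat}"
proof -
  define L where "L = real (Lcm {1..2 * k + 1})"
  define I :: real where "I = fact k * fact k / fact (k + k + 1)"
  have "L * I \<in> \<int>" unfolding L_def I_def by (rule Lcm_beta_Ints) simp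
  moreover have "0 < L * I" using Lcm_upto_pos[of "2 * k + 1"] by (auto simp: L_def I_def)
  ultimately have "1 \<le> L * I" by (metis Ints_nonzero_abs_ge1 abs_of_pos less_irrefl)
  moreover have "I * 4 ^ k \<le> 1"
  proof -
    have ineq: "4 ^ m * (fact m * fact m) \<le> (fact (2 * m + 1) :: real)" for m
    proof (induction m)
      case (Suc m)
      have "4 ^ Suc m * (fact (Suc m) * fact (Suc m)) = 
          4 * (real m + 1)^2 * (4 ^ m * (fact m * fact m) :: real)"
        by (simp add: power2_eq_square algebra_simps)
      also have "\<dots> \<le> 4 * (real m + 1)^2 * fact (2 * m + 1)"
        by (intro mult_left_mono Suc.IH) auto
      also have "\<dots> \<le> ((2 * real m + 3) * (2 * real m + 2)) * fact (2 * m + 1)"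
        by (intro mult_right_mono) (auto simp: power2_eq_square algebra_simps)
      also have "\<dots> = fact (2 * Suc m + 1)" by (simp add: algebra_simps)
      finally show ?case .
    qed auto
    have "I * 4 ^ k = (4 ^ k * (fact k * fact k)) / fact (2 * k + 1)"
      unfolding I_def mult_2 by simp
    also have "\<dots> \<le> fact (2 * k + 1) / fact (2 * k + 1)"
      by (intro divide_right_mono ineq) auto
    finally show ?thesis by simp
  qed
  ultimately have "4 ^ k \<le> L"
  proof -
    assume a: "1 \<le> L * I" and b: "I * 4 ^ k \<le> 1"
    have "4 ^ k \<le> L * I * 4 ^ k" using a by simp
    also have "\<dots> = L * (I * 4 ^ k)" by simp
    also have "\<dots> \<le> L * 1" using b by (intro mult_left_mono) (auto simp: L_def)
    finally show ?thesis by simp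
  qed
  thus ?thesis unfolding L_def using of_nat_le_iff[where 'a=real] by fastforce
qed

text \<open>A nonzero common multiple of the numbers up to \<open>2 k + 1\<close> is at least their
  lcm, hence at least \<open>4 ^ k\<close>. This is the source of the logarithm in the upper
  bound.\<close>

lemma exists_small_nondivisor:
  fixes v :: int
  assumes "v \<noteq> 0" and "\<bar>v\<bar> < 4 ^ k"
  shows "\<exists>q\<in>{1..2 * k + 1 :: nat}. \<not> int q dvd v"
proof (rule ccontr)
  assume "\<not> ?thesis"
  hence "\<forall>q\<in>{1..2 * k + 1}. q dvd nat \<bar>v\<bar>" by (auto simp: int_dvd_int_iff nat_abs_dvd_iff)
  hence "Lcm {1..2 * k + 1} dvd nat \<bar>v\<bar>" by (intro Lcm_least) auto
  hence "Lcm {1..2 * k + 1} \<le> nat \<bar>v\<bar>" using assms by (intro dvd_imp_le) auto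
  hence "4 ^ k \<le> nat \<bar>v\<bar>" using Lcm_upto_ge[of k] by linarith
  hence "int (4 ^ k) \<le> \<bar>v\<bar>" by linarith
  thus False using assms by simp
qed


section \<open>Complex roots of integer polynomials and Kronecker's theorem\<close>

abbreviation ipolyC :: "int poly \<Rightarrow> complex poly" where
  "ipolyC \<equiv> map_poly of_int"

lemma coeff_ipolyC [simp]: "Polynomial.coeff (ipolyC p) i = of_int (Polynomial.coeff p i)"
  by (simp add: coeff_map_poly)

lemma degree_ipolyC [simp]: "Polynomial.degree (ipolyC p) = Polynomial.degree p"
  by (rule degree_map_poly) simp

lemma ipolyC_eq_0_iff [simp]: "ipolyC p = 0 \<longleftrightarrow> p = 0"
  by (simp add: poly_eq_iff)

lemma ipolyC_mult: "ipolyC (p * q) = ipolyC p * ipolyC q"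
  by (simp add: poly_eq_iff coeff_mult)

lemma ipolyC_add: "ipolyC (p + q) = ipolyC p + ipolyC q"
  by (simp add: poly_eq_iff)

lemma ipolyC_diff: "ipolyC (p - q) = ipolyC p - ipolyC q"
  by (simp add: poly_eq_iff)

lemma ipolyC_smult: "ipolyC (Polynomial.smult c p) = Polynomial.smult (of_int c) (ipolyC p)"
  by (simp add: poly_eq_iff)

lemma ipolyC_pCons: "ipolyC (pCons c p) = pCons (of_int c) (ipolyC p)"
  by (simp add: poly_eq_iff coeff_pCons split: nat.splits)

lemma ipolyC_pcompose: "ipolyC (p \<circ>\<^sub>p q) = ipolyC p \<circ>\<^sub>p ipolyC q"
  by (induction p) (simp_all add: pcompose_pCons ipolyC_add ipolyC_mult ipolyC_pCons)

lemma ipolyC_power: "ipolyC (p ^ n) = ipolyC p ^ n"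
  by (induction n) (simp_all add: ipolyC_mult)

text \<open>Graeffe's root squaring: with \<open>p = e(x\<^sup>2) + x o(x\<^sup>2)\<close> one has
  \<open>p(x) p(-x) = r(x\<^sup>2)\<close> for \<open>r = e\<^sup>2 - x o\<^sup>2\<close>.\<close>

lemma even_odd_parts:
  fixes p :: "'a :: comm_ring_1 poly"
  shows "\<exists>e d. p = e \<circ>\<^sub>p [:0, 0, 1:] + [:0, 1:] * (d \<circ>\<^sub>p [:0, 0, 1:])"
proof (induction p)
  case 0
  show ?case by (intro exI[of _ 0]) simp
next
  case (pCons c p)
  then obtain e d where p: "p = e \<circ>\<^sub>p [:0, 0, 1:] + [:0, 1:] * (d \<circ>\<^sub>p [:0, 0, 1:])" by blast
  have "pCons c p = pCons c d \<circ>\<^sub>p [:0, 0, 1:] + [:0, 1:] * (e \<circ>\<^sub>p [:0, 0, 1:])"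
    by (subst p) (simp add: pcompose_pCons algebra_simps)
  thus ?case by blast
qed

lemma graeffe:
  fixes p :: "int poly"
  shows "\<exists>r. \<forall>z. poly (ipolyC r) (z ^ 2) = poly (ipolyC p) z * poly (ipolyC p) (- z)
     \<and> Polynomial.degree r = Polynomial.degree p
     \<and> \<bar>Polynomial.coeff r (Polynomial.degree r)\<bar> = (Polynomial.coeff p (Polynomial.degree p))\<^sup>2"
proof -
  obtain e d where p: "p = e \<circ>\<^sub>p [:0, 0, 1:] + [:0, 1:] * (d \<circ>\<^sub>p [:0, 0, 1:])"
    using even_odd_parts by blast
  define r where "r = e * e - [:0, 1:] * (d * d)"
  \<comment> \<open>The substitution \<open>x -> -x\<close> fixes everything in \<open>x^2\<close>
    and flips only the sign of the odd part.\<close>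
  have minus: "p \<circ>\<^sub>p [:0, -1:] = e \<circ>\<^sub>p [:0, 0, 1:] - [:0, 1:] * (d \<circ>\<^sub>p [:0, 0, 1:])"
  proof -
    have "[:0, 0, 1::int:] \<circ>\<^sub>p [:0, -1:] = [:0, 0, 1:]" by (simp add: pcompose_pCons)
    thus ?thesis by (subst p) (simp add: pcompose_add pcompose_mult pcompose_pCons flip: pcompose_assoc)
  qed
  have rp: "r \<circ>\<^sub>p [:0, 0, 1:] = p * (p \<circ>\<^sub>p [:0, -1:])"
    unfolding minus
    by (subst p) (simp add: r_def pcompose_diff pcompose_mult pcompose_pCons algebra_simps)
  have eq: "poly (ipolyC r) (z ^ 2) = poly (ipolyC p) z * poly (ipolyC p) (- z)" for z
  proof -
    have "poly (ipolyC (r \<circ>\<^sub>p [:0, 0, 1:])) z = poly (ipolyC (p * (p \<circ>\<^sub>p [:0, -1:]))) z"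
      by (simp add: rp)
    thus ?thesis
      by (simp add: ipolyC_pcompose ipolyC_mult poly_pcompose ipolyC_pCons power2_eq_square)
  qed
  have "Polynomial.degree (r \<circ>\<^sub>p [:0, 0, 1:]) = Polynomial.degree (p * (p \<circ>\<^sub>p [:0, -1:]))"
    by (simp add: rp)
  hence deg: "Polynomial.degree r = Polynomial.degree p"
  proof (cases "p = 0")
    case False
    have "p \<circ>\<^sub>p [:0, -1:] \<noteq> 0" using False by (subst pcompose_eq_0_iff) auto
    hence "Polynomial.degree (p * (p \<circ>\<^sub>p [:0, -1:])) = 2 * Polynomial.degree p"
      using False by (simp add: degree_mult_eq degree_pcompose)
    thus ?thesis using \<open>Polynomial.degree (r \<circ>\<^sub>p _) = _\<close> by (simp add: degree_pcompose)
  qed (simp add: degree_pcompose)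
  have "Polynomial.coeff (r \<circ>\<^sub>p [:0, 0, 1:]) (Polynomial.degree (r \<circ>\<^sub>p [:0, 0, 1:])) =
      Polynomial.coeff (p * (p \<circ>\<^sub>p [:0, -1:])) (Polynomial.degree (p * (p \<circ>\<^sub>p [:0, -1:])))"
    by (simp add: rp)
  hence "Polynomial.coeff r (Polynomial.degree r) =
      Polynomial.coeff p (Polynomial.degree p) * (Polynomial.coeff p (Polynomial.degree p) * (- 1) ^ Polynomial.degree p)"
    by (subst (asm) lead_coeff_comp, simp, subst (asm) lead_coeff_mult, subst (asm) lead_coeff_comp) simp_all
  hence "\<bar>Polynomial.coeff r (Polynomial.degree r)\<bar> = (Polynomial.coeff p (Polynomial.degree p))\<^sup>2"
    by (simp add: abs_mult power_abs power2_eq_square)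
  with deg eq show ?thesis by blast
qed

text \<open>The leading coefficient is fixed only up to sign because root squaring may change the
  sign.\<close>

definition unit_disc_polys :: "nat \<Rightarrow> int poly set" where
  "unit_disc_polys d = {p. Polynomial.degree p = d \<and> \<bar>Polynomial.coeff p d\<bar> = 1 \<and>
     (\<forall>z. poly (ipolyC p) z = 0 \<longrightarrow> norm z \<le> 1)}"

text \<open>Multiplication by \<open>x - z\<close> with \<open>|z| <= 1\<close> at most doubles a
  bound on the coefficients. This crude estimate is enough for finiteness.\<close>

lemma norm_coeff_prod_mset_linear_le:
  fixes A :: "complex multiset"
  assumes "\<forall>z\<in>#A. norm z \<le> 1"
  shows "norm (Polynomial.coeff (\<Prod>z\<in>#A. [:- z, 1:]) i) \<le> 2 ^ size A"
  using assms
proof (induction A arbitrary: i)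
  case empty
  show ?case by (auto simp: Polynomial.coeff_1 split: if_splits)
next
  case (add z A)
  define q where "q = (\<Prod>z\<in>#A. [:- z, 1:])"
  have IH: "norm (Polynomial.coeff q i) \<le> 2 ^ size A" for i using add by (simp add: q_def)
  have "norm (- z * Polynomial.coeff q i) \<le> 2 ^ size A"
    using mult_mono[of "norm z" 1 "norm (Polynomial.coeff q i)" "2 ^ size A"] add.prems IH
    by (simp add: norm_mult)
  moreover have "norm (Polynomial.coeff (pCons 0 q) i) \<le> 2 ^ size A"
    using IH by (cases i) (auto simp: coeff_pCons)
  ultimately have "norm (- z * Polynomial.coeff q i + Polynomial.coeff (pCons 0 q) i) \<le> 2 ^ size A + 2 ^ size A"
    by (rule norm_triangle_mono)
  thus ?case by (simp add: q_def)
qed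

lemma abs_coeff_unit_disc_polys:
  assumes "p \<in> unit_disc_polys d"
  shows "\<bar>Polynomial.coeff p i\<bar> \<le> 2 ^ d"
proof -
  have "ipolyC p \<noteq> 0" using assms by (auto simp: unit_disc_polys_def)
  from alg_closed_imp_factorization[OF this]
  obtain A where A: "size A = Polynomial.degree (ipolyC p)"
    "ipolyC p = Polynomial.smult (Polynomial.coeff (ipolyC p) (Polynomial.degree (ipolyC p))) (\<Prod>x\<in>#A. [:- x, 1:])"
    by blast
  define l :: complex where "l = of_int (Polynomial.coeff p d)"
  have l: "norm l = 1" using assms by (simp add: unit_disc_polys_def l_def flip: of_int_abs)
  have dp: "Polynomial.degree p = d" using assms by (simp add: unit_disc_polys_def)
  have p: "ipolyC p = Polynomial.smult l (\<Prod>x\<in>#A. [:- x, 1:])"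
    using A(2) dp by (simp add: l_def)
  have "norm z \<le> 1" if "z \<in># A" for z
  proof -
    have "poly (ipolyC p) z = 0" unfolding p using that
      by (auto simp: poly_prod_mset prod_mset_zero_iff)
    thus ?thesis using assms by (auto simp: unit_disc_polys_def)
  qed
  hence "norm (Polynomial.coeff (\<Prod>x\<in>#A. [:- x, 1:]) i) \<le> 2 ^ size A"
    by (intro norm_coeff_prod_mset_linear_le) auto
  moreover have "size A = d" using A(1) dp by simp
  ultimately have "norm (Polynomial.coeff (ipolyC p) i) \<le> 2 ^ d"
    using l by (simp add: p norm_mult del: coeff_ipolyC)
  hence "real_of_int \<bar>Polynomial.coeff p i\<bar> \<le> of_int (2 ^ d)" by simp
  thus ?thesis by (simp only: of_int_le_iff)
qed

lemma finite_unit_disc_polys: "finite (unit_disc_polys d)"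
proof (rule finite_subset)
  let ?L = "{xs. set xs \<subseteq> {- (2 ^ d) .. 2 ^ d :: int} \<and> length xs \<le> d + 1}"
  show "finite (Poly ` ?L)" by (intro finite_imageI finite_lists_length_le) simp
  show "unit_disc_polys d \<subseteq> Poly ` ?L"
  proof
    fix p assume p: "p \<in> unit_disc_polys d"
    have "set (coeffs p) \<subseteq> {- (2 ^ d) .. 2 ^ d}"
    proof
      fix c assume "c \<in> set (coeffs p)"
      then obtain i where "c = Polynomial.coeff p i" by (auto simp: coeffs_def split: if_splits)
      thus "c \<in> {- (2 ^ d) .. 2 ^ d}" using abs_coeff_unit_disc_polys[OF p, of i] by (simp add: abs_le_iff)
    qed
    moreover have "length (coeffs p) \<le> d + 1"
      using p by (auto simp: unit_disc_polys_def length_coeffs_degree coeffs_def)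
    ultimately show "p \<in> Poly ` ?L" by (intro image_eqI[of _ _ "coeffs p"]) auto
  qed
qed

text \<open>Root squaring maps the class to itself, so the finite set \<open>R\<close> of all roots
  of its members is closed under squaring. Two of the powers \<open>z^(2^k)\<close> therefore
  coincide, and \<open>z\<close> can be cancelled because it is nonzero.\<close>

lemma kronecker_root_of_unity:
  assumes "p \<in> unit_disc_polys d" and "poly (ipolyC p) z = 0" and "z \<noteq> 0"
  shows "\<exists>n>0. z ^ n = 1"
proof -
  define R where "R = (\<Union>q\<in>unit_disc_polys d. {w. poly (ipolyC q) w = 0})"
  have "q \<noteq> 0" if "q \<in> unit_disc_polys d" for q
    using that by (auto simp: unit_disc_polys_def)
  hence "finite R" unfolding R_def
    by (intro finite_UN_I finite_unit_disc_polys poly_roots_finite) simp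
  have sq: "w ^ 2 \<in> R" if w: "w \<in> R" for w
  proof -
    obtain q where q: "q \<in> unit_disc_polys d" "poly (ipolyC q) w = 0" using w unfolding R_def by blast
    obtain r where r: "\<And>z. poly (ipolyC r) (z ^ 2) = poly (ipolyC q) z * poly (ipolyC q) (- z)"
      "Polynomial.degree r = Polynomial.degree q"
      "\<bar>Polynomial.coeff r (Polynomial.degree r)\<bar> = (Polynomial.coeff q (Polynomial.degree q))\<^sup>2"
      using graeffe[of q] by blast
    have "norm u \<le> 1" if "poly (ipolyC r) u = 0" for u
    proof -
      \<comment> \<open>Every root of the squared polynomial is the square of a root of
        \<open>q\<close>; only the sign of its square root is undetermined.\<close>
      have "poly (ipolyC q) (csqrt u) = 0 \<or> poly (ipolyC q) (- csqrt u) = 0"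
        using r(1)[of "csqrt u"] that by simp
      hence "norm (csqrt u) \<le> 1" using q(1) by (auto simp: unit_disc_polys_def)
      hence "norm (csqrt u ^ 2) \<le> 1" by (simp only: norm_power power_le_one norm_ge_zero)
      thus ?thesis by simp
    qed
    moreover have "\<bar>Polynomial.coeff r d\<bar> = 1"
      using r(2,3) q(1) by (auto simp: unit_disc_polys_def power2_eq_square abs_mult_self_eq)
        (metis abs_mult_self_eq mult_1)
    ultimately have "r \<in> unit_disc_polys d" using q(1) r(2) by (auto simp: unit_disc_polys_def)
    moreover have "poly (ipolyC r) (w ^ 2) = 0" using r(1) q(2) by simp
    ultimately show ?thesis by (auto simp: R_def)
  qed
  have "z ^ (2 ^ k) \<in> R" for k
  proof (induction k)
    case 0
    show ?case using assms by (auto simp: R_def)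
  next
    case (Suc k)
    have "z ^ (2 ^ Suc k) = (z ^ (2 ^ k)) ^ 2" by (simp add: mult.commute flip: power_mult)
    thus ?case using sq[OF Suc] by simp
  qed
  hence "range (\<lambda>k. z ^ (2 ^ k)) \<subseteq> R" by auto
  hence "\<not> inj (\<lambda>k::nat. z ^ (2 ^ k))"
    using \<open>finite R\<close> finite_subset range_inj_infinite by blast
  then obtain i j :: nat where ij: "i < j" "z ^ (2 ^ i) = z ^ (2 ^ j)"
    unfolding inj_on_def by (metis nat_neq_iff)
  have lt: "(2::nat) ^ i < 2 ^ j" using ij(1) by simp
  have "z ^ (2 ^ j) = z ^ (2 ^ i) * z ^ (2 ^ j - 2 ^ i)"
    using lt by (simp flip: power_add)
  hence "z ^ (2 ^ j - 2 ^ i) = 1" using ij(2) assms(3) by simp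
  thus ?thesis using lt by (intro exI[of _ "2 ^ j - 2 ^ i"]) auto
qed


section \<open>Ideals containing relations with coefficients -1, 0, 1\<close>

text \<open>These are the nonzero differences of two 0/1 polynomials, the form in which two positive
  words in \<open>a u\<close> and \<open>u\<close> are compared.\<close>

definition small_poly :: "int poly \<Rightarrow> bool" where
  "small_poly F \<longleftrightarrow> F \<noteq> 0 \<and> (\<forall>i. Polynomial.coeff F i \<in> {-1, 0, 1})"

text \<open>In a Horner step a tail of modulus at least 1 grows to at least 2, and adding a
  coefficient of modulus at most 1 leaves at least 1. So no root has modulus 2 or more.\<close>

lemma small_poly_eval:
  assumes "small_poly F" and "norm z \<ge> 2"
  shows "norm (poly (ipolyC F) z) \<ge> 1"
  using assms
proof (induction F)
  case 0
  thus ?case by (simp add: small_poly_def)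
next
  case (pCons c F)
  have "Polynomial.coeff (pCons c F) 0 \<in> {-1, 0, 1}" using pCons.prems unfolding small_poly_def by blast
  hence c: "c \<in> {-1, 0, 1}" by simp
  have cf: "Polynomial.coeff F i \<in> {-1, 0, 1}" for i
  proof -
    have "Polynomial.coeff (pCons c F) (Suc i) \<in> {-1, 0, 1}" using pCons.prems unfolding small_poly_def by blast
    thus ?thesis by simp
  qed
  show ?case
  proof (cases "F = 0")
    case True
    thus ?thesis using c pCons.hyps by (auto simp: ipolyC_pCons)
  next
    case False
    hence "1 \<le> norm (poly (ipolyC F) z)" using pCons cf by (auto simp: small_poly_def)
    hence "2 * 1 \<le> norm z * norm (poly (ipolyC F) z)" using pCons.prems by (intro mult_mono) auto
    moreover have "norm (of_int c :: complex) \<le> 1" using c by auto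
    moreover have "norm (z * poly (ipolyC F) z) \<le> norm (of_int c + z * poly (ipolyC F) z) + norm (of_int c :: complex)"
      using norm_triangle_ineq4[of "of_int c + z * poly (ipolyC F) z" "of_int c"] by simp
    ultimately show ?thesis by (simp add: ipolyC_pCons norm_mult)
  qed
qed

lemma small_poly_lead:
  assumes "small_poly F"
  shows "\<bar>Polynomial.coeff F (Polynomial.degree F)\<bar> = 1"
proof -
  have "Polynomial.coeff F (Polynomial.degree F) \<noteq> 0" using assms by (simp add: small_poly_def)
  moreover have "Polynomial.coeff F (Polynomial.degree F) \<in> {-1, 0, 1}"
    using assms unfolding small_poly_def by blast
  ultimately show ?thesis by auto
qed

lemma norm_le_1_if_powers_bounded:
  fixes z :: complex
  assumes "\<And>k. k > 0 \<Longrightarrow> norm (z ^ k) < 2"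
  shows "norm z \<le> 1"
proof (rule ccontr)
  assume "\<not> norm z \<le> 1"
  then obtain n where n: "2 < norm z ^ n" using real_arch_pow[of "norm z" 2] by auto
  hence "n > 0" by (cases n) auto
  thus False using assms[of n] n by (simp add: norm_power)
qed

text \<open>Each linear factor of \<open>p\<close> divides \<open>q\<close>; one copy of
  \<open>q\<close> per linear factor takes care of multiplicities.\<close>

lemma dvd_power_of_roots:
  fixes p q :: "complex poly"
  assumes "p \<noteq> 0" and "\<And>z. poly p z = 0 \<Longrightarrow> poly q z = 0"
  shows "p dvd q ^ Polynomial.degree p"
proof -
  obtain A where A: "size A = Polynomial.degree p"
    "p = Polynomial.smult (Polynomial.coeff p (Polynomial.degree p)) (\<Prod>x\<in>#A. [:- x, 1:])"
    using alg_closed_imp_factorization[OF assms(1)] by blast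
  have rt: "poly q z = 0" if "z \<in># A" for z
    using that by (intro assms(2)) (subst A(2), auto simp: poly_prod_mset prod_mset_zero_iff)
  have "(\<Prod>x\<in>#A. [:- x, 1:]) dvd q ^ size A"
    using rt
  proof (induction A)
    case (add x A)
    have "[:- x, 1:] dvd q" using add.prems by (simp add: poly_eq_0_iff_dvd)
    thus ?case using add by (simp add: mult_dvd_mono del: mult_pCons_left)
  qed simp
  hence "Polynomial.smult (Polynomial.coeff p (Polynomial.degree p)) (\<Prod>x\<in>#A. [:- x, 1:]) dvd q ^ size A"
    using assms(1) by (simp add: smult_dvd_iff)
  thus ?thesis using A by simp
qed

text \<open>A generator \<open>p\<close> of the ideal divides all \<open>F\<^sub>k(x\<^sup>k)\<close>, so it has leading coefficient
  \<open>\<plusminus>1\<close> and all its roots in the closed unit disc; by Kronecker they are roots of unity.\<close>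

lemma quasi_unipotent_poly_ideal:
  fixes I :: "int poly \<Rightarrow> bool"
  assumes add: "\<And>p q. I p \<Longrightarrow> I q \<Longrightarrow> I (p - q)"
    and mult: "\<And>p q. I p \<Longrightarrow> I (p * q)"
    and pure: "\<And>c p. c \<noteq> 0 \<Longrightarrow> I (Polynomial.smult c p) \<Longrightarrow> I p"
    and xpure: "\<And>p. I (pCons 0 p) \<Longrightarrow> I p"
    and small: "\<And>k. k > 0 \<Longrightarrow> \<exists>F. small_poly F \<and> I (F \<circ>\<^sub>p Polynomial.monom 1 k)"
  shows "\<exists>N>0. \<exists>d. I ((Polynomial.monom 1 N - 1) ^ d)"
proof -
  define P where "P = (\<lambda>p. p \<noteq> 0 \<and> I p)"
  define Fk where "Fk k = (SOME F. small_poly F \<and> I (F \<circ>\<^sub>p Polynomial.monom 1 k))" for k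
  have Fk: "small_poly (Fk k)" "I (Fk k \<circ>\<^sub>p Polynomial.monom 1 k)" if "k > 0" for k
    using someI_ex[OF small[OF that]] by (auto simp: Fk_def)
  have deg_monom: "Polynomial.degree (Polynomial.monom (1::int) k) = k" for k
    by (simp add: Polynomial.degree_monom_eq)
  have Fk0: "Fk k \<circ>\<^sub>p Polynomial.monom 1 k \<noteq> 0" if "k > 0" for k
    using Fk(1)[OF that] that by (subst pcompose_eq_0_iff) (auto simp: deg_monom small_poly_def)
  have "P (Fk 1 \<circ>\<^sub>p Polynomial.monom 1 1)" using Fk(2)[of 1] Fk0[of 1] by (simp add: P_def)
  \<comment> \<open>A nonzero member of least degree is made primitive below. Purity keeps the
    primitive part in the ideal, so it generates the ideal up to integer multiples.\<close>
  from ex_has_least_nat[of P, OF this, of Polynomial.degree]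
  obtain p0 where p0: "P p0" and min0: "\<And>q. P q \<Longrightarrow> Polynomial.degree p0 \<le> Polynomial.degree q"
    by blast
  define p where "p = primitive_part p0"
  have p0': "p0 = Polynomial.smult (content p0) p" by (simp add: p_def)
  have c0: "content p0 \<noteq> 0" using p0 by (simp add: P_def)
  have Ip: "I p" using pure[OF c0] p0 p0' by (simp add: P_def)
  have pn0: "p \<noteq> 0" using p0 p0' by (auto simp: P_def)
  have contp: "content p = 1" using p0 by (simp add: p_def P_def)
  have min: "Polynomial.degree p \<le> Polynomial.degree q" if "q \<noteq> 0" "I q" for q
  proof -
    have "Polynomial.degree p = Polynomial.degree p0" by (simp add: p_def)
    thus ?thesis using min0[of q] that by (simp add: P_def)
  qed
  have I0: "I 0" using add[OF Ip Ip] by simp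
  \<comment> \<open>Over the integers division works only after multiplying by a power of the
    leading coefficient of \<open>p\<close>.\<close>
  have division: "\<exists>c q. c \<noteq> 0 \<and> Polynomial.smult c F = p * q" if "I F" for F
  proof -
    obtain q r where qr: "pseudo_divmod F p = (q, r)" by (cases "pseudo_divmod F p") auto
    define c where "c = Polynomial.coeff p (Polynomial.degree p) ^ (Suc (Polynomial.degree F) - Polynomial.degree p)"
    have c: "c \<noteq> 0" using pn0 by (simp add: c_def)
    have eq: "Polynomial.smult c F = p * q + r" and r: "r = 0 \<or> Polynomial.degree r < Polynomial.degree p"
      using pseudo_divmod[OF pn0 qr] by (auto simp: c_def)
    have "r = F * [:c:] - p * q" using eq by simp
    hence "I r" using add mult Ip that by metis
    hence "r = 0" using r min by fastforce
    thus ?thesis using eq c by auto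
  qed
  have lead: "\<bar>Polynomial.coeff p (Polynomial.degree p)\<bar> = 1"
  proof -
    define F where "F = Fk 1"
    have "Polynomial.monom (1::int) 1 = [:0, 1:]" by (simp add: Polynomial.monom_Suc Polynomial.monom_0)
    hence F: "small_poly F" "I F" using Fk[of 1] by (simp_all add: F_def pcompose_idR)
    obtain c q where cq: "c \<noteq> 0" "Polynomial.smult c F = p * q" using division[OF F(2)] by blast
    have leadF: "\<bar>Polynomial.coeff F (Polynomial.degree F)\<bar> = 1" by (rule small_poly_lead[OF F(1)])
    \<comment> \<open>Gauss's lemma: \<open>F\<close> and \<open>p\<close> have content 1, so
      \<open>|c|\<close> is the content of \<open>q\<close> and does not exceed the leading
      coefficient of \<open>q\<close>. Comparing leading coefficients in \<open>c F = p q\<close>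
      bounds that of \<open>p\<close> by 1.\<close>
    have "content F dvd Polynomial.coeff F (Polynomial.degree F)" by (rule content_dvd_coeff)
    hence "content F dvd 1" using leadF by (metis dvd_abs_iff)
    hence "content F = 1" by (metis is_unit_normalize normalize_content)
    hence "\<bar>c\<bar> = content q"
      using arg_cong[OF cq(2), of content] contp by (simp add: content_mult abs_mult)
    moreover have "content q dvd Polynomial.coeff q (Polynomial.degree q)" by (rule content_dvd_coeff)
    moreover have q0: "q \<noteq> 0" using cq F by (auto simp: small_poly_def)
    ultimately have le: "\<bar>c\<bar> \<le> \<bar>Polynomial.coeff q (Polynomial.degree q)\<bar>"
      using dvd_imp_le_int[of "Polynomial.coeff q (Polynomial.degree q)" "content q"] by auto
    have "Polynomial.coeff (Polynomial.smult c F) (Polynomial.degree (Polynomial.smult c F)) =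
        Polynomial.coeff p (Polynomial.degree p) * Polynomial.coeff q (Polynomial.degree q)"
      by (simp only: cq(2) lead_coeff_mult)
    hence "c * Polynomial.coeff F (Polynomial.degree F) =
        Polynomial.coeff p (Polynomial.degree p) * Polynomial.coeff q (Polynomial.degree q)"
      using cq(1) by simp
    hence "\<bar>c\<bar> = \<bar>Polynomial.coeff p (Polynomial.degree p)\<bar> * \<bar>Polynomial.coeff q (Polynomial.degree q)\<bar>"
      using leadF by (metis abs_mult mult.right_neutral)
    hence "\<bar>Polynomial.coeff p (Polynomial.degree p)\<bar> * \<bar>Polynomial.coeff q (Polynomial.degree q)\<bar>
        \<le> 1 * \<bar>Polynomial.coeff q (Polynomial.degree q)\<bar>" using le by simp
    hence "\<bar>Polynomial.coeff p (Polynomial.degree p)\<bar> \<le> 1"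
      using q0 by (subst (asm) mult_le_cancel_right_pos) auto
    moreover have "Polynomial.coeff p (Polynomial.degree p) \<noteq> 0" using pn0 by simp
    ultimately show ?thesis by linarith
  qed
  \<comment> \<open>A root \<open>z\<close> of \<open>p\<close> makes each \<open>z^k\<close> a root
    of a small polynomial, hence of modulus less than 2 for all \<open>k > 0\<close>.\<close>
  have roots: "norm z \<le> 1" if z: "poly (ipolyC p) z = 0" for z
  proof (rule norm_le_1_if_powers_bounded)
    fix k :: nat assume k: "k > 0"
    obtain c q where cq: "c \<noteq> 0" "Polynomial.smult c (Fk k \<circ>\<^sub>p Polynomial.monom 1 k) = p * q"
      using division[OF Fk(2)[OF k]] by blast
    have "poly (ipolyC (Polynomial.smult c (Fk k \<circ>\<^sub>p Polynomial.monom 1 k))) z = 0"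
      unfolding cq(2) by (simp add: ipolyC_mult z)
    moreover have "ipolyC (Polynomial.monom 1 k) = Polynomial.monom 1 k"
      by (simp add: map_poly_monom)
    ultimately have "poly (ipolyC (Fk k)) (z ^ k) = 0"
      using cq(1) by (simp add: ipolyC_smult ipolyC_pcompose poly_pcompose poly_monom)
    thus "norm (z ^ k) < 2" using small_poly_eval[OF Fk(1)[OF k], of "z ^ k"] by force
  qed
  have P: "p \<in> unit_disc_polys (Polynomial.degree p)"
    using lead roots by (auto simp: unit_disc_polys_def)
  \<comment> \<open>A zero root would give \<open>p = x q\<close> with \<open>q\<close> in the ideal
    and of smaller degree.\<close>
  have nz: "z \<noteq> 0" if z: "poly (ipolyC p) z = 0" for z
  proof
    assume "z = 0"
    hence "Polynomial.coeff p 0 = 0" using z by (simp add: poly_0_coeff_0)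
    then obtain q where q: "p = pCons 0 q" by (cases p) auto
    have "q \<noteq> 0" using q pn0 by auto
    moreover have "I q" using xpure Ip q by simp
    ultimately show False using min[of q] q by simp
  qed
  define Z where "Z = {z. poly (ipolyC p) z = 0}"
  have finZ: "finite Z" unfolding Z_def using pn0 by (intro poly_roots_finite) simp
  have "\<forall>z\<in>Z. \<exists>n>0. z ^ n = 1" using kronecker_root_of_unity[OF P] nz by (auto simp: Z_def)
  then obtain n where n: "\<And>z. z \<in> Z \<Longrightarrow> n z > (0::nat)" "\<And>z. z \<in> Z \<Longrightarrow> z ^ n z = 1" by metis
  define N where "N = prod n Z"
  have N: "N > 0" unfolding N_def using n(1) by (intro prod_pos) auto
  have zN: "z ^ N = 1" if "z \<in> Z" for z
  proof -
    have "n z dvd N" unfolding N_def using that finZ by (intro dvd_prodI) auto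
    thus ?thesis using n(2)[OF that] by (auto simp: power_mult)
  qed
  define Y where "Y = (Polynomial.monom (1::int) N - 1)"
  define F where "F = Y ^ Polynomial.degree p"
  have Y: "ipolyC Y = Polynomial.monom 1 N - 1" by (simp add: Y_def ipolyC_diff map_poly_monom)
  have dvd: "ipolyC p dvd ipolyC F"
  proof -
    have "ipolyC p dvd ipolyC Y ^ Polynomial.degree (ipolyC p)"
    proof (rule dvd_power_of_roots)
      show "ipolyC p \<noteq> 0" using pn0 by simp
      fix z assume "poly (ipolyC p) z = 0"
      hence "z ^ N = 1" using zN by (simp add: Z_def)
      thus "poly (ipolyC Y) z = 0" by (simp add: Y poly_monom)
    qed
    thus ?thesis by (simp add: F_def ipolyC_power)
  qed
  \<comment> \<open>Over the complex numbers \<open>p\<close> divides \<open>F\<close>, hence also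
    the remainder, which vanishes for degree reasons. So divisibility descends to a nonzero integer
    multiple of \<open>F\<close>.\<close>
  obtain q r where qr: "pseudo_divmod F p = (q, r)" by (cases "pseudo_divmod F p") auto
  define c where "c = Polynomial.coeff p (Polynomial.degree p) ^ (Suc (Polynomial.degree F) - Polynomial.degree p)"
  have c: "c \<noteq> 0" using pn0 by (simp add: c_def)
  have eq: "Polynomial.smult c F = p * q + r" and r: "r = 0 \<or> Polynomial.degree r < Polynomial.degree p"
    using pseudo_divmod[OF pn0 qr] by (auto simp: c_def)
  have "ipolyC r = Polynomial.smult (of_int c) (ipolyC F) - ipolyC p * ipolyC q"
    using arg_cong[OF eq, of ipolyC] by (simp add: ipolyC_smult ipolyC_add ipolyC_mult)
  hence "ipolyC p dvd ipolyC r" using dvd by (simp add: dvd_smult)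
  hence "r = 0" using r dvd_imp_degree_le[of "ipolyC p" "ipolyC r"] by fastforce
  hence "I (Polynomial.smult c F)" using eq mult[OF Ip] by simp
  hence "I F" using pure c by blast
  thus ?thesis using N unfolding F_def Y_def by blast
qed

section \<open>Commutators, power subgroups and coset coverings\<close>

definition commt :: "('a, 'b) monoid_scheme \<Rightarrow> 'a \<Rightarrow> 'a \<Rightarrow> 'a" where
  "commt G x y = x \<otimes>\<^bsub>G\<^esub> y \<otimes>\<^bsub>G\<^esub> inv\<^bsub>G\<^esub> x \<otimes>\<^bsub>G\<^esub> inv\<^bsub>G\<^esub> y"

definition conjg :: "('a, 'b) monoid_scheme \<Rightarrow> 'a \<Rightarrow> 'a \<Rightarrow> 'a" where
  "conjg G x y = x \<otimes>\<^bsub>G\<^esub> y \<otimes>\<^bsub>G\<^esub> inv\<^bsub>G\<^esub> x"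

text \<open>Only an inclusion: for infinite \<open>M\<close> a conjugate of \<open>M\<close> may be
  a proper subset. Statements about a single element therefore mention its inverse as well.\<close>

definition normalizes :: "('a, 'b) monoid_scheme \<Rightarrow> 'a set \<Rightarrow> 'a set \<Rightarrow> bool" where
  "normalizes G H M \<longleftrightarrow> (\<forall>h\<in>H. \<forall>m\<in>M. conjg G h m \<in> M)"

text \<open>The lower central series of \<open>H\<close>, computed in the ambient group so that the
  series of different subgroups can be compared directly.\<close>

primrec lcs :: "('a, 'b) monoid_scheme \<Rightarrow> 'a set \<Rightarrow> nat \<Rightarrow> 'a set" where
  "lcs G H 0 = H"
| "lcs G H (Suc n) = generate G {commt G x y | x y. x \<in> H \<and> y \<in> lcs G H n}"

text \<open>For a generating set \<open>S\<close> of \<open>H\<close> these are normal generators of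
  the corresponding lower central term, see \<open>lcs_eq_nclosure\<close>.\<close>

primrec left_comms :: "('a, 'b) monoid_scheme \<Rightarrow> 'a set \<Rightarrow> nat \<Rightarrow> 'a set" where
  "left_comms G S 0 = S"
| "left_comms G S (Suc n) = {commt G s y | s y. s \<in> S \<and> y \<in> left_comms G S n}"

definition nclosure :: "('a, 'b) monoid_scheme \<Rightarrow> 'a set \<Rightarrow> 'a set \<Rightarrow> 'a set" where
  "nclosure G H Y = generate G {conjg G h y | h y. h \<in> H \<and> y \<in> Y}"

text \<open>Stands in for many finite quotients at once: for \<open>U\<close> the whole group it
  lies in every normal subgroup whose index divides \<open>m\<close>.\<close>

definition power_subgroup :: "('a, 'b) monoid_scheme \<Rightarrow> 'a set \<Rightarrow> nat \<Rightarrow> 'a set" where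
  "power_subgroup G U m = generate G {x [^]\<^bsub>G\<^esub> m | x. x \<in> U}"

text \<open>For subgroups: the intersection of \<open>U\<close> and \<open>B\<close> has index at
  most \<open>k\<close> in \<open>U\<close>, expressed by left coset representatives.
  \<open>B\<close> need not lie in \<open>U\<close>.\<close>

definition covered :: "('a, 'b) monoid_scheme \<Rightarrow> 'a set \<Rightarrow> 'a set \<Rightarrow> nat \<Rightarrow> bool" where
  "covered G U B k \<longleftrightarrow> (\<exists>T. finite T \<and> T \<subseteq> U \<and> card T \<le> k \<and> (\<forall>x\<in>U. \<exists>t\<in>T. \<exists>b\<in>B. x = t \<otimes>\<^bsub>G\<^esub> b))"

text \<open>Polynomial index growth of power subgroups of \<open>U\<close> relative to
  \<open>Y\<close>. Quantifying over every \<open>B\<close> allows direct application to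
  intersections and products of subgroups when bounds are multiplied along a series.\<close>

definition power_bounded :: "('a, 'b) monoid_scheme \<Rightarrow> 'a set \<Rightarrow> 'a set \<Rightarrow> bool" where
  "power_bounded G U Y \<longleftrightarrow> (\<exists>c d. \<forall>m>0. \<forall>B. subgroup B G \<and> Y \<subseteq> B \<and> (\<forall>x\<in>U. x [^]\<^bsub>G\<^esub> m \<in> B)
      \<longrightarrow> covered G U B (c * m ^ d))"

text \<open>Products of exactly \<open>n\<close> letters, so spheres may overlap and need not be
  nested. Inverses are available only if \<open>S\<close> contains them.\<close>

primrec sphere :: "('a, 'b) monoid_scheme \<Rightarrow> 'a set \<Rightarrow> nat \<Rightarrow> 'a set" where
  "sphere G S 0 = {\<one>\<^bsub>G\<^esub>}"
| "sphere G S (Suc n) = {s \<otimes>\<^bsub>G\<^esub> g | s g. s \<in> S \<and> g \<in> sphere G S n}"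

context group
begin

lemma inv_cancel_left [simp]: "x \<in> carrier G \<Longrightarrow> y \<in> carrier G \<Longrightarrow> inv x \<otimes> (x \<otimes> y) = y"
  by (simp flip: m_assoc)

lemma inv_cancel_right [simp]: "x \<in> carrier G \<Longrightarrow> y \<in> carrier G \<Longrightarrow> x \<otimes> (inv x \<otimes> y) = y"
  by (simp flip: m_assoc)

lemmas grp = m_assoc inv_mult_group commt_def conjg_def

lemma commt_closed [simp]: "x \<in> carrier G \<Longrightarrow> y \<in> carrier G \<Longrightarrow> commt G x y \<in> carrier G"
  by (simp add: commt_def)

lemma conjg_closed [simp]: "x \<in> carrier G \<Longrightarrow> y \<in> carrier G \<Longrightarrow> conjg G x y \<in> carrier G"
  by (simp add: conjg_def)

lemma conjg_mult: "x \<in> carrier G \<Longrightarrow> y \<in> carrier G \<Longrightarrow> z \<in> carrier G \<Longrightarrow>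
    conjg G x (y \<otimes> z) = conjg G x y \<otimes> conjg G x z"
  by (simp add: grp)

lemma conjg_mult_left: "x \<in> carrier G \<Longrightarrow> y \<in> carrier G \<Longrightarrow> z \<in> carrier G \<Longrightarrow>
    conjg G (x \<otimes> y) z = conjg G x (conjg G y z)"
  by (simp add: grp)

lemma conjg_inv: "x \<in> carrier G \<Longrightarrow> y \<in> carrier G \<Longrightarrow> conjg G x (inv y) = inv (conjg G x y)"
  by (simp add: grp)

lemma conjg_one [simp]: "x \<in> carrier G \<Longrightarrow> conjg G x \<one> = \<one>" "x \<in> carrier G \<Longrightarrow> conjg G \<one> x = x"
  by (simp_all add: conjg_def)

lemma conjg_inv_cancel [simp]: "x \<in> carrier G \<Longrightarrow> y \<in> carrier G \<Longrightarrow> conjg G (inv x) (conjg G x y) = y"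
   "x \<in> carrier G \<Longrightarrow> y \<in> carrier G \<Longrightarrow> conjg G x (conjg G (inv x) y) = y"
  by (simp_all add: grp)

lemma conjg_pow: "x \<in> carrier G \<Longrightarrow> y \<in> carrier G \<Longrightarrow> conjg G x (y [^] (n::nat)) = conjg G x y [^] n"
  by (induction n) (simp_all add: conjg_mult)

lemma commt_eq: "x \<in> carrier G \<Longrightarrow> y \<in> carrier G \<Longrightarrow> commt G x y = conjg G x y \<otimes> inv y"
  by (simp add: grp)

lemma conjg_eq: "x \<in> carrier G \<Longrightarrow> y \<in> carrier G \<Longrightarrow> conjg G x y = commt G x y \<otimes> y"
  by (simp add: grp)

lemma commt_mult_left: "x \<in> carrier G \<Longrightarrow> y \<in> carrier G \<Longrightarrow> z \<in> carrier G \<Longrightarrow>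
    commt G (x \<otimes> y) z = conjg G x (commt G y z) \<otimes> commt G x z"
  by (simp add: grp)

lemma commt_mult_right: "x \<in> carrier G \<Longrightarrow> y \<in> carrier G \<Longrightarrow> z \<in> carrier G \<Longrightarrow>
    commt G x (y \<otimes> z) = commt G x y \<otimes> conjg G y (commt G x z)"
  by (simp add: grp)

lemma commt_inv_left: "x \<in> carrier G \<Longrightarrow> y \<in> carrier G \<Longrightarrow>
    commt G (inv x) y = conjg G (inv x) (inv (commt G x y))"
  by (simp add: grp)

lemma commt_inv_right: "x \<in> carrier G \<Longrightarrow> y \<in> carrier G \<Longrightarrow>
    commt G x (inv y) = conjg G (inv y) (inv (commt G x y))"
  by (simp add: grp)

lemma conjg_commt: "x \<in> carrier G \<Longrightarrow> y \<in> carrier G \<Longrightarrow> z \<in> carrier G \<Longrightarrow>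
    conjg G z (commt G x y) = commt G (conjg G z x) (conjg G z y)"
  by (simp add: grp)

lemma commt_one [simp]: "x \<in> carrier G \<Longrightarrow> commt G x \<one> = \<one>" "x \<in> carrier G \<Longrightarrow> commt G \<one> x = \<one>"
  by (simp_all add: commt_def)

lemma subgroupD:
  assumes "subgroup H G"
  shows "H \<subseteq> carrier G" "\<one> \<in> H" "x \<in> H \<Longrightarrow> x \<in> carrier G" "x \<in> H \<Longrightarrow> inv x \<in> H"
    "x \<in> H \<Longrightarrow> y \<in> H \<Longrightarrow> x \<otimes> y \<in> H" "x \<in> H \<Longrightarrow> y \<in> H \<Longrightarrow> commt G x y \<in> H"
    "x \<in> H \<Longrightarrow> y \<in> H \<Longrightarrow> conjg G x y \<in> H" "x \<in> H \<Longrightarrow> x [^] (n::nat) \<in> H" "x \<in> H \<Longrightarrow> x [^] (k::int) \<in> H"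
proof -
  show H: "H \<subseteq> carrier G" "\<one> \<in> H" "x \<in> H \<Longrightarrow> x \<in> carrier G" "x \<in> H \<Longrightarrow> inv x \<in> H"
    "x \<in> H \<Longrightarrow> y \<in> H \<Longrightarrow> x \<otimes> y \<in> H" for x y
    using assms by (auto simp: subgroup_def)
  show "x \<in> H \<Longrightarrow> y \<in> H \<Longrightarrow> commt G x y \<in> H" "x \<in> H \<Longrightarrow> y \<in> H \<Longrightarrow> conjg G x y \<in> H"
    by (simp_all add: commt_def conjg_def H)
  show "x \<in> H \<Longrightarrow> x [^] n \<in> H" by (induction n) (simp_all add: H)
  show "x \<in> H \<Longrightarrow> x [^] k \<in> H" using subgroup_int_pow_closed[OF assms] by blast
qed

lemma subgroup_mult_cancel_left:
  assumes "subgroup H G" "x \<in> H" "y \<in> carrier G" "x \<otimes> y \<in> H" shows "y \<in> H"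
proof -
  have "inv x \<otimes> (x \<otimes> y) \<in> H"
    by (rule subgroupD(5)[OF assms(1) subgroupD(4)[OF assms(1,2)] assms(4)])
  moreover have "x \<in> carrier G" using assms by (auto intro: subgroupD(3))
  ultimately show ?thesis using assms by simp
qed

lemma subgroup_mult_cancel_right:
  assumes "subgroup H G" "y \<in> H" "x \<in> carrier G" "x \<otimes> y \<in> H" shows "x \<in> H"
proof -
  have "(x \<otimes> y) \<otimes> inv y \<in> H"
    by (rule subgroupD(5)[OF assms(1) assms(4) subgroupD(4)[OF assms(1,2)]])
  moreover have "y \<in> carrier G" using assms by (auto intro: subgroupD(3))
  ultimately show ?thesis using assms by (simp add: m_assoc)
qed

lemma normalizesD: "normalizes G H M \<Longrightarrow> h \<in> H \<Longrightarrow> m \<in> M \<Longrightarrow> conjg G h m \<in> M"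
  by (simp add: normalizes_def)

lemma generate_subset: "S \<subseteq> generate G S"
  by (auto intro: generate.incl)

lemma generate_subgroup: "S \<subseteq> carrier G \<Longrightarrow> subgroup (generate G S) G"
  by (rule generate_is_subgroup)

lemma generate_least: "subgroup H G \<Longrightarrow> S \<subseteq> H \<Longrightarrow> generate G S \<subseteq> H"
  by (rule generate_subgroup_incl)

lemma generate_insert_Un:
  assumes "T \<union> Y \<subseteq> carrier G" "t \<in> carrier G"
  shows "generate G (insert t T \<union> Y) = generate G (insert t (generate G (T \<union> Y)))"
proof
  show "generate G (insert t T \<union> Y) \<subseteq> generate G (insert t (generate G (T \<union> Y)))"
    by (rule mono_generate) (auto intro: generate.incl)
  have sg: "subgroup (generate G (insert t T \<union> Y)) G" using assms by (intro generate_subgroup) auto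
  have "generate G (T \<union> Y) \<subseteq> generate G (insert t T \<union> Y)" by (rule mono_generate) auto
  thus "generate G (insert t (generate G (T \<union> Y))) \<subseteq> generate G (insert t T \<union> Y)"
    by (intro generate_least[OF sg]) (auto intro: generate.incl)
qed

lemma subgroup_normalizes_self: "subgroup H G \<Longrightarrow> normalizes G H H"
  by (simp add: normalizes_def subgroupD)

lemma normalizes_generate:
  assumes "subgroup H G" "S \<subseteq> carrier G" and "\<And>h s. h \<in> H \<Longrightarrow> s \<in> S \<Longrightarrow> conjg G h s \<in> generate G S"
  shows "normalizes G H (generate G S)"
  unfolding normalizes_def
proof (intro ballI)
  fix h m assume h: "h \<in> H" and m: "m \<in> generate G S"
  have hc: "h \<in> carrier G" using h assms(1) by (rule subgroupD(3)[rotated])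
  have sg: "subgroup (generate G S) G" by (rule generate_subgroup[OF assms(2)])
  have "subgroup {m \<in> carrier G. conjg G h m \<in> generate G S} G"
    by unfold_locales (auto simp: conjg_mult conjg_inv hc subgroupD[OF sg])
  moreover have "S \<subseteq> {m \<in> carrier G. conjg G h m \<in> generate G S}" using assms h by auto
  ultimately have "generate G S \<subseteq> {m \<in> carrier G. conjg G h m \<in> generate G S}" by (rule generate_least)
  thus "conjg G h m \<in> generate G S" using m by auto
qed

text \<open>\<open>[x, y z]\<close> expands into \<open>[x, y]\<close> and a conjugate of
  \<open>[x, z]\<close> by an element of \<open>H\<close>, and both stay in
  \<open>M\<close>.\<close>

lemma subgroup_commt_right:
  assumes M: "subgroup M G" "normalizes G H M" and H: "subgroup H G" and U: "U \<subseteq> carrier G"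
  shows "subgroup {y \<in> H. \<forall>x\<in>U. commt G x y \<in> M} G"
proof -
  have [simp]: "x \<in> carrier G" if "x \<in> U" for x using that U by auto
  show ?thesis
    by unfold_locales (auto simp: commt_mult_right commt_inv_right subgroupD[OF H] subgroupD[OF M(1)] normalizesD[OF M(2)])
qed

lemma subgroup_commt_left:
  assumes M: "subgroup M G" "normalizes G H M" and H: "subgroup H G" and U: "U \<subseteq> carrier G"
  shows "subgroup {y \<in> H. \<forall>x\<in>U. commt G y x \<in> M} G"
proof -
  have [simp]: "x \<in> carrier G" if "x \<in> U" for x using that U by auto
  show ?thesis
    by unfold_locales (auto simp: commt_mult_left commt_inv_left subgroupD[OF H] subgroupD[OF M(1)] normalizesD[OF M(2)])
qed

section \<open>The lower central series of a subgroup and its normal generators\<close>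

lemma lcs_props:
  assumes H: "subgroup H G"
  shows lcs_subgroup: "subgroup (lcs G H n) G" and lcs_subset: "lcs G H n \<subseteq> H"
    and lcs_normalized: "normalizes G H (lcs G H n)"
proof -
  have "subgroup (lcs G H n) G \<and> lcs G H n \<subseteq> H \<and> normalizes G H (lcs G H n)"
  proof (induction n)
    case 0
    show ?case using H by (simp add: subgroup_normalizes_self)
  next
    case (Suc n)
    let ?S = "{commt G x y | x y. x \<in> H \<and> y \<in> lcs G H n}"
    have S: "?S \<subseteq> H" using Suc by (auto simp: subgroupD[OF H] subset_iff)
    hence Sc: "?S \<subseteq> carrier G" using subgroupD(1)[OF H] by blast
    moreover have "generate G ?S \<subseteq> H" by (rule generate_least[OF H S])
    moreover have "normalizes G H (generate G ?S)"
    proof (rule normalizes_generate[OF H Sc])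
      fix h s assume h: "h \<in> H" and "s \<in> ?S"
      then obtain x y where s: "s = commt G x y" "x \<in> H" "y \<in> lcs G H n" by blast
      have "conjg G h s = commt G (conjg G h x) (conjg G h y)"
        unfolding s(1) using s h Suc by (intro conjg_commt) (auto simp: subset_iff subgroupD[OF H])
      moreover have "conjg G h x \<in> H" "conjg G h y \<in> lcs G H n"
        using s h Suc by (auto simp: subgroupD[OF H] normalizesD)
      ultimately have "conjg G h s \<in> ?S" by blast
      thus "conjg G h s \<in> generate G ?S" by (rule generate.incl)
    qed
    ultimately show ?case using generate_subgroup[OF Sc] by simp
  qed
  thus "subgroup (lcs G H n) G" "lcs G H n \<subseteq> H" "normalizes G H (lcs G H n)" by auto
qed

lemma commt_in_lcs: "x \<in> H \<Longrightarrow> y \<in> lcs G H n \<Longrightarrow> commt G x y \<in> lcs G H (Suc n)"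
  by (auto intro: generate.incl)

lemma lcs_Suc_subset:
  assumes H: "subgroup H G"
  shows "lcs G H (Suc n) \<subseteq> lcs G H n"
proof -
  have "{commt G x y | x y. x \<in> H \<and> y \<in> lcs G H n} \<subseteq> lcs G H n"
  proof clarify
    fix x y assume xy: "x \<in> H" "y \<in> lcs G H n"
    hence c: "x \<in> carrier G" "y \<in> carrier G"
      using subgroupD(3)[OF H] subgroupD(3)[OF lcs_subgroup[OF H]] by auto
    show "commt G x y \<in> lcs G H n" unfolding commt_eq[OF c]
      using xy by (intro subgroupD[OF lcs_subgroup[OF H]] normalizesD[OF lcs_normalized[OF H]])
  qed
  thus ?thesis using generate_least[OF lcs_subgroup[OF H]] by simp
qed

lemma lcs_antimono: "subgroup H G \<Longrightarrow> m \<le> n \<Longrightarrow> lcs G H n \<subseteq> lcs G H m"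
  by (rule lift_Suc_antimono_le[where f = "lcs G H"]) (use lcs_Suc_subset in auto)

lemma lcs_mono: "H \<subseteq> K \<Longrightarrow> lcs G H n \<subseteq> lcs G K n"
  by (induction n) (auto intro!: mono_generate)

lemma lower_central_eq_lcs:
  assumes H: "subgroup H G"
  shows "lower_central (G\<lparr>carrier := H\<rparr>) n = lcs G H n"
proof (induction n)
  case (Suc n)
  have c: "lcs G H n \<subseteq> H" by (rule lcs_subset[OF H])
  have "{x \<otimes> y \<otimes> inv\<^bsub>G\<lparr>carrier := H\<rparr>\<^esub> x \<otimes> inv\<^bsub>G\<lparr>carrier := H\<rparr>\<^esub> y | x y. x \<in> H \<and> y \<in> lcs G H n}
     = {commt G x y | x y. x \<in> H \<and> y \<in> lcs G H n}"
  proof -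
    have "x \<otimes> y \<otimes> inv\<^bsub>G\<lparr>carrier := H\<rparr>\<^esub> x \<otimes> inv\<^bsub>G\<lparr>carrier := H\<rparr>\<^esub> y = commt G x y"
      if "x \<in> H" "y \<in> lcs G H n" for x y
      using that c by (auto simp: commt_def m_inv_consistent[OF H] subset_iff)
    thus ?thesis by (intro Collect_cong) metis
  qed
  moreover have "{commt G x y | x y. x \<in> H \<and> y \<in> lcs G H n} \<subseteq> H"
    using c by (auto simp: subgroupD[OF H] subset_iff)
  ultimately show ?case using generate_consistent[OF _ H] by (simp add: Suc)
qed simp

lemma nclosure_props:
  assumes H: "subgroup H G" and Y: "Y \<subseteq> H"
  shows nclosure_subgroup: "subgroup (nclosure G H Y) G" and nclosure_subset: "nclosure G H Y \<subseteq> H"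
    and nclosure_normalized: "normalizes G H (nclosure G H Y)" and nclosure_incl: "Y \<subseteq> nclosure G H Y"
proof -
  let ?S = "{conjg G h y | h y. h \<in> H \<and> y \<in> Y}"
  have S: "?S \<subseteq> H" using Y by (auto simp: subgroupD[OF H] subset_iff)
  hence Sc: "?S \<subseteq> carrier G" using subgroupD(1)[OF H] by blast
  show "subgroup (nclosure G H Y) G" unfolding nclosure_def by (rule generate_subgroup[OF Sc])
  show "nclosure G H Y \<subseteq> H" unfolding nclosure_def by (rule generate_least[OF H S])
  show "Y \<subseteq> nclosure G H Y"
  proof
    fix y assume y: "y \<in> Y"
    hence "conjg G \<one> y = y" using Y by (simp add: subset_iff subgroupD[OF H])
    hence "y = conjg G \<one> y \<and> \<one> \<in> H \<and> y \<in> Y" using y subgroupD(2)[OF H] by simp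
    hence "y \<in> ?S" by blast
    thus "y \<in> nclosure G H Y" unfolding nclosure_def by (rule generate.incl)
  qed
  show "normalizes G H (nclosure G H Y)" unfolding nclosure_def
  proof (rule normalizes_generate[OF H Sc])
    fix h s assume h: "h \<in> H" and "s \<in> ?S"
    then obtain x y where s: "s = conjg G x y" "x \<in> H" "y \<in> Y" by blast
    have "conjg G h s = conjg G (h \<otimes> x) y"
      using s h Y by (auto simp: conjg_mult_left subset_iff subgroupD[OF H])
    hence "conjg G h s \<in> ?S" using s h subgroupD(5)[OF H] by blast
    thus "conjg G h s \<in> generate G ?S" by (rule generate.incl)
  qed
qed

lemma nclosure_least:
  assumes "subgroup M G" "normalizes G H M" "Y \<subseteq> M"
  shows "nclosure G H Y \<subseteq> M"
  unfolding nclosure_def using assms by (intro generate_least) (auto simp: normalizesD subset_iff)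

lemma left_comms_subset: "S \<subseteq> H \<Longrightarrow> left_comms G S n \<subseteq> lcs G H n"
  by (induction n) (auto intro!: commt_in_lcs simp del: lcs.simps(2) simp: subset_iff)

lemma finite_left_comms: "finite S \<Longrightarrow> finite (left_comms G S n)"
proof (induction n)
  case (Suc n)
  have "left_comms G S (Suc n) = (\<lambda>(s, y). commt G s y) ` (S \<times> left_comms G S n)" by auto
  thus ?case using Suc by simp
qed simp

text \<open>Let \<open>M\<close> be the normal closure for \<open>n + 1\<close>. The elements whose
  commutators with \<open>H\<close> lie in \<open>M\<close> form a subgroup normalized by
  \<open>H\<close>. It contains the iterated commutators for \<open>n\<close>, because for a fixed
  second entry the admissible first entries form a subgroup containing \<open>S\<close>.\<close>

lemma lcs_eq_nclosure:
  assumes H: "subgroup H G" and S: "generate G S = H" "S \<subseteq> carrier G"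
  shows "lcs G H n = nclosure G H (left_comms G S n)"
proof
  have SH: "S \<subseteq> H" using S generate_subset by auto
  have lc: "left_comms G S n \<subseteq> lcs G H n" for n by (rule left_comms_subset[OF SH])
  have lcH: "left_comms G S n \<subseteq> H" for n using lc lcs_subset[OF H] by blast
  show "nclosure G H (left_comms G S n) \<subseteq> lcs G H n"
    by (intro nclosure_least lcs_subgroup lcs_normalized H lc)
  show "lcs G H n \<subseteq> nclosure G H (left_comms G S n)"
  proof (induction n)
    case 0
    have "generate G S \<subseteq> nclosure G H S"
      by (intro generate_least nclosure_subgroup nclosure_incl H SH)
    thus ?case using S by simp
  next
    case (Suc n)
    define M where "M = nclosure G H (left_comms G S (Suc n))"
    have M: "subgroup M G" "normalizes G H M" "left_comms G S (Suc n) \<subseteq> M" "M \<subseteq> H"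
      unfolding M_def by (intro nclosure_props[OF H lcH])+
    define C where "C = {y \<in> H. \<forall>x\<in>H. commt G x y \<in> M}"
    have C: "subgroup C G" unfolding C_def
      by (rule subgroup_commt_right[OF M(1,2) H subgroupD(1)[OF H]])
    have nC: "normalizes G H C" unfolding normalizes_def C_def
    proof (intro ballI, clarify, intro conjI ballI)
      fix h y assume h: "h \<in> H" and y: "y \<in> H" "\<forall>x\<in>H. commt G x y \<in> M"
      show "conjg G h y \<in> H" using h y by (simp add: subgroupD[OF H])
      fix x assume x: "x \<in> H"
      have [simp]: "h \<in> carrier G" "x \<in> carrier G" "y \<in> carrier G" using h x y by (auto simp: subgroupD[OF H])
      have "commt G x (conjg G h y) = conjg G h (commt G (conjg G (inv h) x) y)"
        by (simp add: conjg_commt)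
      thus "commt G x (conjg G h y) \<in> M" using y x h by (simp add: normalizesD[OF M(2)] subgroupD[OF H])
    qed
    have "left_comms G S n \<subseteq> C"
    proof
      fix y assume y: "y \<in> left_comms G S n"
      have yH: "y \<in> H" using y lcH by blast
      have "subgroup {x \<in> H. \<forall>z\<in>{y}. commt G x z \<in> M} G"
        using yH by (intro subgroup_commt_left M H) (auto simp: subgroupD[OF H])
      moreover have "S \<subseteq> {x \<in> H. \<forall>z\<in>{y}. commt G x z \<in> M}" using y SH M(3) by auto
      ultimately have "generate G S \<subseteq> {x \<in> H. \<forall>z\<in>{y}. commt G x z \<in> M}" by (rule generate_least)
      hence "H \<subseteq> {x \<in> H. \<forall>z\<in>{y}. commt G x z \<in> M}" by (simp only: S(1))
      thus "y \<in> C" using yH by (auto simp: C_def)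
    qed
    hence "nclosure G H (left_comms G S n) \<subseteq> C" by (intro nclosure_least C nC)
    hence "lcs G H n \<subseteq> C" using Suc by blast
    hence "{commt G x y | x y. x \<in> H \<and> y \<in> lcs G H n} \<subseteq> M" by (auto simp: C_def)
    thus ?case using generate_least[OF M(1)] by (simp add: M_def)
  qed
qed


section \<open>Power subgroups and coverings by cosets\<close>

lemma power_subgroup_props:
  assumes H: "subgroup H G"
  shows power_subgroup_subgroup: "subgroup (power_subgroup G H m) G"
    and power_subgroup_subset: "power_subgroup G H m \<subseteq> H"
    and power_subgroup_incl: "x \<in> H \<Longrightarrow> x [^] m \<in> power_subgroup G H m"
proof -
  have S: "{x [^] m | x. x \<in> H} \<subseteq> H" by (auto simp: subgroupD[OF H])
  hence Sc: "{x [^] m | x. x \<in> H} \<subseteq> carrier G" using subgroupD(1)[OF H] by blast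
  show "subgroup (power_subgroup G H m) G" unfolding power_subgroup_def by (rule generate_subgroup[OF Sc])
  show "power_subgroup G H m \<subseteq> H" unfolding power_subgroup_def by (rule generate_least[OF H S])
  show "x \<in> H \<Longrightarrow> x [^] m \<in> power_subgroup G H m"
    unfolding power_subgroup_def by (rule generate.incl) blast
qed

lemma power_subgroup_least:
  assumes "subgroup M G" "\<And>x. x \<in> H \<Longrightarrow> x [^] m \<in> M"
  shows "power_subgroup G H m \<subseteq> M"
  unfolding power_subgroup_def using assms by (intro generate_least) auto

lemma power_subgroup_normalized:
  assumes H: "subgroup H G" and L: "subgroup L G" "normalizes G L H"
  shows "normalizes G L (power_subgroup G H m)"
  unfolding power_subgroup_def
proof (rule normalizes_generate[OF L(1)])
  show "{x [^] m | x. x \<in> H} \<subseteq> carrier G" using subgroupD[OF H] by auto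
  fix h s assume h: "h \<in> L" and "s \<in> {x [^] m | x. x \<in> H}"
  then obtain x where s: "s = x [^] m" "x \<in> H" by blast
  have "conjg G h s = conjg G h x [^] m"
    unfolding s(1) using h s subgroupD(3)[OF H] subgroupD(3)[OF L(1)] by (simp add: conjg_pow)
  hence "conjg G h s \<in> {x [^] m | x. x \<in> H}" using normalizesD[OF L(2) h s(2)] by blast
  thus "conjg G h s \<in> generate G {x [^] m | x. x \<in> H}" by (rule generate.incl)
qed

lemma normal_iff_normalizes: "subgroup N G \<Longrightarrow> N \<lhd> G \<longleftrightarrow> normalizes G (carrier G) N"
  by (simp add: normal_inv_iff normalizes_def conjg_def)

lemma power_subgroup_normal: "power_subgroup G (carrier G) m \<lhd> G"
  using power_subgroup_normalized[OF subgroup_self subgroup_self subgroup_normalizes_self[OF subgroup_self]]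
    power_subgroup_subgroup[OF subgroup_self] normal_iff_normalizes by blast

lemma coveredI:
  "finite T \<Longrightarrow> T \<subseteq> U \<Longrightarrow> card T \<le> k \<Longrightarrow> (\<And>x. x \<in> U \<Longrightarrow> \<exists>t\<in>T. \<exists>b\<in>B. x = t \<otimes> b) \<Longrightarrow> covered G U B k"
  unfolding covered_def by blast

lemma coveredE:
  assumes "covered G U B k"
  obtains T where "finite T" "T \<subseteq> U" "card T \<le> k" "\<forall>x\<in>U. \<exists>t\<in>T. \<exists>b\<in>B. x = t \<otimes> b"
  using assms unfolding covered_def by blast

lemma covered_mono: "covered G U B k \<Longrightarrow> B \<subseteq> C \<Longrightarrow> k \<le> l \<Longrightarrow> covered G U C l"
  unfolding covered_def by (meson le_trans subset_iff)

lemma covered_pigeonhole: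
  assumes "covered G U B k" and B: "subgroup B G" and U: "U \<subseteq> carrier G"
    and f: "\<And>i. i \<in> I \<Longrightarrow> f i \<in> U" and I: "k < card I"
  shows "\<exists>i\<in>I. \<exists>j\<in>I. i \<noteq> j \<and> inv (f i) \<otimes> f j \<in> B"
proof -
  obtain T where T: "finite T" "T \<subseteq> U" "card T \<le> k" "\<forall>x\<in>U. \<exists>t\<in>T. \<exists>b\<in>B. x = t \<otimes> b"
    using assms(1) by (rule coveredE)
  have "\<forall>i\<in>I. \<exists>t. t \<in> T \<and> (\<exists>b\<in>B. f i = t \<otimes> b)" using T(4) f by blast
  then obtain \<tau> where \<tau>: "\<And>i. i \<in> I \<Longrightarrow> \<tau> i \<in> T" "\<And>i. i \<in> I \<Longrightarrow> \<exists>b\<in>B. f i = \<tau> i \<otimes> b"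
    by (metis bchoice)
  have "\<not> inj_on \<tau> I"
  proof
    assume "inj_on \<tau> I"
    hence "card I \<le> card T" using \<tau>(1) T(1) by (intro card_inj_on_le) auto
    thus False using I T(3) by linarith
  qed
  then obtain i j where ij: "i \<in> I" "j \<in> I" "i \<noteq> j" "\<tau> i = \<tau> j" by (auto simp: inj_on_def)
  obtain b c where bc: "b \<in> B" "f i = \<tau> i \<otimes> b" "c \<in> B" "f j = \<tau> i \<otimes> c" using \<tau>(2) ij by metis
  have [simp]: "\<tau> i \<in> carrier G" "b \<in> carrier G" "c \<in> carrier G"
    using \<tau>(1)[OF ij(1)] T(2) U bc subgroupD(1)[OF B] by auto
  have "inv (f i) \<otimes> f j = inv b \<otimes> c" by (simp add: bc grp)
  moreover have "inv b \<otimes> c \<in> B" using bc by (simp add: subgroupD[OF B])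
  ultimately have "inv (f i) \<otimes> f j \<in> B" by (simp only:)
  thus ?thesis using ij by blast
qed

lemma covered_trans:
  assumes U: "covered G U Y k" and Y: "covered G Y B l"
    and "U \<subseteq> carrier G" "subgroup U G" "Y \<subseteq> U" "B \<subseteq> carrier G"
  shows "covered G U B (k * l)"
proof -
  obtain T where T: "finite T" "T \<subseteq> U" "card T \<le> k" "\<forall>x\<in>U. \<exists>t\<in>T. \<exists>b\<in>Y. x = t \<otimes> b"
    using U by (rule coveredE)
  obtain V where V: "finite V" "V \<subseteq> Y" "card V \<le> l" "\<forall>x\<in>Y. \<exists>t\<in>V. \<exists>b\<in>B. x = t \<otimes> b"
    using Y by (rule coveredE)
  show ?thesis
  proof (rule coveredI[of "(\<lambda>(t, v). t \<otimes> v) ` (T \<times> V)"])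
    show "card ((\<lambda>(t, v). t \<otimes> v) ` (T \<times> V)) \<le> k * l"
      using T V by (intro order.trans[OF card_image_le]) (auto simp: card_cartesian_product mult_mono)
    show "(\<lambda>(t, v). t \<otimes> v) ` (T \<times> V) \<subseteq> U"
      using T V assms subgroupD(5)[OF assms(4)] by auto blast
    fix x assume "x \<in> U"
    then obtain t y where ty: "t \<in> T" "y \<in> Y" "x = t \<otimes> y" using T(4) by blast
    then obtain v b where vb: "v \<in> V" "b \<in> B" "y = v \<otimes> b" using V(4) by blast
    have "x = (t \<otimes> v) \<otimes> b" using ty vb T V assms by (simp add: m_assoc subset_iff)
    thus "\<exists>t\<in>(\<lambda>(t, v). t \<otimes> v) ` (T \<times> V). \<exists>b\<in>B. x = t \<otimes> b" using ty vb by force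
  qed (use T V in auto)
qed

lemma covered_pigeonhole_less:
  assumes "covered G U B k" and B: "subgroup B G" and U: "U \<subseteq> carrier G"
    and f: "\<And>i. f i \<in> U"
  shows "\<exists>i j. i < j \<and> j \<le> k \<and> inv (f i) \<otimes> f j \<in> B"
proof -
  obtain i j where ij: "i \<in> {..k}" "j \<in> {..k}" "i \<noteq> j" "inv (f i) \<otimes> f j \<in> B"
    using covered_pigeonhole[OF assms(1) B U, of "{..k}" f] f by auto
  have fc: "f i \<in> carrier G" for i using f U by blast
  have "inv (inv (f i) \<otimes> f j) \<in> B" by (rule subgroupD(4)[OF B ij(4)])
  hence "inv (f j) \<otimes> f i \<in> B" using fc by (simp add: inv_mult_group)
  thus ?thesis using ij by (metis atMost_iff nat_neq_iff)
qed

text \<open>Two of the powers \<open>x^0, ..., x^k\<close> agree modulo \<open>B\<close>, so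
  \<open>x^n\<close> lies in \<open>B\<close> for some \<open>n\<close> between 1 and
  \<open>k\<close>. The factorial serves all \<open>x\<close> at once, also for \<open>B\<close>
  that is not normal.\<close>

lemma covered_power:
  assumes "covered G U B k" and B: "subgroup B G" and U: "subgroup U G" and x: "x \<in> U"
  shows "x [^] (fact k :: nat) \<in> B"
proof -
  have xc: "x \<in> carrier G" using x U by (auto intro: subgroupD(3))
  obtain i j where ij: "i < j" "j \<le> k" "inv (x [^] i) \<otimes> x [^] j \<in> B"
    using covered_pigeonhole_less[OF assms(1) B subgroupD(1)[OF U], of "\<lambda>i. x [^] i"]
    by (auto simp: subgroupD(8)[OF U x])
  have "x [^] j = x [^] i \<otimes> x [^] (j - i)" using ij xc by (simp add: nat_pow_mult)
  hence "inv (x [^] i) \<otimes> x [^] j = x [^] (j - i)" using xc by simp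
  hence "\<exists>n\<in>{1..k}. x [^] n \<in> B" using ij by (intro bexI[of _ "j - i"]) auto
  then obtain n where n: "n \<in> {1..k}" "x [^] n \<in> B" by blast
  then obtain m where "fact k = n * m" by (metis atLeastAtMost_iff dvd_fact dvd_def)
  thus ?thesis using n xc subgroupD(8)[OF B n(2), of m] by (simp add: nat_pow_pow)
qed

text \<open>Needed where a rank bound controls finite subsets of a \<open>U\<close> that may not be
  finitely generated. If each finite part of \<open>U\<close> meets at most \<open>k\<close> cosets,
  there are at most \<open>k\<close> in all; representatives found outside \<open>U\<close> are
  rechosen inside.\<close>

lemma covered_if_finite_subsets_covered:
  assumes B: "subgroup B G" and U: "U \<subseteq> carrier G"
    and fin: "\<And>F. finite F \<Longrightarrow> F \<subseteq> U \<Longrightarrow> \<exists>T. finite T \<and> T \<subseteq> carrier G \<and> card T \<le> k \<and> (\<forall>x\<in>F. \<exists>t\<in>T. \<exists>b\<in>B. x = t \<otimes> b)"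
  shows "covered G U B k"
proof -
  let ?C = "(\<lambda>x. x <# B) ` U"
  have coset: "(t \<otimes> b) <# B = t <# B" if "t \<in> carrier G" "b \<in> B" for t b
    using that B lcos_m_assoc[OF subgroupD(1)[OF B], of t b]
    by (metis coset_join3 subgroupD(3))
  have fc: "finite ?C \<and> card ?C \<le> k"
  proof (rule finite_if_finite_subsets_card_bdd)
    fix D assume D: "D \<subseteq> ?C" "finite D"
    then obtain F where F: "finite F" "F \<subseteq> U" "D = (\<lambda>x. x <# B) ` F" by (metis finite_subset_image)
    obtain T where T: "finite T" "T \<subseteq> carrier G" "card T \<le> k" "\<forall>x\<in>F. \<exists>t\<in>T. \<exists>b\<in>B. x = t \<otimes> b"
      using fin[OF F(1,2)] by blast
    have "D \<subseteq> (\<lambda>t. t <# B) ` T"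
    proof
      fix d assume "d \<in> D"
      then obtain x where x: "x \<in> F" "d = x <# B" using F by blast
      then obtain t b where tb: "t \<in> T" "b \<in> B" "x = t \<otimes> b" using T(4) by blast
      hence "d = t <# B" using x coset T(2) by auto
      thus "d \<in> (\<lambda>t. t <# B) ` T" using tb by blast
    qed
    hence "card D \<le> card T" using T(1) surj_card_le by blast
    thus "card D \<le> k" using T(3) by linarith
  qed
  define r where "r c = (SOME x. x \<in> U \<and> x <# B = c)" for c
  have r: "r c \<in> U \<and> r c <# B = c" if c: "c \<in> ?C" for c
    unfolding r_def by (rule someI_ex) (use c in blast)
  show ?thesis
  proof (rule coveredI[of "r ` ?C"])
    show "finite (r ` ?C)" using fc by simp
    show "r ` ?C \<subseteq> U" using r by blast
    show "card (r ` ?C) \<le> k" using fc card_image_le[of ?C r] by linarith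
    fix x assume x: "x \<in> U"
    hence c: "x <# B \<in> ?C" by blast
    have "x \<in> x <# B" using lcos_self[OF _ B] x U by blast
    hence "x \<in> r (x <# B) <# B" using r[OF c] by simp
    thus "\<exists>t\<in>r ` ?C. \<exists>b\<in>B. x = t \<otimes> b" using c unfolding l_coset_def by blast
  qed
qed

lemma finite_index_if_covered:
  assumes "covered G (carrier G) H k" and H: "subgroup H G"
  shows "finite_index G H" "card (rcosets H) \<le> k"
proof -
  obtain T where T: "finite T" "T \<subseteq> carrier G" "card T \<le> k"
    "\<forall>x\<in>carrier G. \<exists>t\<in>T. \<exists>b\<in>H. x = t \<otimes> b"
    using assms(1) by (rule coveredE)
  \<comment> \<open>Inversion exchanges the left cosets of \<open>covered\<close> with the right
    cosets counted by \<open>rcosets\<close>.\<close>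
  have sub: "rcosets H \<subseteq> (\<lambda>t. H #> inv t) ` T"
  proof
    fix c assume "c \<in> rcosets H"
    then obtain x where x: "x \<in> carrier G" "c = H #> x" by (auto simp: RCOSETS_def)
    obtain t b where tb: "t \<in> T" "b \<in> H" "inv x = t \<otimes> b" using bspec[OF T(4), of "inv x"] x by auto
    have c: "t \<in> carrier G" "b \<in> carrier G" using tb T(2) subgroupD(1)[OF H] by auto
    have "x = inv b \<otimes> inv t" using tb(3) x c by (metis inv_inv inv_mult_group)
    hence "c = (H #> inv b) #> inv t" using x(2) c coset_mult_assoc[OF subgroupD(1)[OF H], of "inv b" "inv t"] by simp
    also have "H #> inv b = H" using subgroupD(4)[OF H tb(2)] H coset_join2 c by simp
    finally show "c \<in> (\<lambda>t. H #> inv t) ` T" using tb by blast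
  qed
  show "finite_index G H" unfolding finite_index_def using sub T(1) finite_surj by blast
  show "card (rcosets H) \<le> k" using sub T(1,3) surj_card_le[of T "rcosets H"] by (meson le_trans)
qed

lemma covered_if_finite_index:
  assumes "finite_index G H" and H: "subgroup H G"
  shows "\<exists>k. covered G (carrier G) H k"
proof -
  define r where "r c = (SOME x. x \<in> carrier G \<and> H #> x = c)" for c
  have r: "r c \<in> carrier G \<and> H #> r c = c" if c: "c \<in> rcosets H" for c
    unfolding r_def by (rule someI_ex) (use c in \<open>auto simp: RCOSETS_def\<close>)
  define T where "T = (\<lambda>c. inv (r c)) ` (rcosets H)"
  have "covered G (carrier G) H (card T)"
  proof (rule coveredI[of T])
    show "finite T" using assms by (simp add: T_def finite_index_def)
    show "T \<subseteq> carrier G" using r by (auto simp: T_def)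
    fix x assume x: "x \<in> carrier G"
    have c: "H #> inv x \<in> rcosets H" using x by (auto simp: RCOSETS_def)
    have "inv x \<in> H #> inv x" using rcos_self[OF _ H] x by simp
    hence "inv x \<in> H #> r (H #> inv x)" using r[OF c] by simp
    then obtain h where h: "h \<in> H" "inv x = h \<otimes> r (H #> inv x)" by (auto simp: r_coset_def)
    have "x = inv (r (H #> inv x)) \<otimes> inv h"
      using h x r[OF c] subgroupD(3)[OF H h(1)] by (metis inv_inv inv_mult_group)
    thus "\<exists>t\<in>T. \<exists>b\<in>H. x = t \<otimes> b" using c h subgroupD(4)[OF H] unfolding T_def by blast
  qed simp
  thus ?thesis by blast
qed

text \<open>A coset of \<open>B\<close> and a coset of \<open>C\<close> meet in a single coset of
  the intersection or not at all, so pairs of representatives suffice.\<close>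

lemma covered_Int:
  assumes "covered G U B k" "covered G U C l" and B: "subgroup B G" and C: "subgroup C G" and U: "U \<subseteq> carrier G"
  shows "covered G U (B \<inter> C) (k * l)"
proof -
  obtain T where T: "finite T" "T \<subseteq> U" "card T \<le> k" "\<forall>x\<in>U. \<exists>t\<in>T. \<exists>b\<in>B. x = t \<otimes> b"
    using assms(1) by (rule coveredE)
  obtain V where V: "finite V" "V \<subseteq> U" "card V \<le> l" "\<forall>x\<in>U. \<exists>t\<in>V. \<exists>b\<in>C. x = t \<otimes> b"
    using assms(2) by (rule coveredE)
  define R where "R = (\<lambda>(t, v). SOME x. x \<in> U \<and> (\<exists>b\<in>B. x = t \<otimes> b) \<and> (\<exists>b\<in>C. x = v \<otimes> b))"
  define D where "D = {(t, v) \<in> T \<times> V. \<exists>x. x \<in> U \<and> (\<exists>b\<in>B. x = t \<otimes> b) \<and> (\<exists>b\<in>C. x = v \<otimes> b)}"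
  have R: "R (t, v) \<in> U \<and> (\<exists>b\<in>B. R (t, v) = t \<otimes> b) \<and> (\<exists>b\<in>C. R (t, v) = v \<otimes> b)" if tv: "(t, v) \<in> D" for t v
    unfolding R_def prod.case by (rule someI_ex) (use tv in \<open>auto simp: D_def\<close>)
  have D: "finite D" "card D \<le> card T * card V"
    using T V card_mono[of "T \<times> V" D] by (auto simp: D_def card_cartesian_product intro: finite_subset[of _ "T \<times> V"])
  show ?thesis
  proof (rule coveredI[of "R ` D"])
    show "card (R ` D) \<le> k * l" using D T V card_image_le[OF D(1), of R] by (meson le_trans mult_le_mono)
    show "R ` D \<subseteq> U" using R by auto
    fix x assume x: "x \<in> U"
    obtain t b where tb: "t \<in> T" "b \<in> B" "x = t \<otimes> b" using T(4) x by blast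
    obtain v c where vc: "v \<in> V" "c \<in> C" "x = v \<otimes> c" using V(4) x by blast
    have tv: "(t, v) \<in> D" unfolding D_def using tb vc x by blast
    obtain b' c' where b': "b' \<in> B" "R (t, v) = t \<otimes> b'" and c': "c' \<in> C" "R (t, v) = v \<otimes> c'" using R[OF tv] by blast
    have [simp]: "t \<in> carrier G" "v \<in> carrier G" "b \<in> carrier G" "b' \<in> carrier G" "c \<in> carrier G" "c' \<in> carrier G"
      using tb vc b' c' T V U subgroupD(1)[OF B] subgroupD(1)[OF C] by auto
    have "inv (R (t, v)) \<otimes> x = inv b' \<otimes> b" unfolding b'(2) tb(3) by (simp add: grp)
    hence 1: "inv (R (t, v)) \<otimes> x \<in> B" using b' tb by (simp add: subgroupD[OF B])
    have "inv (R (t, v)) \<otimes> x = inv c' \<otimes> c" unfolding c'(2) vc(3) by (simp add: grp)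
    hence 2: "inv (R (t, v)) \<otimes> x \<in> C" using c' vc by (simp add: subgroupD[OF C])
    have "x = R (t, v) \<otimes> (inv (R (t, v)) \<otimes> x)" using x U R[OF tv] by (simp add: subset_iff)
    thus "\<exists>t\<in>R ` D. \<exists>b\<in>B \<inter> C. x = t \<otimes> b" using 1 2 tv by blast
  qed (use D in auto)
qed


section \<open>Polynomial bounds for the index of power subgroups\<close>

lemma normalizer_subgroup:
  assumes "Y \<subseteq> carrier G"
  shows "subgroup {h \<in> carrier G. \<forall>y\<in>Y. conjg G h y \<in> Y \<and> conjg G (inv h) y \<in> Y} G"
proof -
  have [simp]: "y \<in> carrier G" if "y \<in> Y" for y using that assms by auto
  show ?thesis by unfold_locales (auto simp: conjg_mult_left inv_mult_group)
qed

text \<open>Products \<open>y t^k\<close> are closed under multiplication and inversion because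
  \<open>t^k\<close> normalizes \<open>Y\<close> for positive and negative \<open>k\<close>
  alike.\<close>

lemma cyclic_extension:
  assumes Y: "subgroup Y G" and t: "t \<in> carrier G" and n: "normalizes G {t, inv t} Y"
  defines "U \<equiv> generate G (insert t Y)"
  shows cyclic_extension_subgroup: "subgroup U G"
    and cyclic_extension_normalizes: "normalizes G U Y"
    and cyclic_extension_eq: "U = {y \<otimes> t [^] k | y (k::int). y \<in> Y}"
    and cyclic_extension_pow: "\<And>y k. y \<in> Y \<Longrightarrow> conjg G (t [^] (k::int)) y \<in> Y"
proof -
  have Yc: "Y \<subseteq> carrier G" by (rule subgroupD(1)[OF Y])
  have Uc: "insert t Y \<subseteq> carrier G" using Yc t by auto
  show sU: "subgroup U G" unfolding U_def by (rule generate_subgroup[OF Uc])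
  let ?N = "{h \<in> carrier G. \<forall>y\<in>Y. conjg G h y \<in> Y \<and> conjg G (inv h) y \<in> Y}"
  have "t \<in> ?N" using t n by (auto simp: normalizes_def)
  moreover have "Y \<subseteq> ?N" using subgroupD[OF Y] by auto
  ultimately have "U \<subseteq> ?N" unfolding U_def by (intro generate_least normalizer_subgroup Yc) auto
  thus N: "normalizes G U Y" by (auto simp: normalizes_def)
  have tU: "t \<in> U" unfolding U_def by (rule generate.incl) simp
  have YU: "Y \<subseteq> U" unfolding U_def by (auto intro: generate.incl)
  show pow: "conjg G (t [^] (k::int)) y \<in> Y" if "y \<in> Y" for y k
    using that by (intro normalizesD[OF N] subgroupD(9)[OF sU tU])
  let ?E = "{y \<otimes> t [^] k | y (k::int). y \<in> Y}"
  show "U = ?E"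
  proof
    show "?E \<subseteq> U" using subgroupD(5)[OF sU] subgroupD(9)[OF sU tU] YU by blast
    have "subgroup ?E G"
    proof
      show "?E \<subseteq> carrier G" using Yc t by auto
      have "\<one> = \<one> \<otimes> t [^] (0::int) \<and> \<one> \<in> Y" using subgroupD(2)[OF Y] by simp
      thus "\<one> \<in> ?E" by blast
      fix a assume "a \<in> ?E"
      then obtain y k where a: "y \<in> Y" "a = y \<otimes> t [^] (k::int)" by blast
      have yc: "y \<in> carrier G" using a Yc by auto
      have "inv a = conjg G (t [^] (- k)) (inv y) \<otimes> t [^] (- k)"
        unfolding a(2) using yc t by (simp add: grp int_pow_neg)
      moreover have "conjg G (t [^] (- k)) (inv y) \<in> Y" by (rule pow[OF subgroupD(4)[OF Y a(1)]])
      ultimately show "inv a \<in> ?E" by blast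
      fix b assume "b \<in> ?E"
      then obtain z l where b: "z \<in> Y" "b = z \<otimes> t [^] (l::int)" by blast
      have zc: "z \<in> carrier G" using b Yc by auto
      have "a \<otimes> b = (y \<otimes> conjg G (t [^] k) z) \<otimes> t [^] (k + l)"
        unfolding a(2) b(2) using yc zc t by (simp add: grp int_pow_mult)
      moreover have "y \<otimes> conjg G (t [^] k) z \<in> Y" by (intro subgroupD(5)[OF Y] a(1) pow b(1))
      ultimately show "a \<otimes> b \<in> ?E" by blast
    qed
    moreover have "insert t Y \<subseteq> ?E"
    proof
      fix a assume "a \<in> insert t Y"
      hence "a = \<one> \<otimes> t [^] (1::int) \<and> \<one> \<in> Y \<or> a = a \<otimes> t [^] (0::int) \<and> a \<in> Y"
        using Yc t subgroupD(2)[OF Y] by auto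
      thus "a \<in> ?E" by blast
    qed
    ultimately show "U \<subseteq> ?E" unfolding U_def by (rule generate_least)
  qed
qed

text \<open>Generators are added one at a time. The exponent of a new generator can be reduced
  modulo \<open>m\<close>, so each multiplies the number of representatives by at most
  \<open>m\<close>.\<close>

lemma abelian_factor_covered:
  assumes Y: "subgroup Y G" and U: "subgroup U G" and YU: "Y \<subseteq> U"
    and ab: "\<And>x y. x \<in> U \<Longrightarrow> y \<in> U \<Longrightarrow> commt G x y \<in> Y"
    and B: "subgroup B G" "Y \<subseteq> B" and m: "m > 0"
    and T: "finite T" "T \<subseteq> U" "\<And>t. t \<in> T \<Longrightarrow> t [^] m \<in> B"
  shows "covered G (generate G (T \<union> Y)) B (m ^ card T)"
  using T
proof (induction T rule: finite_induct)
  case empty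
  have "generate G Y = Y" using generate_least[OF Y order_refl] generate_subset by blast
  moreover have "covered G Y B 1"
  proof (rule coveredI[of "{\<one>}"])
    fix x assume x: "x \<in> Y"
    hence "x = \<one> \<otimes> x \<and> x \<in> B" using B subgroupD(1)[OF Y] by auto
    thus "\<exists>t\<in>{\<one>}. \<exists>b\<in>B. x = t \<otimes> b" by blast
  qed (use subgroupD(2)[OF Y] in auto)
  ultimately show ?case by simp
next
  case (insert \<tau> T)
  define V where "V = generate G (T \<union> Y)"
  have TYU: "T \<union> Y \<subseteq> U" using insert.prems YU by auto
  hence sV: "subgroup V G" unfolding V_def using subgroupD(1)[OF U] by (intro generate_subgroup) auto
  have VU: "V \<subseteq> U" unfolding V_def by (rule generate_least[OF U TYU])
  have YV: "Y \<subseteq> V" unfolding V_def by (auto intro: generate.incl)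
  have \<tau>: "\<tau> \<in> U" "\<tau> \<in> carrier G" using insert.prems subgroupD(1)[OF U] by auto
  have Vc: "V \<subseteq> carrier G" by (rule subgroupD(1)[OF sV])
  have Bc: "B \<subseteq> carrier G" by (rule subgroupD(1)[OF B(1)])
  have nV: "conjg G u v \<in> V" if "u \<in> U" "v \<in> V" for u v
  proof -
    have "conjg G u v = commt G u v \<otimes> v" using that Vc subgroupD(1)[OF U] by (intro conjg_eq) auto
    moreover have "commt G u v \<in> V" using ab[of u v] that VU YV by blast
    ultimately show ?thesis using subgroupD(5)[OF sV] that by simp
  qed
  have N: "normalizes G {\<tau>, inv \<tau>} V" using nV \<tau> subgroupD(4)[OF U] by (auto simp: normalizes_def)
  have gen: "generate G (insert \<tau> T \<union> Y) = generate G (insert \<tau> V)"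
    unfolding V_def using TYU \<tau> subgroupD(1)[OF U] by (intro generate_insert_Un) auto
  have eq: "generate G (insert \<tau> V) = {y \<otimes> \<tau> [^] k | y (k::int). y \<in> V}"
    by (rule cyclic_extension_eq[OF sV \<tau>(2) N])
  have "covered G V B (m ^ card T)" unfolding V_def by (rule insert.IH) (use insert.prems in auto)
  then obtain T0 where T0: "finite T0" "T0 \<subseteq> V" "card T0 \<le> m ^ card T" "\<forall>x\<in>V. \<exists>t\<in>T0. \<exists>b\<in>B. x = t \<otimes> b"
    by (rule coveredE)
  show ?case unfolding gen
  proof (rule coveredI[of "(\<lambda>(s, j). s \<otimes> \<tau> [^] j) ` (T0 \<times> {..<m})"])
    have "card ((\<lambda>(s, j). s \<otimes> \<tau> [^] j) ` (T0 \<times> {..<m})) \<le> card (T0 \<times> {..<m})"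
      using T0(1) by (intro card_image_le) auto
    also have "\<dots> \<le> m ^ card T * m" using T0(3) by (simp add: card_cartesian_product)
    finally show "card ((\<lambda>(s, j). s \<otimes> \<tau> [^] j) ` (T0 \<times> {..<m})) \<le> m ^ card (insert \<tau> T)"
      using insert.hyps by (simp add: mult.commute)
    show "(\<lambda>(s, j). s \<otimes> \<tau> [^] j) ` (T0 \<times> {..<m}) \<subseteq> generate G (insert \<tau> V)"
    proof clarify
      fix s j assume "s \<in> T0"
      hence "s \<otimes> \<tau> [^] j = s \<otimes> \<tau> [^] (int j) \<and> s \<in> V" using T0(2) by (auto simp: int_pow_int)
      thus "s \<otimes> \<tau> [^] j \<in> generate G (insert \<tau> V)" unfolding eq by blast
    qed
    fix x assume "x \<in> generate G (insert \<tau> V)"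
    then obtain v k where v: "v \<in> V" "x = v \<otimes> \<tau> [^] (k::int)" unfolding eq by blast
    obtain s b where sb: "s \<in> T0" "b \<in> B" "v = s \<otimes> b" using T0(4) v by blast
    have sc: "s \<in> carrier G" "b \<in> carrier G" "s \<in> V" using sb T0 Vc Bc by auto
    have bU: "b \<in> U"
      using subgroup_mult_cancel_left[OF sV sc(3) sc(2)] v sb VU by blast
    define j where "j = nat (k mod int m)"
    define q where "q = k div int m"
    have j: "j < m" using m by (simp add: j_def nat_less_iff)
    have "k = int j + int m * q" using m by (simp add: j_def q_def)
    hence \<tau>k: "\<tau> [^] k = \<tau> [^] j \<otimes> (\<tau> [^] m) [^] q"
      using \<tau> by (simp add: int_pow_mult int_pow_pow int_pow_int flip: int_pow_int)
    define c where "c = inv (\<tau> [^] j)"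
    have cU: "c \<in> U" "c \<in> carrier G" using \<tau> by (simp_all add: c_def subgroupD[OF U])
    \<comment> \<open>Moving \<open>b\<close> past the power of \<tau> changes it by a commutator,
      which lies in \<open>Y\<close> and hence in \<open>B\<close>.\<close>
    have "conjg G c b = commt G c b \<otimes> b" by (rule conjg_eq[OF cU(2) sc(2)])
    moreover have "commt G c b \<in> B" using ab[OF cU(1) bU] B(2) by blast
    ultimately have cb: "conjg G c b \<in> B" using sb subgroupD(5)[OF B(1)] by simp
    have tm: "(\<tau> [^] m) [^] q \<in> B" using insert.prems by (intro subgroupD(9)[OF B(1)]) auto
    have "x = (s \<otimes> \<tau> [^] j) \<otimes> (conjg G c b \<otimes> (\<tau> [^] m) [^] q)"
      unfolding v(2) sb(3) \<tau>k c_def using sc \<tau> by (simp add: grp)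
    moreover have "conjg G c b \<otimes> (\<tau> [^] m) [^] q \<in> B" by (rule subgroupD(5)[OF B(1) cb tm])
    ultimately show "\<exists>t\<in>(\<lambda>(s, j). s \<otimes> \<tau> [^] j) ` (T0 \<times> {..<m}). \<exists>b\<in>B. x = t \<otimes> b"
      using sb(1) j by force
  qed (use T0 in auto)
qed

lemma power_bounded_abelian:
  assumes Y: "subgroup Y G" and U: "subgroup U G" and YU: "Y \<subseteq> U"
    and ab: "\<And>x y. x \<in> U \<Longrightarrow> y \<in> U \<Longrightarrow> commt G x y \<in> Y"
    and rank: "\<And>F. finite F \<Longrightarrow> F \<subseteq> U \<Longrightarrow> \<exists>T\<subseteq>U. finite T \<and> card T \<le> r \<and> F \<subseteq> generate G (T \<union> Y)"
  shows "power_bounded G U Y"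
  unfolding power_bounded_def
proof (intro exI allI impI, elim conjE)
  fix m :: nat and B assume m: "m > 0" and B: "subgroup B G" "Y \<subseteq> B" "\<forall>x\<in>U. x [^] m \<in> B"
  show "covered G U B (1 * m ^ r)"
  proof (rule covered_if_finite_subsets_covered[OF B(1) subgroupD(1)[OF U]])
    fix F assume "finite F" "F \<subseteq> U"
    then obtain T where T: "T \<subseteq> U" "finite T" "card T \<le> r" "F \<subseteq> generate G (T \<union> Y)" using rank by blast
    have "covered G (generate G (T \<union> Y)) B (m ^ card T)"
      using T B by (intro abelian_factor_covered[OF Y U YU ab B(1,2) m]) auto
    then obtain V where V: "finite V" "V \<subseteq> generate G (T \<union> Y)" "card V \<le> m ^ card T"
      "\<forall>x\<in>generate G (T \<union> Y). \<exists>t\<in>V. \<exists>b\<in>B. x = t \<otimes> b" by (rule coveredE)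
    have "m ^ card T \<le> m ^ r" using m T by (intro power_increasing) auto
    moreover have "generate G (T \<union> Y) \<subseteq> carrier G"
      using T(1) YU subgroupD(1)[OF U] by (intro generate_incl) auto
    ultimately show "\<exists>T. finite T \<and> T \<subseteq> carrier G \<and> card T \<le> 1 * m ^ r \<and> (\<forall>x\<in>F. \<exists>t\<in>T. \<exists>b\<in>B. x = t \<otimes> b)"
      using V T(4) by (intro exI[of _ V]) auto
  qed
qed

lemma power_bounded_finite:
  assumes "covered G U Y k"
  shows "power_bounded G U Y"
  unfolding power_bounded_def
  using assms by (intro exI[of _ k] exI[of _ 0]) (auto intro: covered_mono)

text \<open>Between \<open>U\<close> and \<open>C\<close>, the part of \<open>B\<close> in
  \<open>U\<close>, insert \<open>D = Y C\<close>. The first bound controls the index of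
  \<open>D\<close> in \<open>U\<close>. Representatives for \<open>C\<close> in \<open>D\<close> can
  be taken from \<open>Y\<close>, where the second bound controls their number.\<close>

lemma power_bounded_trans:
  assumes Y: "subgroup Y G" and U: "subgroup U G" and YU: "Y \<subseteq> U" and n: "normalizes G U Y"
    and ZY: "Z \<subseteq> Y"
    and 1: "power_bounded G U Y" and 2: "power_bounded G Y Z"
  shows "power_bounded G U Z"
proof -
  obtain c d where cd: "\<And>m B. m > 0 \<Longrightarrow> subgroup B G \<Longrightarrow> Y \<subseteq> B \<Longrightarrow> \<forall>x\<in>U. x [^] m \<in> B \<Longrightarrow> covered G U B (c * m ^ d)"
    using 1 unfolding power_bounded_def by blast
  obtain c' d' where cd': "\<And>m B. m > 0 \<Longrightarrow> subgroup B G \<Longrightarrow> Z \<subseteq> B \<Longrightarrow> \<forall>x\<in>Y. x [^] m \<in> B \<Longrightarrow> covered G Y B (c' * m ^ d')"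
    using 2 unfolding power_bounded_def by blast
  show ?thesis unfolding power_bounded_def
  proof (intro exI allI impI, elim conjE)
    fix m :: nat and B assume m: "m > 0" and B: "subgroup B G" "Z \<subseteq> B" "\<forall>x\<in>U. x [^] m \<in> B"
    have Uc: "U \<subseteq> carrier G" by (rule subgroupD(1)[OF U])
    define C where "C = B \<inter> U"
    have C: "subgroup C G" unfolding C_def using B(1) U by (rule subgroups_Inter_pair)
    define D where "D = {y \<otimes> b | y b. y \<in> Y \<and> b \<in> C}"
    have Cc: "C \<subseteq> carrier G" and Yc: "Y \<subseteq> carrier G" using subgroupD(1) C Y by auto
    have nC: "conjg G b y \<in> Y" if "b \<in> C" "y \<in> Y" for b y
      using that by (intro normalizesD[OF n]) (auto simp: C_def)
    have D: "subgroup D G"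
    proof
      show "D \<subseteq> carrier G" using Cc Yc by (auto simp: D_def)
      show "\<one> \<in> D" using subgroupD(2)[OF C] subgroupD(2)[OF Y] unfolding D_def
        by (intro CollectI exI[of _ \<one>]) auto
      fix a assume "a \<in> D"
      then obtain y b where a: "a = y \<otimes> b" "y \<in> Y" "b \<in> C" by (auto simp: D_def)
      have "inv a = conjg G (inv b) (inv y) \<otimes> inv b" unfolding a(1) using a Cc Yc by (simp add: grp subset_iff)
      moreover have "conjg G (inv b) (inv y) \<in> Y" using a by (intro nC subgroupD(4)[OF Y] subgroupD(4)[OF C])
      ultimately show "inv a \<in> D" using a subgroupD(4)[OF C] unfolding D_def by blast
      fix a' assume "a' \<in> D"
      then obtain y' b' where a': "a' = y' \<otimes> b'" "y' \<in> Y" "b' \<in> C" by (auto simp: D_def)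
      have "a \<otimes> a' = (y \<otimes> conjg G b y') \<otimes> (b \<otimes> b')"
        unfolding a(1) a'(1) using a a' Cc Yc by (simp add: grp subset_iff)
      moreover have "y \<otimes> conjg G b y' \<in> Y" using a a' by (intro nC subgroupD(5)[OF Y])
      moreover have "b \<otimes> b' \<in> C" using a a' by (intro subgroupD(5)[OF C])
      ultimately show "a \<otimes> a' \<in> D" unfolding D_def by blast
    qed
    have YD: "Y \<subseteq> D"
    proof
      fix y assume y: "y \<in> Y"
      hence "y = y \<otimes> \<one> \<and> \<one> \<in> C" using Yc subgroupD(2)[OF C] by auto
      thus "y \<in> D" unfolding D_def using y by blast
    qed
    have CD: "C \<subseteq> D"
    proof
      fix y assume y: "y \<in> C"
      hence "y = \<one> \<otimes> y \<and> \<one> \<in> Y" using Cc subgroupD(2)[OF Y] by auto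
      thus "y \<in> D" unfolding D_def using y by blast
    qed
    have "\<forall>x\<in>U. x [^] m \<in> D" using B(3) CD subgroupD(8)[OF U] by (auto simp: C_def)
    hence c1: "covered G U D (c * m ^ d)" by (intro cd m D YD)
    have "covered G Y (B \<inter> Y) (c' * m ^ d')"
      using B ZY YU subgroupD(8)[OF Y] by (intro cd' m subgroups_Inter_pair B(1) Y) auto
    hence c2: "covered G Y C (c' * m ^ d')" by (rule covered_mono) (use YU in \<open>auto simp: C_def\<close>)
    have "covered G D C (c' * m ^ d')"
    proof -
      obtain T where T: "finite T" "T \<subseteq> Y" "card T \<le> c' * m ^ d'" "\<forall>x\<in>Y. \<exists>t\<in>T. \<exists>b\<in>C. x = t \<otimes> b"
        using c2 by (rule coveredE)
      show ?thesis
      proof (rule coveredI[OF T(1) _ T(3)])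
        show "T \<subseteq> D" using T(2) YD by blast
        fix x assume "x \<in> D"
        then obtain y b where x: "x = y \<otimes> b" "y \<in> Y" "b \<in> C" by (auto simp: D_def)
        then obtain t b' where t: "t \<in> T" "b' \<in> C" "y = t \<otimes> b'" using T(4) by blast
        have "x = t \<otimes> (b' \<otimes> b)" using x t T(2) Yc Cc by (simp add: m_assoc subset_iff)
        thus "\<exists>t\<in>T. \<exists>b\<in>C. x = t \<otimes> b" using t x subgroupD(5)[OF C] by blast
      qed
    qed
    moreover have "D \<subseteq> U" using YU subgroupD(5)[OF U] by (auto simp: D_def C_def)
    ultimately have "covered G U C ((c * m ^ d) * (c' * m ^ d'))"
      by (intro covered_trans[OF c1 _ Uc U _ Cc])
    thus "covered G U B ((c * c') * m ^ (d + d'))"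
      by (rule covered_mono) (auto simp: C_def power_add mult_ac)
  qed
qed

lemma power_boundedD:
  assumes "power_bounded G U {\<one>}" and "subgroup U G"
  shows "\<exists>c d. \<forall>m>0. covered G U (power_subgroup G U m) (c * m ^ d)"
proof -
  obtain c d where cd: "\<And>m B. m > 0 \<Longrightarrow> subgroup B G \<Longrightarrow> {\<one>} \<subseteq> B \<Longrightarrow> \<forall>x\<in>U. x [^] m \<in> B \<Longrightarrow> covered G U B (c * m ^ d)"
    using assms(1) unfolding power_bounded_def by blast
  show ?thesis
    by (intro exI[of _ c] exI[of _ d] allI impI cd)
       (auto intro: power_subgroup_incl assms(2) power_subgroup_subgroup subgroupD(2))
qed

section \<open>Word spheres and Schreier generators\<close>

lemma sphere_subset: "S \<subseteq> H \<Longrightarrow> subgroup H G \<Longrightarrow> sphere G S n \<subseteq> H"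
  by (induction n) (auto simp: subgroupD subset_iff intro: subgroupD(2) subgroupD(5))

lemma sphere_closed: "S \<subseteq> carrier G \<Longrightarrow> sphere G S n \<subseteq> carrier G"
  by (rule sphere_subset[OF _ subgroup_self])

lemma sphere_add:
  assumes "S \<subseteq> carrier G"
  shows "g \<in> sphere G S m \<Longrightarrow> h \<in> sphere G S n \<Longrightarrow> g \<otimes> h \<in> sphere G S (m + n)"
proof (induction m arbitrary: g)
  case 0
  thus ?case using sphere_closed[OF assms, of n] by auto
next
  case (Suc m)
  then obtain s g' where g: "g = s \<otimes> g'" "s \<in> S" "g' \<in> sphere G S m" by auto
  have "g \<otimes> h = s \<otimes> (g' \<otimes> h)"
    unfolding g(1) using g Suc.prems(2) assms sphere_closed[OF assms, of m] sphere_closed[OF assms, of n]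
    by (intro m_assoc) auto
  thus ?case using Suc.IH[OF g(3) Suc.prems(2)] g(2) by auto
qed

lemma sphere_one: "s \<in> S \<Longrightarrow> S \<subseteq> carrier G \<Longrightarrow> s \<in> sphere G S 1"
  by (auto intro!: exI[of _ s])

lemma sphere_inv:
  assumes S: "S \<subseteq> carrier G"
  defines "S1 \<equiv> S \<union> (\<lambda>s. inv s) ` S"
  shows "g \<in> sphere G S1 n \<Longrightarrow> inv g \<in> sphere G S1 n"
proof (induction n arbitrary: g)
  case (Suc n)
  have Sc: "S1 \<subseteq> carrier G" and invS: "\<And>s. s \<in> S1 \<Longrightarrow> inv s \<in> S1" using S by (auto simp: S1_def)
  obtain s g' where g: "g = s \<otimes> g'" "s \<in> S1" "g' \<in> sphere G S1 n" using Suc.prems by auto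
  have "inv g = inv g' \<otimes> inv s"
    unfolding g(1) using g Sc sphere_closed[OF Sc, of n] by (intro inv_mult_group) auto
  thus ?case using sphere_add[OF Sc Suc.IH[OF g(3)] sphere_one[OF invS[OF g(2)] Sc]] by simp
qed auto

lemma generate_eq_spheres:
  assumes S: "S \<subseteq> carrier G"
  shows "generate G S = (\<Union>n. sphere G (S \<union> (\<lambda>s. inv s) ` S) n)"
proof
  let ?S = "S \<union> (\<lambda>s. inv s) ` S"
  have Sc: "?S \<subseteq> carrier G" using S by auto
  have "subgroup (\<Union>n. sphere G ?S n) G"
  proof
    show "(\<Union>n. sphere G ?S n) \<subseteq> carrier G" using sphere_closed[OF Sc] by blast
    show "\<one> \<in> (\<Union>n. sphere G ?S n)" by (rule UN_I[of 0]) auto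
    fix g assume "g \<in> (\<Union>n. sphere G ?S n)"
    then obtain m where g: "g \<in> sphere G ?S m" by blast
    show "inv g \<in> (\<Union>n. sphere G ?S n)" by (rule UN_I[of m], simp, rule sphere_inv[OF S g])
    fix h assume "h \<in> (\<Union>n. sphere G ?S n)"
    then obtain n where h: "h \<in> sphere G ?S n" by blast
    show "g \<otimes> h \<in> (\<Union>n. sphere G ?S n)" by (rule UN_I[of "m + n"], simp, rule sphere_add[OF Sc g h])
  qed
  moreover have "S \<subseteq> (\<Union>n. sphere G ?S n)"
  proof
    fix s assume "s \<in> S"
    thus "s \<in> (\<Union>n. sphere G ?S n)" by (intro UN_I[of 1] sphere_one Sc) auto
  qed
  ultimately show "generate G S \<subseteq> (\<Union>n. sphere G ?S n)" by (rule generate_least)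
  have "?S \<subseteq> generate G S" by (auto intro: generate.incl generate.inv)
  from sphere_subset[OF this generate_subgroup[OF S]]
  show "(\<Union>n. sphere G ?S n) \<subseteq> generate G S" by blast
qed

text \<open>Rewriting a word letter by letter through coset representatives produces a word of the
  same length in the Schreier generators. The preserved length is what growth estimates in a finite
  index subgroup rely on.\<close>

lemma schreier:
  assumes cov: "covered G (carrier G) H k" and H: "subgroup H G" and S: "finite S" "S \<subseteq> carrier G"
  shows "\<exists>S'. finite S' \<and> S' \<subseteq> H \<and> (\<forall>n g. g \<in> sphere G S n \<longrightarrow> g \<in> H \<longrightarrow> g \<in> sphere G S' n)"
proof -
  obtain T where T: "finite T" "T \<subseteq> carrier G" "card T \<le> k" "\<forall>x\<in>carrier G. \<exists>t\<in>T. \<exists>b\<in>H. x = t \<otimes> b"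
    using cov by (rule coveredE)
  \<comment> \<open>The representative of \<open>H\<close> itself is the identity, so for
    \<open>g\<close> in \<open>H\<close> the rewritten remainder \<open>inv (r g)\<close> times
    \<open>g\<close> is \<open>g\<close>.\<close>
  define r where "r x = (if x \<in> H then \<one> else SOME t. t \<in> T \<and> (\<exists>b\<in>H. x = t \<otimes> b))" for x
  have r: "r x \<in> insert \<one> T \<and> inv (r x) \<otimes> x \<in> H" if x: "x \<in> carrier G" for x
  proof (cases "x \<in> H")
    case False
    have "\<exists>t. t \<in> T \<and> (\<exists>b\<in>H. x = t \<otimes> b)" using T(4) x by blast
    from someI_ex[OF this] False have *: "r x \<in> T" "\<exists>b\<in>H. x = r x \<otimes> b" by (auto simp: r_def)
    then obtain b where b: "b \<in> H" "x = r x \<otimes> b" by blast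
    have "inv (r x) \<otimes> x = b" using b * T(2) subgroupD(3)[OF H b(1)] by (metis inv_cancel_left subsetD)
    thus ?thesis using * b by auto
  qed (use x in \<open>auto simp: r_def\<close>)
  have rc: "r x \<in> carrier G" if "x \<in> carrier G" for x using r[OF that] T(2) by auto
  define S' where "S' = {inv t \<otimes> s \<otimes> t' | t s t'. t \<in> insert \<one> T \<and> s \<in> S \<and> t' \<in> insert \<one> T} \<inter> H"
  have "finite S'"
  proof -
    have "S' \<subseteq> (\<lambda>(t, s, t'). inv t \<otimes> s \<otimes> t') ` (insert \<one> T \<times> S \<times> insert \<one> T)"
      by (auto simp: S'_def image_iff) blast+
    thus ?thesis by (rule finite_subset) (use S T in auto)
  qed
  moreover have main: "inv (r g) \<otimes> g \<in> sphere G S' n" if "g \<in> sphere G S n" for g n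
    using that
  proof (induction n arbitrary: g)
    case 0
    thus ?case using subgroupD(2)[OF H] by (auto simp: r_def)
  next
    case (Suc n)
    then obtain s g' where g: "g = s \<otimes> g'" "s \<in> S" "g' \<in> sphere G S n" by auto
    have c: "s \<in> carrier G" "g' \<in> carrier G" "g \<in> carrier G"
      using g S sphere_closed[OF S(2), of n] by auto
    define a where "a = inv (r g) \<otimes> s \<otimes> r g'"
    have split: "inv (r g) \<otimes> g = a \<otimes> (inv (r g') \<otimes> g')"
      unfolding a_def g(1) using c rc[OF c(2)] rc[OF c(3)] by (simp add: grp g(1))
    have ac: "a \<in> carrier G" using c rc by (simp add: a_def)
    have "a \<in> H"
      using subgroup_mult_cancel_right[OF H conjunct2[OF r[OF c(2)]] ac] r[OF c(3)] split by simp
    hence "a \<in> S'" unfolding S'_def a_def using r[OF c(2)] r[OF c(3)] g(2) by blast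
    thus ?case unfolding split using Suc.IH[OF g(3)] by auto
  qed
  have "g \<in> sphere G S' n" if "g \<in> sphere G S n" "g \<in> H" for g n
    using main[OF that(1)] that(2) subgroupD(3)[OF H that(2)] by (simp add: r_def)
  ultimately show ?thesis by (intro exI[of _ S']) (auto simp: S'_def)
qed

lemma schreier_generate:
  assumes cov: "covered G (carrier G) H k" and H: "subgroup H G"
    and S: "finite S" "S \<subseteq> carrier G" "generate G S = carrier G"
  shows "\<exists>S'. finite S' \<and> S' \<subseteq> H \<and> generate G S' = H"
proof -
  define S1 where "S1 = S \<union> (\<lambda>s. inv s) ` S"
  have S1: "finite S1" "S1 \<subseteq> carrier G" using S by (auto simp: S1_def)
  have all: "(\<Union>n. sphere G S1 n) = carrier G" using generate_eq_spheres[OF S(2)] S(3) by (simp add: S1_def)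
  obtain S2 where S2: "finite S2" "S2 \<subseteq> H" "\<forall>n g. g \<in> sphere G S1 n \<longrightarrow> g \<in> H \<longrightarrow> g \<in> sphere G S2 n"
    using schreier[OF cov H S1] by blast
  have Hc: "H \<subseteq> carrier G" by (rule subgroupD(1)[OF H])
  have "generate G S2 = H"
  proof
    show "generate G S2 \<subseteq> H" by (rule generate_least[OF H S2(2)])
    show "H \<subseteq> generate G S2"
    proof
      fix h assume h: "h \<in> H"
      then obtain n where "h \<in> sphere G S1 n" using all Hc by blast
      hence "h \<in> sphere G S2 n" using S2(3) h by blast
      moreover have "sphere G S2 n \<subseteq> generate G S2"
        using S2(2) Hc by (intro sphere_subset generate_subset generate_subgroup) auto
      ultimately show "h \<in> generate G S2" by blast
    qed
  qed
  thus ?thesis using S2 by blast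
qed

end

section \<open>Polynomial functions on nilpotent groups\<close>

definition ldiff :: "('a, 'b) monoid_scheme \<Rightarrow> 'a \<Rightarrow> ('a \<Rightarrow> int) \<Rightarrow> 'a \<Rightarrow> int" where
  "ldiff G u f = (\<lambda>y. f (u \<otimes>\<^bsub>G\<^esub> y) - f y)"

text \<open>Polynomial functions of degree less than \<open>n\<close>.\<close>

primrec polyf :: "('a, 'b) monoid_scheme \<Rightarrow> 'a set \<Rightarrow> nat \<Rightarrow> ('a \<Rightarrow> int) \<Rightarrow> bool" where
  "polyf G B 0 f \<longleftrightarrow> (\<forall>b\<in>B. f b = 0)"
| "polyf G B (Suc n) f \<longleftrightarrow> (\<forall>u\<in>B. polyf G B n (ldiff G u f))"

text \<open>The same with the degree measured along a filtration \<open>L\<close>: differencing by an element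
  of \<open>L j\<close> counts \<open>j + 1\<close> times.\<close>

fun wpolyf :: "('a, 'b) monoid_scheme \<Rightarrow> (nat \<Rightarrow> 'a set) \<Rightarrow> 'a set \<Rightarrow> nat \<Rightarrow> ('a \<Rightarrow> int) \<Rightarrow> bool" where
  "wpolyf G L B 0 f \<longleftrightarrow> (\<forall>b\<in>B. f b = 0)"
| "wpolyf G L B (Suc n) f \<longleftrightarrow> (\<forall>j. \<forall>u\<in>B \<inter> L j. wpolyf G L B (n - j) (ldiff G u f))"

definition separating :: "('a, 'b) monoid_scheme \<Rightarrow> 'a set \<Rightarrow> nat \<Rightarrow> ('a \<Rightarrow> int) set \<Rightarrow> bool" where
  "separating G B n F \<longleftrightarrow> finite F \<and> (\<forall>f\<in>F. polyf G B n f) \<and>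
     (\<forall>g\<in>B. g \<noteq> \<one>\<^bsub>G\<^esub> \<longrightarrow> (\<exists>f\<in>F. f g \<noteq> f \<one>\<^bsub>G\<^esub>))"

definition virt_separated :: "('a, 'b) monoid_scheme \<Rightarrow> 'a set \<Rightarrow> bool" where
  "virt_separated G U \<longleftrightarrow> (\<exists>B k n F. subgroup B G \<and> B \<subseteq> U \<and> covered G U B k \<and> separating G B n F)"

lemma newton_forward_difference:
  fixes h :: "nat \<Rightarrow> int"
  shows "h m = (\<Sum>k\<le>m. int (m choose k) * ((\<lambda>h j. h (Suc j) - h j) ^^ k) h 0)"
proof (induction m arbitrary: h)
  case (Suc m)
  let ?D = "\<lambda>(h :: nat \<Rightarrow> int) j. h (Suc j) - h j"
  define a where "a k = (?D ^^ k) h 0" for k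
  have sh: "(\<Sum>k\<le>i. c k) = c 0 + (\<Sum>k<i. c (Suc k))" for i and c :: "nat \<Rightarrow> int"
    by (simp only: lessThan_Suc_atMost[symmetric] sum.lessThan_Suc_shift)
  have "h m = (\<Sum>k\<le>m. int (m choose k) * a k)" unfolding a_def by (rule Suc.IH)
  also have "\<dots> = a 0 + (\<Sum>k<m. int (m choose Suc k) * a (Suc k))" by (simp add: sh)
  also have "(\<Sum>k<m. int (m choose Suc k) * a (Suc k)) = (\<Sum>k<Suc m. int (m choose Suc k) * a (Suc k))"
    by (simp add: binomial_eq_0)
  finally have 1: "h m = a 0 + (\<Sum>k<Suc m. int (m choose Suc k) * a (Suc k))" .
  have "?D h m = (\<Sum>k\<le>m. int (m choose k) * (?D ^^ k) (?D h) 0)" by (rule Suc.IH)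
  also have "\<dots> = (\<Sum>k<Suc m. int (m choose k) * a (Suc k))"
    by (simp only: a_def funpow_Suc_right o_apply lessThan_Suc_atMost)
  finally have 2: "h (Suc m) - h m = (\<Sum>k<Suc m. int (m choose k) * a (Suc k))" .
  have "(\<Sum>k\<le>Suc m. int (Suc m choose k) * a k) = a 0 + (\<Sum>k<Suc m. int (Suc m choose Suc k) * a (Suc k))"
    by (simp only: sh) simp
  also have "\<dots> = a 0 + (\<Sum>k<Suc m. int (m choose Suc k) * a (Suc k)) + (\<Sum>k<Suc m. int (m choose k) * a (Suc k))"
    by (simp only: binomial_Suc_Suc of_nat_add distrib_right sum.distrib add_ac)
  finally show ?case using 1 2 by (simp add: a_def)
qed simp

text \<open>In \<open>k * (q * n! choose k) = q * n! * ...\<close> the factor \<open>q\<close>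
  survives cancelling \<open>k\<close>, since \<open>k\<close> divides \<open>n!\<close>. This is
  the origin of \<open>n!\<close> in the periods below.\<close>

lemma dvd_binomial_fact:
  assumes "0 < k" "k \<le> n"
  shows "q dvd (q * fact n choose k :: nat)"
proof (cases "q = 0")
  case False
  obtain k' where k': "k = Suc k'" using assms by (cases k) auto
  obtain m' where m': "q * fact n = Suc m'" using False by (cases "q * fact n") auto
  obtain r :: nat where r: "fact n = k * r" using assms dvd_fact[of k n] by (auto elim: dvdE)
  have "k * (q * fact n choose k) = q * fact n * (m' choose k')"
    unfolding k' m' using Suc_times_binomial_eq[of m' k'] by (simp add: mult.commute)
  also have "\<dots> = k * (q * (r * (m' choose k')))" by (simp only: r mult_ac)
  finally have "(q * fact n choose k) = q * (r * (m' choose k'))" using assms by simp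
  thus ?thesis by simp
qed (use assms in auto)

text \<open>In Newton's expansion at \<open>q * n!\<close> the constant term is \<open>h 0\<close>,
  the binomials of order 1 to \<open>n\<close> are divisible by \<open>q\<close>, and the higher
  differences vanish.\<close>

lemma periodic_mod:
  fixes h :: "nat \<Rightarrow> int"
  assumes "\<And>k. k \<ge> n \<Longrightarrow> ((\<lambda>h j. h (Suc j) - h j) ^^ k) h 0 = 0"
  shows "int q dvd h (q * fact n) - h 0"
proof -
  let ?D = "\<lambda>(h :: nat \<Rightarrow> int) j. h (Suc j) - h j"
  define m where "m = q * fact n"
  have "h m = (\<Sum>k\<le>m. int (m choose k) * (?D ^^ k) h 0)" by (rule newton_forward_difference)
  also have "\<dots> = h 0 + (\<Sum>k\<in>{0<..m}. int (m choose k) * (?D ^^ k) h 0)"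
    by (subst sum.remove[of _ 0]) (auto intro!: sum.cong)
  finally have "h m - h 0 = (\<Sum>k\<in>{0<..m}. int (m choose k) * (?D ^^ k) h 0)" by simp
  also have "int q dvd \<dots>"
  proof (rule dvd_sum)
    fix k assume k: "k \<in> {0<..m}"
    show "int q dvd int (m choose k) * (?D ^^ k) h 0"
    proof (cases "k \<le> n")
      case True
      hence "int q dvd int (m choose k)" using dvd_binomial_fact[of k n q] k by (simp add: m_def)
      thus ?thesis by simp
    qed (use assms[of k] in auto)
  qed
  finally show ?thesis by (simp add: m_def)
qed

context group
begin

lemma ldiff_cong: "subgroup B G \<Longrightarrow> (\<And>b. b \<in> B \<Longrightarrow> f b = g b) \<Longrightarrow> u \<in> B \<Longrightarrow> b \<in> B \<Longrightarrow> ldiff G u f b = ldiff G u g b"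
  by (simp add: ldiff_def subgroupD)

lemma polyf_cong:
  assumes B: "subgroup B G"
  shows "(\<And>b. b \<in> B \<Longrightarrow> f b = g b) \<Longrightarrow> polyf G B n f \<Longrightarrow> polyf G B n g"
proof (induction n arbitrary: f g)
  case (Suc n)
  show ?case unfolding polyf.simps
  proof
    fix u assume u: "u \<in> B"
    have "ldiff G u f b = ldiff G u g b" if "b \<in> B" for b
      by (rule ldiff_cong[OF B Suc.prems(1) u that])
    moreover have "polyf G B n (ldiff G u f)" using Suc.prems(2) u by simp
    ultimately show "polyf G B n (ldiff G u g)" by (rule Suc.IH)
  qed
qed auto

lemma polyf_subset: "C \<subseteq> B \<Longrightarrow> polyf G B n f \<Longrightarrow> polyf G C n f"
  by (induction n arbitrary: f) auto

lemma polyf_Suc: "subgroup B G \<Longrightarrow> polyf G B n f \<Longrightarrow> polyf G B (Suc n) f"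
  by (induction n arbitrary: f) (auto simp: ldiff_def subgroupD)

lemma polyf_mono: "subgroup B G \<Longrightarrow> n \<le> m \<Longrightarrow> polyf G B n f \<Longrightarrow> polyf G B m f"
  by (rotate_tac 1, induction m rule: dec_induct) (auto intro: polyf_Suc simp del: polyf.simps)

lemma polyf_iterated_ldiff:
  assumes B: "subgroup B G" and x: "x \<in> B"
  shows "polyf G B n f \<Longrightarrow> k \<ge> n \<Longrightarrow> polyf G B 0 ((ldiff G x ^^ k) f)"
proof (induction k arbitrary: n f)
  case (Suc k)
  have "polyf G B k (ldiff G x f)"
  proof (cases n)
    case 0
    thus ?thesis using Suc.prems polyf_mono[OF B, of 0 k] x by (auto simp: ldiff_def subgroupD[OF B] simp del: polyf.simps(2))
  next
    case (Suc n')
    thus ?thesis using Suc.prems x polyf_mono[OF B, of n' k] by auto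
  qed
  from Suc.IH[OF this] show ?case by (simp only: funpow_Suc_right o_apply order_refl)
qed simp

lemma polyf_periodic:
  assumes B: "subgroup B G" and f: "polyf G B n f" and x: "x \<in> B" and y: "y \<in> B"
  shows "int q dvd f (x [^] (q * fact n) \<otimes> y) - f y"
proof -
  let ?D = "\<lambda>(h :: nat \<Rightarrow> int) j. h (Suc j) - h j"
  have xy: "x \<in> carrier G" "y \<in> carrier G" using x y subgroupD(3)[OF B] by auto
  \<comment> \<open>Along the sequence \<open>x^j y\<close>, differencing in \<open>j\<close> is the
    left difference by \<open>x\<close>.\<close>
  define h where "h f j = f (x [^] j \<otimes> y)" for f :: "'a \<Rightarrow> int" and j :: nat
  have "x [^] Suc j \<otimes> y = x \<otimes> (x [^] j \<otimes> y)" for j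
    unfolding nat_pow_Suc2[OF xy(1)] using xy by (simp add: m_assoc)
  hence step: "?D (h f) = h (ldiff G x f)" for f
    by (simp add: h_def ldiff_def fun_eq_iff del: nat_pow_Suc)
  have pow: "(?D ^^ k) (h f) = h ((ldiff G x ^^ k) f)" for k f
    by (induction k arbitrary: f) (simp_all only: funpow_Suc_right o_apply step funpow_0 id_apply funpow.simps)
  have "int q dvd h f (q * fact n) - h f 0"
  proof (rule periodic_mod)
    fix k assume "k \<ge> n"
    hence "polyf G B 0 ((ldiff G x ^^ k) f)" by (rule polyf_iterated_ldiff[OF B x f])
    thus "(?D ^^ k) (h f) 0 = 0" unfolding pow using y xy by (simp add: h_def)
  qed
  thus ?thesis using xy by (simp add: h_def)
qed

text \<open>The elements whose left translation preserves \<open>f\<close> modulo \<open>q\<close>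
  at every point of \<open>B\<close> form a subgroup, which contains all powers with exponent
  \<open>q * n!\<close>.\<close>

lemma polyf_power_subgroup:
  assumes B: "subgroup B G" and f: "polyf G B n f" and g: "g \<in> power_subgroup G B (q * fact n)"
  shows "int q dvd f g - f \<one>"
proof -
  let ?P = "{g \<in> B. \<forall>y\<in>B. int q dvd f (g \<otimes> y) - f y}"
  have "subgroup ?P G"
  proof
    show "?P \<subseteq> carrier G" using subgroupD(1)[OF B] by auto
    show "\<one> \<in> ?P" using subgroupD[OF B] by auto
    fix a assume a: "a \<in> ?P"
    show "inv a \<in> ?P"
    proof (intro CollectI conjI ballI)
      fix y assume y: "y \<in> B"
      have "int q dvd f (a \<otimes> (inv a \<otimes> y)) - f (inv a \<otimes> y)"
        using a y subgroupD(4,5)[OF B] by blast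
      hence "int q dvd f y - f (inv a \<otimes> y)" using a y subgroupD(3)[OF B] by simp
      thus "int q dvd f (inv a \<otimes> y) - f y" by (simp add: dvd_diff_commute)
    qed (use a subgroupD(4)[OF B] in auto)
    fix b assume b: "b \<in> ?P"
    show "a \<otimes> b \<in> ?P"
    proof (intro CollectI conjI ballI)
      fix y assume y: "y \<in> B"
      have "int q dvd f (a \<otimes> (b \<otimes> y)) - f (b \<otimes> y)" using a b y subgroupD(5)[OF B] by blast
      moreover have "int q dvd f (b \<otimes> y) - f y" using b y by blast
      ultimately have "int q dvd (f (a \<otimes> (b \<otimes> y)) - f (b \<otimes> y)) + (f (b \<otimes> y) - f y)" by (rule dvd_add)
      thus "int q dvd f (a \<otimes> b \<otimes> y) - f y" using a b y subgroupD(3)[OF B] by (simp add: m_assoc)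
    qed (use a b subgroupD(5)[OF B] in auto)
  qed
  moreover have "x [^] (q * fact n) \<in> ?P" if "x \<in> B" for x
    using polyf_periodic[OF B f that] subgroupD(8)[OF B that] by simp
  ultimately have "power_subgroup G B (q * fact n) \<subseteq> ?P" by (intro power_subgroup_least)
  hence gP: "g \<in> ?P" using g by blast
  hence "int q dvd f (g \<otimes> \<one>) - f \<one>" using subgroupD(2)[OF B] by blast
  thus ?thesis using gP subgroupD(3)[OF B] by simp
qed

text \<open>A word of length \<open>k\<close> is built in \<open>k\<close> steps, and each step
  changes \<open>f\<close> by a difference along a generator, for which the estimate of lower degree
  is already known.\<close>

lemma polyf_growth:
  assumes B: "subgroup B G" and S: "finite S" "S \<subseteq> B"
  shows "polyf G B n f \<Longrightarrow> \<exists>C::nat. \<forall>k. \<forall>g\<in>sphere G S k. \<bar>f g\<bar> \<le> int (C * (k + 1) ^ n)"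
proof (induction n arbitrary: f)
  case 0
  thus ?case using sphere_subset[OF S(2) B] by (intro exI[of _ 0]) auto
next
  case (Suc n)
  have "\<forall>s\<in>S. \<exists>C::nat. \<forall>k. \<forall>g\<in>sphere G S k. \<bar>ldiff G s f g\<bar> \<le> int (C * (k + 1) ^ n)"
    using Suc S by auto
  then obtain C :: "'a \<Rightarrow> nat" where C: "\<And>s k g. s \<in> S \<Longrightarrow> g \<in> sphere G S k \<Longrightarrow> \<bar>ldiff G s f g\<bar> \<le> int (C s * (k + 1) ^ n)"
    by metis
  define D where "D = sum C S"
  have D: "C s \<le> D" if "s \<in> S" for s unfolding D_def using that S(1) by (intro member_le_sum) auto
  define A where "A = nat \<bar>f \<one>\<bar> + D"
  have bd: "\<bar>f g\<bar> \<le> int (nat \<bar>f \<one>\<bar> + k * (D * (k + 1) ^ n))" if "g \<in> sphere G S k" for g k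
    using that
  proof (induction k arbitrary: g)
    case (Suc k)
    then obtain s g' where g: "g = s \<otimes> g'" "s \<in> S" "g' \<in> sphere G S k" by auto
    have "f g = f g' + ldiff G s f g'" by (simp add: ldiff_def g)
    hence "\<bar>f g\<bar> \<le> \<bar>f g'\<bar> + \<bar>ldiff G s f g'\<bar>" by linarith
    also have "\<dots> \<le> int (nat \<bar>f \<one>\<bar> + k * (D * (k + 1) ^ n)) + int (C s * (k + 1) ^ n)"
      by (intro add_mono Suc.IH g C)
    also have "\<dots> \<le> int (nat \<bar>f \<one>\<bar> + k * (D * (k + 1) ^ n)) + int (D * (k + 1) ^ n)"
      using D[OF g(2)] by (intro add_left_mono) (simp only: of_nat_le_iff mult_le_mono1)
    also have "\<dots> = int (nat \<bar>f \<one>\<bar> + Suc k * (D * (k + 1) ^ n))" by (simp add: algebra_simps)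
    also have "\<dots> \<le> int (nat \<bar>f \<one>\<bar> + Suc k * (D * (Suc k + 1) ^ n))"
      by (simp only: of_nat_le_iff) (intro add_left_mono mult_left_mono power_mono; simp)
    finally show ?case by simp
  qed simp
  have "\<bar>f g\<bar> \<le> int (A * (k + 1) ^ Suc n)" if "g \<in> sphere G S k" for g k
  proof -
    have "nat \<bar>f \<one>\<bar> * 1 \<le> nat \<bar>f \<one>\<bar> * (k + 1) ^ Suc n"
      by (rule mult_left_mono[OF one_le_power]) simp_all
    moreover have "k * (D * (k + 1) ^ n) \<le> (k + 1) * (D * (k + 1) ^ n)"
      by (rule mult_right_mono) simp_all
    moreover have "nat \<bar>f \<one>\<bar> * (k + 1) ^ Suc n + (k + 1) * (D * (k + 1) ^ n) = A * (k + 1) ^ Suc n"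
      by (simp add: A_def algebra_simps)
    ultimately have "nat \<bar>f \<one>\<bar> + k * (D * (k + 1) ^ n) \<le> A * (k + 1) ^ Suc n" by linarith
    hence "int (nat \<bar>f \<one>\<bar> + k * (D * (k + 1) ^ n)) \<le> int (A * (k + 1) ^ Suc n)" by (simp only: of_nat_le_iff)
    thus ?thesis using bd[OF that] by linarith
  qed
  thus ?case by blast
qed

end

section \<open>Degree along a filtration, and its behaviour under conjugation\<close>

lemma wpolyf_SucD: "wpolyf G L B (Suc n) f \<Longrightarrow> u \<in> B \<Longrightarrow> u \<in> L j \<Longrightarrow> wpolyf G L B (n - j) (ldiff G u f)"
  by simp

context group
begin

lemma wpolyf_cong:
  assumes B: "subgroup B G"
  shows "(\<And>b. b \<in> B \<Longrightarrow> f b = g b) \<Longrightarrow> wpolyf G L B n f \<Longrightarrow> wpolyf G L B n g"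
proof (induction n arbitrary: f g rule: less_induct)
  case (less n)
  show ?case
  proof (cases n)
    case (Suc n')
    show ?thesis unfolding Suc wpolyf.simps
    proof (intro allI ballI)
      fix j u assume u: "u \<in> B \<inter> L j"
      have "n' - j < n" using Suc by simp
      moreover have "ldiff G u f b = ldiff G u g b" if "b \<in> B" for b
        by (rule ldiff_cong[OF B less.prems(1) _ that]) (use u in auto)
      moreover have "wpolyf G L B (n' - j) (ldiff G u f)" using less.prems(2) u Suc by simp
      ultimately show "wpolyf G L B (n' - j) (ldiff G u g)" by (rule less.IH)
    qed
  qed (use less.prems in auto)
qed

lemma wpolyf_zero:
  assumes B: "subgroup B G"
  shows "(\<And>b. b \<in> B \<Longrightarrow> f b = 0) \<Longrightarrow> wpolyf G L B n f"
proof (induction n arbitrary: f rule: less_induct)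
  case (less n)
  show ?case
  proof (cases n)
    case (Suc n')
    show ?thesis unfolding Suc wpolyf.simps
      by (intro allI ballI less.IH) (use less.prems Suc in \<open>auto simp: ldiff_def subgroupD[OF B]\<close>)
  qed (use less.prems in auto)
qed

lemma wpolyf_add:
  assumes B: "subgroup B G"
  shows "wpolyf G L B n f \<Longrightarrow> wpolyf G L B n g \<Longrightarrow> wpolyf G L B n (\<lambda>x. f x + g x)"
proof (induction n arbitrary: f g rule: less_induct)
  case (less n)
  show ?case
  proof (cases n)
    case (Suc n')
    show ?thesis unfolding Suc wpolyf.simps
    proof (intro allI ballI)
      fix j u assume u: "u \<in> B \<inter> L j"
      have "wpolyf G L B (n' - j) (\<lambda>x. ldiff G u f x + ldiff G u g x)"
        by (intro less.IH) (use less.prems u Suc in auto)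
      moreover have "(\<lambda>x. ldiff G u f x + ldiff G u g x) = ldiff G u (\<lambda>x. f x + g x)"
        by (auto simp: ldiff_def)
      ultimately show "wpolyf G L B (n' - j) (ldiff G u (\<lambda>x. f x + g x))" by simp
    qed
  qed (use less.prems in auto)
qed

lemma wpolyf_Suc:
  assumes B: "subgroup B G"
  shows "wpolyf G L B n f \<Longrightarrow> wpolyf G L B (Suc n) f"
proof (induction n arbitrary: f rule: less_induct)
  case (less n)
  show ?case
  proof (cases n)
    case 0
    thus ?thesis using less.prems wpolyf_zero[OF B, of f L "Suc n"] by auto
  next
    case (Suc n')
    show ?thesis unfolding Suc wpolyf.simps(2)[of G L B "Suc n'"]
    proof (intro allI ballI)
      fix j u assume u: "u \<in> B \<inter> L j"
      have w: "wpolyf G L B (n' - j) (ldiff G u f)" using less.prems u Suc by auto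
      show "wpolyf G L B (Suc n' - j) (ldiff G u f)"
      proof (cases "j \<le> n'")
        case True
        thus ?thesis using less.IH[OF _ w] Suc by (simp add: Suc_diff_le del: wpolyf.simps)
      qed (use w in simp)
    qed
  qed
qed

lemma wpolyf_mono: "subgroup B G \<Longrightarrow> n \<le> m \<Longrightarrow> wpolyf G L B n f \<Longrightarrow> wpolyf G L B m f"
  by (rotate_tac 1, induction m rule: dec_induct) (auto intro: wpolyf_Suc simp del: wpolyf.simps)

lemma wpolyf_ldiff:
  assumes B: "subgroup B G" "B \<subseteq> L 0" and u: "u \<in> B" and f: "wpolyf G L B n f"
  shows "wpolyf G L B n (ldiff G u f)"
proof (cases n)
  case 0
  thus ?thesis using f u by (auto simp: ldiff_def subgroupD[OF B(1)])
next
  case (Suc n')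
  have "wpolyf G L B (n' - 0) (ldiff G u f)"
    using f B(2) u unfolding Suc by (intro wpolyf_SucD) auto
  thus ?thesis unfolding Suc using wpolyf_Suc[OF B(1)] by simp
qed

text \<open>An element that moves \<open>L j\<close> into \<open>L (j + 1)\<close> acts unipotently on polynomial functions,
  because \<open>f(t u y t\<^sup>-\<^sup>1) = f(v u (t y t\<^sup>-\<^sup>1))\<close> with \<open>v = [t, u] \<in> L (j + 1)\<close>.\<close>

lemma wpolyf_conj_diff:
  assumes B: "subgroup B G" "B \<subseteq> L 0" and t: "t \<in> carrier G" "\<And>b. b \<in> B \<Longrightarrow> conjg G t b \<in> B"
    and L: "\<And>j u. u \<in> B \<Longrightarrow> u \<in> L j \<Longrightarrow> commt G t u \<in> L (Suc j)"
      "\<And>j u. u \<in> B \<Longrightarrow> u \<in> L j \<Longrightarrow> conjg G t u \<in> L j"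
  shows "wpolyf G L B (Suc n) f \<Longrightarrow> wpolyf G L B n (\<lambda>y. f (conjg G t y) - f y)"
proof (induction n arbitrary: f rule: less_induct)
  case (less n)
  have Bc: "b \<in> carrier G" if "b \<in> B" for b using that subgroupD(3)[OF B(1)] by blast
  have cB: "commt G t b \<in> B" if "b \<in> B" for b
    using that t(2)[OF that] by (simp add: commt_eq t(1) Bc subgroupD[OF B(1)])
  show ?case
  proof (cases n)
    case 0
    have "f (conjg G t b) - f b = 0" if b: "b \<in> B" for b
    proof -
      have "wpolyf G L B (n - 0) (ldiff G (commt G t b) f)"
        by (rule wpolyf_SucD[OF less.prems]) (use cB[OF b] B(2) in auto)
      hence "ldiff G (commt G t b) f b = 0" using b 0 by simp
      thus ?thesis using conjg_eq[OF t(1) Bc[OF b]] by (simp add: ldiff_def)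
    qed
    thus ?thesis using 0 by simp
  next
    case (Suc n')
    show ?thesis unfolding Suc wpolyf.simps
    proof (intro allI ballI)
      fix j u assume "u \<in> B \<inter> L j"
      hence u: "u \<in> B" "u \<in> L j" by auto
      define u' where "u' = conjg G t u"
      define v where "v = commt G t u"
      have u': "u' \<in> B" "u' \<in> L j" unfolding u'_def using u t(2) L(2) by auto
      have v: "v \<in> B" "v \<in> L (Suc j)" unfolding v_def using u cB L(1) by auto
      have u'v: "u' = v \<otimes> u" unfolding u'_def v_def by (rule conjg_eq[OF t(1) Bc[OF u(1)]])
      have w1: "wpolyf G L B (n' - j) (\<lambda>y. ldiff G u' f (conjg G t y) - ldiff G u' f y)"
      proof (cases "j \<le> n'")
        case True
        have "wpolyf G L B (Suc n' - j) (ldiff G u' f)" by (rule wpolyf_SucD[OF less.prems[unfolded Suc] u'])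
        hence "wpolyf G L B (Suc (n' - j)) (ldiff G u' f)" using True by (simp only: Suc_diff_le)
        thus ?thesis by (intro less.IH) (simp add: Suc)
      next
        case False
        have "wpolyf G L B (Suc n' - j) (ldiff G u' f)" by (rule wpolyf_SucD[OF less.prems[unfolded Suc] u'])
        hence "wpolyf G L B 0 (ldiff G u' f)" using False by simp
        thus ?thesis by (intro wpolyf_zero[OF B(1)]) (use t(2) in auto)
      qed
      have w2: "wpolyf G L B (n' - j) (ldiff G v f)"
        using wpolyf_SucD[OF less.prems[unfolded Suc] v] by simp
      have w3: "wpolyf G L B (n' - j) (ldiff G u (ldiff G v f))"
        by (rule wpolyf_ldiff[OF B u(1) w2])
      \<comment> \<open>The last two terms add up to the difference by \<open>v\<close> at
        \<open>u y\<close>. It has the required degree because \<open>v\<close> lies one term deeper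
        in the filtration than \<open>u\<close>.\<close>
      have "wpolyf G L B (n' - j) (\<lambda>y. (ldiff G u' f (conjg G t y) - ldiff G u' f y) + (ldiff G v f y + ldiff G u (ldiff G v f) y))"
        by (intro wpolyf_add[OF B(1)] w1 w2 w3)
      thus "wpolyf G L B (n' - j) (ldiff G u (\<lambda>y. f (conjg G t y) - f y))"
      proof (rule wpolyf_cong[OF B(1), rotated])
        fix y assume y: "y \<in> B"
        have "conjg G t (u \<otimes> y) = u' \<otimes> conjg G t y"
          unfolding u'_def by (rule conjg_mult[OF t(1) Bc[OF u(1)] Bc[OF y]])
        moreover have "u' \<otimes> y = v \<otimes> (u \<otimes> y)" unfolding u'v using Bc v u y by (simp add: m_assoc)
        ultimately show "(ldiff G u' f (conjg G t y) - ldiff G u' f y) + (ldiff G v f y + ldiff G u (ldiff G v f) y) =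
            ldiff G u (\<lambda>y. f (conjg G t y) - f y) y"
          by (simp add: ldiff_def)
      qed
    qed
  qed
qed

text \<open>A nontrivial element lies only in terms \<open>L j\<close> with \<open>j < c\<close>, so
  one ordinary difference costs at most \<open>c\<close> units of filtered degree; a difference by
  the identity is zero.\<close>

lemma wpolyf_if_polyf:
  assumes B: "subgroup B G" and L: "\<And>j. j \<ge> c \<Longrightarrow> L j \<subseteq> {\<one>}"
  shows "polyf G B n f \<Longrightarrow> wpolyf G L B (n * Suc c) f"
proof (induction n arbitrary: f)
  case (Suc n)
  have eq: "Suc n * Suc c = Suc (c + n * Suc c)" by simp
  show ?case unfolding eq wpolyf.simps
  proof (intro allI ballI)
    fix j u assume u: "u \<in> B \<inter> L j"
    have IH: "wpolyf G L B (n * Suc c) (ldiff G u f)" using Suc u by auto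
    show "wpolyf G L B (c + n * Suc c - j) (ldiff G u f)"
    proof (cases "u = \<one>")
      case True
      thus ?thesis by (intro wpolyf_zero[OF B]) (auto simp: ldiff_def subgroupD(3)[OF B])
    next
      case False
      hence "j < c" using L[of j] u by (meson IntE linorder_not_less singletonD subsetD)
      thus ?thesis by (intro wpolyf_mono[OF B _ IH]) simp
    qed
  qed
qed auto


lemma wpolyf_conj:
  assumes B: "subgroup B G" "B \<subseteq> L 0" and t: "t \<in> carrier G" "\<And>b. b \<in> B \<Longrightarrow> conjg G t b \<in> B"
    and L: "\<And>j u. u \<in> B \<Longrightarrow> u \<in> L j \<Longrightarrow> commt G t u \<in> L (Suc j)"
      "\<And>j u. u \<in> B \<Longrightarrow> u \<in> L j \<Longrightarrow> conjg G t u \<in> L j"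
    and f: "wpolyf G L B n f"
  shows "wpolyf G L B n (\<lambda>y. f (conjg G t y))"
proof -
  have "wpolyf G L B n (\<lambda>y. f (conjg G t y) - f y)"
    by (rule wpolyf_conj_diff[OF B t L wpolyf_Suc[OF B(1) f]])
  from wpolyf_add[OF B(1) this f] show ?thesis by simp
qed

section \<open>Separating functions on finitely generated nilpotent groups\<close>

lemma cyclic_extension_coordinates:
  assumes B: "subgroup B G" and tc: "t \<in> carrier G" and inf: "\<And>k::int. t [^] k \<in> B \<Longrightarrow> k = 0"
  shows "\<exists>\<beta> \<kappa>. \<forall>b\<in>B. \<forall>k::int. \<beta> (b \<otimes> t [^] k) = b \<and> \<kappa> (b \<otimes> t [^] k) = k"
proof -
  have Bc: "b \<in> carrier G" if "b \<in> B" for b using that subgroupD(3)[OF B(1)] by blast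
  have uniq: "b = b' \<and> k = k'" if "b \<in> B" "b' \<in> B" "b \<otimes> t [^] (k::int) = b' \<otimes> t [^] k'" for b b' k k'
  proof -
    have "inv b' \<otimes> b \<otimes> t [^] k = t [^] k'" using that Bc tc by (simp add: m_assoc)
    hence "inv b' \<otimes> b = t [^] k' \<otimes> inv (t [^] k)"
      using that Bc tc by (metis int_pow_closed inv_closed inv_solve_right m_closed)
    also have "\<dots> = t [^] (k' - k)" using tc by (metis int_pow_mult int_pow_neg diff_conv_add_uminus)
    finally have eq: "inv b' \<otimes> b = t [^] (k' - k)" .
    have "inv b' \<otimes> b \<in> B" by (intro subgroupD(4,5)[OF B(1)] that)
    hence "k' - k = 0" unfolding eq by (rule inf)
    hence "k = k'" by simp
    moreover have "b = b'" using that tc Bc \<open>k = k'\<close> by (metis int_pow_closed r_cancel)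
    ultimately show ?thesis by blast
  qed
  define \<beta>\<kappa> where "\<beta>\<kappa> x = (SOME p. fst p \<in> B \<and> x = fst p \<otimes> t [^] (snd p :: int))" for x
  have "fst (\<beta>\<kappa> (b \<otimes> t [^] k)) = b \<and> snd (\<beta>\<kappa> (b \<otimes> t [^] k)) = k" if b: "b \<in> B" for b and k :: int
  proof -
    have "fst (\<beta>\<kappa> (b \<otimes> t [^] k)) \<in> B \<and> b \<otimes> t [^] k = fst (\<beta>\<kappa> (b \<otimes> t [^] k)) \<otimes> t [^] snd (\<beta>\<kappa> (b \<otimes> t [^] k))"
      unfolding \<beta>\<kappa>_def by (rule someI[of _ "(b, k)"]) (simp add: b)
    thus ?thesis using uniq[OF b] by metis
  qed
  thus ?thesis by (intro exI[of _ "fst \<circ> \<beta>\<kappa>"] exI[of _ "snd \<circ> \<beta>\<kappa>"]) simp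
qed

text \<open>Functions on \<open>B\<close> are extended by ignoring the exponent of \<open>t\<close>.
  Left translation by \<open>b t^k\<close> acts on the \<open>B\<close>-coordinate as conjugation by
  \<open>t^k\<close> followed by translation by \<open>b\<close>, and conjugation changes a function
  only in lower filtered degree. The exponent of \<open>t\<close> itself is one more function, a
  homomorphism.\<close>

lemma separating_cyclic_extension:
  assumes N: "subgroup N G" "lcs G N c = {\<one>}"
    and B: "subgroup B G" "B \<subseteq> N" and t: "t \<in> N" "normalizes G {t, inv t} B"
    and inf: "\<And>k::int. t [^] k \<in> B \<Longrightarrow> k = 0"
    and sep: "separating G B n F"
  shows "\<exists>n F. separating G (generate G (insert t B)) n F"
proof -
  have tc: "t \<in> carrier G" using t(1) subgroupD(3)[OF N(1)] by blast
  have Bc: "b \<in> carrier G" if "b \<in> B" for b using that subgroupD(3)[OF B(1)] by blast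
  define U where "U = generate G (insert t B)"
  have U: "subgroup U G" and Ueq: "U = {y \<otimes> t [^] k | y (k::int). y \<in> B}"
    and tpow: "\<And>y k. y \<in> B \<Longrightarrow> conjg G (t [^] (k::int)) y \<in> B"
    unfolding U_def by (rule cyclic_extension[OF B(1) tc t(2)])+
  have "\<exists>\<beta> \<kappa>. \<forall>b\<in>B. \<forall>k::int. \<beta> (b \<otimes> t [^] k) = b \<and> \<kappa> (b \<otimes> t [^] k) = k"
    by (rule cyclic_extension_coordinates[OF B(1) tc inf])
  then obtain \<beta> and \<kappa> :: "'a \<Rightarrow> int"
    where "\<forall>b\<in>B. \<forall>k. \<beta> (b \<otimes> t [^] k) = b \<and> \<kappa> (b \<otimes> t [^] k) = k" by blast
  hence dec: "\<beta> (b \<otimes> t [^] k) = b" "\<kappa> (b \<otimes> t [^] k) = k" if "b \<in> B" for b k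
    using that by auto
  have prod: "(b \<otimes> t [^] k) \<otimes> (b' \<otimes> t [^] l) = (b \<otimes> conjg G (t [^] k) b') \<otimes> t [^] (k + l)"
    if "b \<in> B" "b' \<in> B" for b b' and k l :: int
    using that Bc tc by (simp add: grp int_pow_mult)
  define L where "L = lcs G N"
  have BL: "B \<subseteq> L 0" using B(2) by (simp add: L_def)
  have Ltriv: "L j \<subseteq> {\<one>}" if "j \<ge> c" for j using lcs_antimono[OF N(1) that] N(2) by (simp add: L_def)
  have tkN: "t [^] (k::int) \<in> N" for k by (rule subgroupD(9)[OF N(1) t(1)])
  have L1: "commt G (t [^] (k::int)) u \<in> L (Suc j)" if "u \<in> L j" for k u j
    unfolding L_def using that by (intro commt_in_lcs tkN) (simp add: L_def)
  have L2: "conjg G (t [^] (k::int)) u \<in> L j" if "u \<in> L j" for k u j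
    using that normalizesD[OF lcs_normalized[OF N(1)] tkN] by (simp add: L_def)
  have conj: "wpolyf G L B n (\<lambda>y. f (conjg G (t [^] k) y))" if "wpolyf G L B n f" for n f and k :: int
    by (rule wpolyf_conj[OF B(1) BL _ tpow L1 L2 that]) (use tc in auto)
  have conj_diff: "wpolyf G L B n (\<lambda>y. f (conjg G (t [^] k) y) - f y)" if "wpolyf G L B (Suc n) f" for n f and k :: int
    by (rule wpolyf_conj_diff[OF B(1) BL _ tpow L1 L2 that]) (use tc in auto)
  have ext: "polyf G U n (f \<circ> \<beta>)" if "wpolyf G L B n f" for n f
    using that
  proof (induction n arbitrary: f)
    case 0
    thus ?case by (auto simp: Ueq dec)
  next
    case (Suc n)
    show ?case unfolding polyf.simps
    proof
      fix a assume "a \<in> U"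
      then obtain b k where a: "a = b \<otimes> t [^] (k::int)" "b \<in> B" unfolding Ueq by blast
      \<comment> \<open>The difference of the extended function splits into a translation part and a
        conjugation part, each of filtered degree less by one.\<close>
      define h where "h = (\<lambda>y. ldiff G b f (conjg G (t [^] k) y) + (f (conjg G (t [^] k) y) - f y))"
      have "wpolyf G L B (n - 0) (ldiff G b f)" by (rule wpolyf_SucD[OF Suc.prems]) (use a BL in auto)
      hence "wpolyf G L B n h" unfolding h_def
        by (intro wpolyf_add[OF B(1)] conj conj_diff Suc.prems) simp
      hence "polyf G U n (h \<circ> \<beta>)" by (rule Suc.IH)
      thus "polyf G U n (ldiff G a (f \<circ> \<beta>))"
      proof (rule polyf_cong[OF U, rotated])
        fix y assume "y \<in> U"
        then obtain b' l where y: "y = b' \<otimes> t [^] (l::int)" "b' \<in> B" unfolding Ueq by blast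
        have "b \<otimes> conjg G (t [^] k) b' \<in> B" by (intro subgroupD(5)[OF B(1)] a tpow y)
        thus "(h \<circ> \<beta>) y = ldiff G a (f \<circ> \<beta>) y"
          unfolding ldiff_def o_def a(1) y(1) prod[OF a(2) y(2)] by (simp add: dec y h_def ldiff_def)
      qed
    qed
  qed
  have \<kappa>: "polyf G U 2 \<kappa>"
  proof -
    have "ldiff G a (ldiff G a' \<kappa>) y = 0" if "a \<in> U" "a' \<in> U" "y \<in> U" for a a' y
    proof -
      have lin: "\<kappa> (a \<otimes> y) = \<kappa> a + \<kappa> y" if ay: "a \<in> U" "y \<in> U" for a y
      proof -
        obtain b k where a: "a = b \<otimes> t [^] (k::int)" "b \<in> B" using ay unfolding Ueq by blast
        obtain b' l where y: "y = b' \<otimes> t [^] (l::int)" "b' \<in> B" using ay unfolding Ueq by blast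
        have "b \<otimes> conjg G (t [^] k) b' \<in> B" by (intro subgroupD(5)[OF B(1)] a tpow y)
        thus ?thesis unfolding a(1) y(1) prod[OF a(2) y(2)] by (simp add: dec a y)
      qed
      show ?thesis using that by (simp add: ldiff_def lin subgroupD(5)[OF U])
    qed
    thus ?thesis by (simp add: numeral_2_eq_2)
  qed
  \<comment> \<open>\<open>n * Suc c\<close> bounds the degree of the extended functions, and 2 that
    of the homomorphism \<kappa>.\<close>
  define n' where "n' = n * Suc c + 2"
  define F' where "F' = insert \<kappa> ((\<lambda>f. f \<circ> \<beta>) ` F)"
  have one: "\<beta> \<one> = \<one>" "\<kappa> \<one> = 0"
    using dec[OF subgroupD(2)[OF B(1)], of 0] by simp_all
  have "separating G U n' F'" unfolding separating_def
  proof (intro conjI ballI impI)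
    show "finite F'" using sep by (simp add: F'_def separating_def)
    fix f assume "f \<in> F'"
    then consider "f = \<kappa>" | f0 where "f = f0 \<circ> \<beta>" "f0 \<in> F" by (auto simp: F'_def)
    thus "polyf G U n' f"
    proof cases
      case 1
      show ?thesis unfolding 1 by (rule polyf_mono[OF U _ \<kappa>]) (simp add: n'_def)
    next
      case (2 f0)
      have "polyf G B n f0" using 2 sep by (simp add: separating_def)
      hence "polyf G U (n * Suc c) (f0 \<circ> \<beta>)" by (intro ext wpolyf_if_polyf[OF B(1) Ltriv])
      thus ?thesis unfolding 2 by (rule polyf_mono[OF U, rotated]) (simp add: n'_def)
    qed
  next
    fix g assume "g \<in> U" and g1: "g \<noteq> \<one>"
    then obtain b k where g: "g = b \<otimes> t [^] (k::int)" "b \<in> B" unfolding Ueq by blast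
    show "\<exists>f\<in>F'. f g \<noteq> f \<one>"
    proof (cases "k = 0")
      case False
      hence "\<kappa> g \<noteq> \<kappa> \<one>" using g dec one by simp
      thus ?thesis by (auto simp: F'_def)
    next
      case True
      hence gb: "g = b" using g Bc by simp
      then obtain f where f: "f \<in> F" "f g \<noteq> f \<one>" using sep g g1 by (auto simp: separating_def)
      have "\<beta> g = g" using dec(1)[OF g(2), of k] g(1) gb by simp
      hence "(f \<circ> \<beta>) g \<noteq> (f \<circ> \<beta>) \<one>" using f one by simp
      thus ?thesis using f by (auto simp: F'_def)
    qed
  qed
  thus ?thesis unfolding U_def by blast
qed

text \<open>The subgroup of \<open>Y\<close> carrying the separating functions need not be
  normalized by \<open>t\<close>. A power subgroup of \<open>Y\<close> inside it is, and
  \<open>power_bounded\<close> makes its index finite. If a nonzero power of \<open>t\<close> lies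
  in \<open>Y\<close>, the index of \<open>Y\<close> is finite; otherwise the exponent of
  \<open>t\<close> is a coordinate.\<close>

lemma virt_separated_cyclic_extension:
  assumes N: "subgroup N G" "lcs G N c = {\<one>}"
    and Y: "subgroup Y G" "Y \<subseteq> N" and t: "t \<in> N" "normalizes G {t, inv t} Y"
    and pb: "power_bounded G Y {\<one>}" and vs: "virt_separated G Y"
  shows "virt_separated G (generate G (insert t Y))"
proof -
  have tc: "t \<in> carrier G" using t(1) subgroupD(3)[OF N(1)] by blast
  have Yc: "Y \<subseteq> carrier G" by (rule subgroupD(1)[OF Y(1)])
  define U where "U = generate G (insert t Y)"
  have U: "subgroup U G" and nUY: "normalizes G U Y" and Ueq: "U = {y \<otimes> t [^] k | y (k::int). y \<in> Y}"
    and tpow: "\<And>y k. y \<in> Y \<Longrightarrow> conjg G (t [^] (k::int)) y \<in> Y"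
    unfolding U_def by (rule cyclic_extension[OF Y(1) tc t(2)])+
  obtain B0 k0 n F where B0: "subgroup B0 G" "B0 \<subseteq> Y" "covered G Y B0 k0" "separating G B0 n F"
    using vs unfolding virt_separated_def by blast
  define m :: nat where "m = fact k0"
  have m: "m > 0" by (simp add: m_def)
  define B where "B = power_subgroup G Y m"
  have B: "subgroup B G" "B \<subseteq> Y" unfolding B_def using Y(1)
    by (intro power_subgroup_subgroup power_subgroup_subset; simp)+
  have tU: "t \<in> U" unfolding U_def by (rule generate.incl) simp
  have YU: "Y \<subseteq> U" unfolding U_def by (auto intro: generate.incl)
  have nUB: "normalizes G U B" unfolding B_def by (rule power_subgroup_normalized[OF Y(1) U nUY])
  have BB0: "B \<subseteq> B0" unfolding B_def m_def
    by (rule power_subgroup_least[OF B0(1) covered_power[OF B0(3,1) Y(1)]])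
  have sepB: "separating G B n F"
    using B0(4) BB0 polyf_subset[OF BB0] unfolding separating_def by blast
  obtain k1 where k1: "covered G Y B k1"
    using power_boundedD[OF pb Y(1)] m unfolding B_def by blast
  show ?thesis
  proof (cases "\<exists>k::int. k \<noteq> 0 \<and> t [^] k \<in> Y")
    case True
    then obtain k :: int where k: "k \<noteq> 0" "t [^] k \<in> Y" by blast
    define p where "p = nat \<bar>k\<bar>"
    have p: "p > 0" using k by (simp add: p_def)
    have tp: "t [^] (int p) \<in> Y"
    proof (cases "k > 0")
      case False
      hence "int p = - k" by (simp add: p_def)
      thus ?thesis using subgroupD(4)[OF Y(1) k(2)] tc by (simp add: int_pow_neg)
    qed (use k in \<open>simp add: p_def\<close>)
    have "covered G U Y p"
    proof (rule coveredI[of "(\<lambda>i. t [^] i) ` {..<p}"])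
      show "card ((\<lambda>i. t [^] i) ` {..<p}) \<le> p" using card_image_le[of "{..<p}" "\<lambda>i. t [^] i"] by simp
      show "(\<lambda>i. t [^] i) ` {..<p} \<subseteq> U" using subgroupD(8)[OF U tU] by auto
      fix x assume "x \<in> U"
      then obtain y l where x: "x = y \<otimes> t [^] (l::int)" "y \<in> Y" unfolding Ueq by blast
      define i where "i = nat (l mod int p)"
      have i: "i < p" using p by (simp add: i_def nat_less_iff)
      have l: "l = int i + int p * (l div int p)" using p by (simp add: i_def)
      have yc: "y \<in> carrier G" using x Yc by auto
      have tl: "t [^] l = t [^] i \<otimes> (t [^] int p) [^] (l div int p)"
        using tc by (subst l) (simp only: int_pow_mult int_pow_pow flip: int_pow_int)
      have "x = t [^] l \<otimes> conjg G (t [^] (- l)) y"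
        unfolding x(1) using yc tc by (simp add: grp int_pow_neg)
      also have "\<dots> = t [^] i \<otimes> ((t [^] int p) [^] (l div int p) \<otimes> conjg G (t [^] (- l)) y)"
        unfolding tl using yc tc by (simp add: m_assoc)
      finally have "x = t [^] i \<otimes> ((t [^] int p) [^] (l div int p) \<otimes> conjg G (t [^] (- l)) y)" .
      moreover have "(t [^] int p) [^] (l div int p) \<otimes> conjg G (t [^] (- l)) y \<in> Y"
        by (intro subgroupD(5)[OF Y(1)] subgroupD(9)[OF Y(1)] tp tpow x)
      ultimately show "\<exists>t\<in>(\<lambda>i. t [^] i) ` {..<p}. \<exists>b\<in>Y. x = t \<otimes> b" using i by blast
    qed simp
    hence "covered G U B (p * k1)"
      by (rule covered_trans[OF _ k1 subgroupD(1)[OF U] U YU subgroupD(1)[OF B(1)]])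
    thus ?thesis unfolding virt_separated_def U_def[symmetric] using B YU sepB by blast
  next
    case False
    define V where "V = generate G (insert t B)"
    have nB: "normalizes G {t, inv t} B"
      using nUB tU subgroupD(4)[OF U tU] by (auto simp: normalizes_def)
    have V: "subgroup V G" and Veq: "V = {y \<otimes> t [^] k | y (k::int). y \<in> B}"
      unfolding V_def by (rule cyclic_extension[OF B(1) tc nB])+
    have VU: "V \<subseteq> U" unfolding V_def U_def by (rule mono_generate) (use B in auto)
    have "\<exists>n F. separating G V n F" unfolding V_def
      by (rule separating_cyclic_extension[OF N B(1) _ t(1) nB _ sepB]) (use B Y False in auto)
    moreover have "covered G U V k1"
    proof -
      obtain T where T: "finite T" "T \<subseteq> Y" "card T \<le> k1" "\<forall>x\<in>Y. \<exists>t\<in>T. \<exists>b\<in>B. x = t \<otimes> b"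
        using k1 by (rule coveredE)
      show ?thesis
      proof (rule coveredI[OF T(1) _ T(3)])
        show "T \<subseteq> U" using T YU by blast
        fix x assume "x \<in> U"
        then obtain y l where x: "x = y \<otimes> t [^] (l::int)" "y \<in> Y" unfolding Ueq by blast
        obtain s b where sb: "s \<in> T" "b \<in> B" "y = s \<otimes> b" using T(4) x by blast
        have "s \<in> carrier G" "b \<in> carrier G" using sb T Yc subgroupD(1)[OF B(1)] by auto
        hence "x = s \<otimes> (b \<otimes> t [^] l)" unfolding x(1) sb(3) using tc by (simp add: m_assoc)
        moreover have "b \<otimes> t [^] l \<in> V" unfolding Veq using sb by blast
        ultimately show "\<exists>t\<in>T. \<exists>b\<in>V. x = t \<otimes> b" using sb by blast
      qed
    qed
    ultimately show ?thesis unfolding virt_separated_def U_def[symmetric] using V VU by blast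
  qed
qed

text \<open>Climbs the lower central series from its trivial end. Modulo the next term, each term is
  central and generated by finitely many iterated commutators, which are adjoined one by one.
  \<open>power_bounded\<close> is carried along because every cyclic extension needs it.\<close>

lemma virt_separated_nilpotent:
  assumes N: "subgroup N G" "lcs G N c = {\<one>}" and S: "finite S" "S \<subseteq> carrier G" "generate G S = N"
  shows "virt_separated G N"
proof -
  have main: "virt_separated G (lcs G N (c - i)) \<and> power_bounded G (lcs G N (c - i)) {\<one>}" if "i \<le> c" for i
    using that
  proof (induction i)
    case 0
    have "separating G {\<one>} 0 {}" by (simp add: separating_def)
    moreover have cov: "covered G {\<one>} {\<one>} 1" by (rule coveredI[of "{\<one>}"]) auto
    ultimately have "virt_separated G {\<one>}" unfolding virt_separated_def using triv_subgroup by blast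
    thus ?case using N(2) power_bounded_finite[OF cov] by simp
  next
    case (Suc i)
    define n where "n = c - Suc i"
    have n: "c - i = Suc n" using Suc.prems by (simp add: n_def)
    define Y where "Y = lcs G N (Suc n)"
    define W where "W = lcs G N n"
    have Y: "subgroup Y G" "Y \<subseteq> N" "normalizes G N Y" unfolding Y_def by (rule lcs_props[OF N(1)])+
    have W: "subgroup W G" "W \<subseteq> N" unfolding W_def by (rule lcs_props[OF N(1)])+
    have comm: "commt G x y \<in> Y" if "x \<in> N" "y \<in> W" for x y
      unfolding Y_def using that by (intro commt_in_lcs) (simp_all add: W_def)
    have YW: "Y \<subseteq> W" unfolding Y_def W_def by (rule lcs_Suc_subset[OF N(1)])
    have Nc: "N \<subseteq> carrier G" by (rule subgroupD(1)[OF N(1)])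
    have step: "virt_separated G (generate G (T \<union> Y)) \<and> power_bounded G (generate G (T \<union> Y)) {\<one>}"
      if "finite T" "T \<subseteq> W" for T
      using that
    proof (induction T rule: finite_induct)
      case empty
      have "generate G Y = Y" using generate_least[OF Y(1) order_refl] generate_subset by blast
      thus ?case using Suc.IH Suc.prems by (simp add: Y_def n)
    next
      case (insert t T)
      define V where "V = generate G (T \<union> Y)"
      have TY: "T \<union> Y \<subseteq> W" using insert.prems YW by auto
      have V: "subgroup V G" unfolding V_def using TY W Nc by (intro generate_subgroup) auto
      have VW: "V \<subseteq> W" unfolding V_def by (rule generate_least[OF W(1) TY])
      have YV: "Y \<subseteq> V" unfolding V_def by (auto intro: generate.incl)
      have t: "t \<in> W" "t \<in> N" "t \<in> carrier G" using insert.prems W Nc by auto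
      have nV: "conjg G u v \<in> V" if "u \<in> N" "v \<in> V" for u v
      proof -
        have "conjg G u v = commt G u v \<otimes> v" using that VW W Nc by (intro conjg_eq) auto
        moreover have "commt G u v \<in> V" using comm[of u v] that VW YV by blast
        ultimately show ?thesis using subgroupD(5)[OF V] that by simp
      qed
      have nt: "normalizes G {t, inv t} V" using nV t subgroupD(4)[OF N(1)] by (auto simp: normalizes_def)
      have gen: "generate G (insert t T \<union> Y) = generate G (insert t V)"
        unfolding V_def using TY t W Nc by (intro generate_insert_Un) auto
      have IH: "virt_separated G V" "power_bounded G V {\<one>}"
        using insert.IH insert.prems unfolding V_def by auto
      define U where "U = generate G (insert t V)"
      have U: "subgroup U G" and nU: "normalizes G U V"
        unfolding U_def by (rule cyclic_extension[OF V t(3) nt])+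
      have UW: "U \<subseteq> W" unfolding U_def by (rule generate_least[OF W(1)]) (use t VW in auto)
      have VU: "V \<subseteq> U" unfolding U_def by (auto intro: generate.incl)
      have tU: "t \<in> U" unfolding U_def by (rule generate.incl) simp
      have "power_bounded G U V"
      proof (rule power_bounded_abelian[OF V U VU, of 1])
        fix x y assume "x \<in> U" "y \<in> U"
        thus "commt G x y \<in> V" using comm[of x y] UW W YV by blast
      next
        fix F assume "finite F" "F \<subseteq> U"
        thus "\<exists>T\<subseteq>U. finite T \<and> card T \<le> 1 \<and> F \<subseteq> generate G (T \<union> V)"
          using tU by (intro exI[of _ "{t}"]) (auto simp: U_def)
      qed
      hence "power_bounded G U {\<one>}"
        using power_bounded_trans[OF V U VU nU _ _ IH(2)] subgroupD(2)[OF V] by simp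
      moreover have "virt_separated G U" unfolding U_def
        by (rule virt_separated_cyclic_extension[OF N V _ t(2) nt IH(2,1)]) (use VW W in auto)
      ultimately show ?case unfolding gen U_def by blast
    qed
    have SN: "S \<subseteq> N" using S(3) generate_subset by auto
    define T where "T = left_comms G S n"
    have T: "finite T" "T \<subseteq> W" unfolding T_def W_def
      by (intro finite_left_comms S(1) left_comms_subset SN)+
    have "W = generate G (T \<union> Y)"
    proof
      show "generate G (T \<union> Y) \<subseteq> W" by (rule generate_least[OF W(1)]) (use T YW in auto)
      have sg: "subgroup (generate G (T \<union> Y)) G" using T YW W Nc by (intro generate_subgroup) auto
      \<comment> \<open>Conjugation is trivial modulo \<open>Y\<close>, so the normal closure of
        \<open>T\<close> lies in the subgroup generated by \<open>T\<close> and
        \<open>Y\<close>.\<close>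
      have "{conjg G h y | h y. h \<in> N \<and> y \<in> T} \<subseteq> generate G (T \<union> Y)"
      proof clarify
        fix h y assume hy: "h \<in> N" "y \<in> T"
        have "conjg G h y = commt G h y \<otimes> y" using hy T W Nc by (intro conjg_eq) auto
        moreover have "commt G h y \<in> generate G (T \<union> Y)" using comm[of h y] hy T by (intro generate.incl) auto
        moreover have "y \<in> generate G (T \<union> Y)" using hy by (intro generate.incl) auto
        ultimately show "conjg G h y \<in> generate G (T \<union> Y)" using subgroupD(5)[OF sg] by simp
      qed
      hence "nclosure G N T \<subseteq> generate G (T \<union> Y)" unfolding nclosure_def by (rule generate_least[OF sg])
      thus "W \<subseteq> generate G (T \<union> Y)" unfolding W_def T_def lcs_eq_nclosure[OF N(1) S(3,2)] .
    qed
    thus ?case using step[OF T] by (simp add: W_def n_def)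
  qed
  show ?thesis using main[of c] by simp
qed

text \<open>\<open>C\<close> and \<open>D\<close> come from the growth of the finitely many
  separating functions, measured in Schreier generators of the same word length. The multiplier
  \<open>e\<close> absorbs both the passage from \<open>G\<close> to the separated subgroup and the
  factor \<open>n!\<close> of the period.\<close>

theorem virtually_nilpotent_detection:
  assumes H: "subgroup H G" "covered G (carrier G) H k" "lcs G H c = {\<one>}"
    and S: "finite S" "S \<subseteq> carrier G" "generate G S = carrier G"
  shows "\<exists>e>0. \<exists>C D. \<forall>n g l. g \<in> sphere G (S \<union> (\<lambda>s. inv s) ` S) n \<longrightarrow> g \<noteq> \<one> \<longrightarrow> C * (n + 1) ^ D < 4 ^ l \<longrightarrow>
      (\<exists>q\<in>{1..2 * l + 1}. g \<notin> power_subgroup G (carrier G) (e * q))"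
proof -
  define S1 where "S1 = S \<union> (\<lambda>s. inv s) ` S"
  have S1: "finite S1" "S1 \<subseteq> carrier G" using S by (auto simp: S1_def)
  have Hc: "H \<subseteq> carrier G" by (rule subgroupD(1)[OF H(1)])
  obtain S2 where S2: "finite S2" "S2 \<subseteq> H" "generate G S2 = H"
    using schreier_generate[OF H(2,1) S] by blast
  have "virt_separated G H" using S2 Hc by (intro virt_separated_nilpotent[OF H(1,3)]) auto
  then obtain B k' n F where B: "subgroup B G" "B \<subseteq> H" "covered G H B k'" "separating G B n F"
    unfolding virt_separated_def by blast
  have covB: "covered G (carrier G) B (k * k')"
    by (rule covered_trans[OF H(2) B(3) order_refl subgroup_self Hc subgroupD(1)[OF B(1)]])
  obtain S3 where S3: "finite S3" "S3 \<subseteq> B" "\<forall>n g. g \<in> sphere G S1 n \<longrightarrow> g \<in> B \<longrightarrow> g \<in> sphere G S3 n"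
    using schreier[OF covB B(1) S1] by blast
  have F: "finite F" "\<And>f. f \<in> F \<Longrightarrow> polyf G B n f" using B(4) by (auto simp: separating_def)
  have "\<forall>f\<in>F. \<exists>C::nat. \<forall>k. \<forall>g\<in>sphere G S3 k. \<bar>f g\<bar> \<le> int (C * (k + 1) ^ n)"
    using polyf_growth[OF B(1) S3(1,2)] F(2) by blast
  then obtain C :: "('a \<Rightarrow> int) \<Rightarrow> nat" where C: "\<And>f k g. f \<in> F \<Longrightarrow> g \<in> sphere G S3 k \<Longrightarrow> \<bar>f g\<bar> \<le> int (C f * (k + 1) ^ n)"
    by metis
  define C' where "C' = (\<Sum>f\<in>F. 2 * C f) + 1"
  have C': "2 * C f \<le> C'" if "f \<in> F" for f
    using member_le_sum[of f F "\<lambda>f. 2 * C f"] that F(1) by (simp add: C'_def)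
  define e where "e = fact (k * k') * (fact n :: nat)"
  have e: "e > 0" by (simp add: e_def)
  have sub: "power_subgroup G (carrier G) (e * q) \<subseteq> power_subgroup G B (q * fact n)" for q
  proof (rule power_subgroup_least[OF power_subgroup_subgroup[OF B(1)]])
    fix x assume x: "x \<in> carrier G"
    have xB: "x [^] (fact (k * k') :: nat) \<in> B" by (rule covered_power[OF covB B(1) subgroup_self x])
    have "x [^] (e * q) = (x [^] (fact (k * k') :: nat)) [^] (q * fact n)"
      using x by (simp add: nat_pow_pow e_def mult_ac)
    thus "x [^] (e * q) \<in> power_subgroup G B (q * fact n)" using power_subgroup_incl[OF B(1) xB] by simp
  qed
  have "\<exists>q\<in>{1..2 * l + 1}. g \<notin> power_subgroup G (carrier G) (e * q)"
    if g: "g \<in> sphere G S1 m" "g \<noteq> \<one>" and l: "C' * (m + 1) ^ n < 4 ^ l" for m g l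
  proof (cases "g \<in> B")
    case False
    \<comment> \<open>Every \<open>e\<close>-th power lies in \<open>B\<close>, so outside
      \<open>B\<close> already \<open>q = 1\<close> detects \<open>g\<close>.\<close>
    hence "g \<notin> power_subgroup G (carrier G) (e * 1)"
      using sub[of 1] power_subgroup_subset[OF B(1)] by blast
    thus ?thesis by (intro bexI[of _ 1]) auto
  next
    case True
    then obtain f where f: "f \<in> F" "f g \<noteq> f \<one>" using B(4) g by (auto simp: separating_def)
    have "\<bar>f g\<bar> \<le> int (C f * (m + 1) ^ n)" using C[OF f(1)] S3(3) g True by blast
    moreover have "\<bar>f \<one>\<bar> \<le> int (C f * (0 + 1) ^ n)" by (rule C[OF f(1)]) simp
    moreover have "int (C f * (0 + 1) ^ n) \<le> int (C f * (m + 1) ^ n)"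
      unfolding of_nat_le_iff by (intro mult_left_mono power_mono) auto
    ultimately have "\<bar>f g - f \<one>\<bar> \<le> int (2 * C f * (m + 1) ^ n)" by simp
    also have "\<dots> \<le> int (C' * (m + 1) ^ n)" unfolding of_nat_le_iff
      using C'[OF f(1)] by (intro mult_right_mono) auto
    also have "\<dots> < int (4 ^ l)" using l by (simp only: of_nat_less_iff)
    finally have "\<bar>f g - f \<one>\<bar> < 4 ^ l" by simp
    then obtain q where q: "q \<in> {1..2 * l + 1}" "\<not> int q dvd f g - f \<one>"
      using exists_small_nondivisor[of "f g - f \<one>" l] f(2) by auto
    have "g \<notin> power_subgroup G B (q * fact n)" using polyf_power_subgroup[OF B(1) F(2)[OF f(1)]] q(2) by blast
    thus ?thesis using q(1) sub[of q] by blast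
  qed
  thus ?thesis using e unfolding S1_def by blast
qed

end

section \<open>Integer polynomials acting on abelian normal subgroups\<close>

text \<open>The module structure over \<open>Z[x]\<close> in which \<open>x\<close> acts as
  conjugation by \<open>t\<close>, written multiplicatively and evaluated by Horner's
  scheme.\<close>

definition poly_act :: "('a, 'b) monoid_scheme \<Rightarrow> 'a \<Rightarrow> int poly \<Rightarrow> 'a \<Rightarrow> 'a" where
  "poly_act G t F v = fold_coeffs (\<lambda>c w. v [^]\<^bsub>G\<^esub> c \<otimes>\<^bsub>G\<^esub> conjg G t w) F \<one>\<^bsub>G\<^esub>"

text \<open>The ascending series of elements of \<open>D\<close> that repeated commutation with
  \<open>E\<close> makes trivial. For \<open>E = D = K\<close> it is the upper central series of
  \<open>K\<close>.\<close>

primrec hyper :: "('a, 'b) monoid_scheme \<Rightarrow> 'a set \<Rightarrow> 'a set \<Rightarrow> nat \<Rightarrow> 'a set" where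
  "hyper G E D 0 = {\<one>\<^bsub>G\<^esub>}"
| "hyper G E D (Suc k) = {w \<in> D. \<forall>e\<in>E. commt G e w \<in> hyper G E D k}"

text \<open>Both letters contain exactly one \<open>u\<close>, so two words of equal length carry
  the same power of \<open>u\<close> and are compared through \<open>a\<close> alone.\<close>

fun bword :: "('a, 'b) monoid_scheme \<Rightarrow> 'a \<Rightarrow> 'a \<Rightarrow> bool list \<Rightarrow> 'a" where
  "bword G a u [] = \<one>\<^bsub>G\<^esub>"
| "bword G a u (c # cs) = (if c then a \<otimes>\<^bsub>G\<^esub> u else u) \<otimes>\<^bsub>G\<^esub> bword G a u cs"

lemma monom_minus_one_dvd:
  assumes "m dvd n"
  shows "Polynomial.monom (1::int) m - 1 dvd Polynomial.monom 1 n - 1"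
proof -
  obtain k where k: "n = m * k" using assms by blast
  have "Polynomial.monom (1::int) n = Polynomial.monom 1 m ^ k"
    by (simp add: k Polynomial.monom_power)
  thus ?thesis using power_diff_1_eq[of "Polynomial.monom (1::int) m" k] by simp
qed

context group
begin

lemma conjg_int_pow: "x \<in> carrier G \<Longrightarrow> y \<in> carrier G \<Longrightarrow> conjg G x (y [^] (k::int)) = conjg G x y [^] k"
  by (cases k rule: int_cases2) (simp_all add: int_pow_int int_pow_neg conjg_pow conjg_inv)

end

section \<open>Abelian subgroups as modules over the integer polynomials\<close>

locale abelian_action = group +
  fixes D :: "'a set"
  assumes D: "subgroup D G" and ab: "x \<in> D \<Longrightarrow> y \<in> D \<Longrightarrow> x \<otimes> y = y \<otimes> x"
begin

lemma Dc: "x \<in> D \<Longrightarrow> x \<in> carrier G"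
  using subgroupD(3)[OF D] .

definition stab :: "'a \<Rightarrow> bool" where
  "stab t \<longleftrightarrow> t \<in> carrier G \<and> (\<forall>v\<in>D. conjg G t v \<in> D)"

lemma stabD: "stab t \<Longrightarrow> t \<in> carrier G" "stab t \<Longrightarrow> v \<in> D \<Longrightarrow> conjg G t v \<in> D"
  by (auto simp: stab_def)

lemma int_pow_D: "v \<in> D \<Longrightarrow> v [^] (k::int) \<in> D"
  using subgroupD(9)[OF D] .

lemma mult4: "a \<in> D \<Longrightarrow> b \<in> D \<Longrightarrow> c \<in> D \<Longrightarrow> d \<in> D \<Longrightarrow> (a \<otimes> b) \<otimes> (c \<otimes> d) = (a \<otimes> c) \<otimes> (b \<otimes> d)"
proof -
  assume *: "a \<in> D" "b \<in> D" "c \<in> D" "d \<in> D"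
  have "(a \<otimes> b) \<otimes> (c \<otimes> d) = a \<otimes> ((b \<otimes> c) \<otimes> d)" using * Dc by (simp add: m_assoc)
  also have "b \<otimes> c = c \<otimes> b" using * ab by blast
  also have "a \<otimes> ((c \<otimes> b) \<otimes> d) = (a \<otimes> c) \<otimes> (b \<otimes> d)" using * Dc by (simp add: m_assoc)
  finally show ?thesis .
qed

lemma int_pow_distrib: "x \<in> D \<Longrightarrow> y \<in> D \<Longrightarrow> (x \<otimes> y) [^] (k::int) = x [^] k \<otimes> y [^] k"
  by (intro int_pow_mult_distrib ab Dc)

lemma poly_act_0 [simp]: "poly_act G t 0 v = \<one>"
  by (simp add: poly_act_def)

lemma poly_act_pCons: "stab t \<Longrightarrow> v \<in> D \<Longrightarrow> poly_act G t (pCons c F) v = v [^] c \<otimes> conjg G t (poly_act G t F v)"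
  by (cases "c = 0 \<and> F = 0") (auto simp: poly_act_def stabD)

lemma poly_act_1: "stab t \<Longrightarrow> v \<in> D \<Longrightarrow> poly_act G t 1 v = v"
  by (simp add: one_pCons poly_act_pCons stabD Dc)

lemma poly_act_closed: "stab t \<Longrightarrow> v \<in> D \<Longrightarrow> poly_act G t F v \<in> D"
  by (induction F) (auto simp: poly_act_pCons subgroupD[OF D] stabD(2) int_pow_D)

lemma poly_act_add:
  assumes t: "stab t" and v: "v \<in> D"
  shows "poly_act G t (F + F') v = poly_act G t F v \<otimes> poly_act G t F' v"
proof (induction F F' rule: poly_induct2)
  case (pCons a p b q)
  have c: "poly_act G t p v \<in> D" "poly_act G t q v \<in> D" by (intro poly_act_closed t v)+
  have "poly_act G t (pCons a p + pCons b q) v = (v [^] a \<otimes> v [^] b) \<otimes> (conjg G t (poly_act G t p v) \<otimes> conjg G t (poly_act G t q v))"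
    using c v t by (simp add: poly_act_pCons pCons.IH int_pow_mult Dc conjg_mult stabD)
  also have "\<dots> = (v [^] a \<otimes> conjg G t (poly_act G t p v)) \<otimes> (v [^] b \<otimes> conjg G t (poly_act G t q v))"
    by (intro mult4 int_pow_D v stabD(2)[OF t] c)
  finally show ?case by (simp add: poly_act_pCons t v)
qed simp

lemma poly_act_smult:
  assumes t: "stab t" and v: "v \<in> D"
  shows "poly_act G t (Polynomial.smult c F) v = poly_act G t F v [^] c"
proof (induction F)
  case (pCons a p)
  have c: "poly_act G t p v \<in> D" by (intro poly_act_closed t v)
  have "poly_act G t (Polynomial.smult c (pCons a p)) v = (v [^] a) [^] c \<otimes> conjg G t (poly_act G t p v) [^] c"
    using c v t by (simp add: poly_act_pCons pCons.IH int_pow_pow Dc conjg_int_pow stabD mult.commute)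
  also have "\<dots> = (v [^] a \<otimes> conjg G t (poly_act G t p v)) [^] c"
    by (rule int_pow_distrib[symmetric]) (intro int_pow_D v stabD(2)[OF t] c)+
  finally show ?case by (simp add: poly_act_pCons t v)
qed simp

lemma poly_act_uminus: "stab t \<Longrightarrow> v \<in> D \<Longrightarrow> poly_act G t (- F) v = inv (poly_act G t F v)"
  using poly_act_smult[of t v "-1" F] by (simp add: int_pow_neg Dc poly_act_closed)

lemma poly_act_diff: "stab t \<Longrightarrow> v \<in> D \<Longrightarrow> poly_act G t (F - F') v = poly_act G t F v \<otimes> inv (poly_act G t F' v)"
  using poly_act_add[of t v F "- F'"] by (simp add: poly_act_uminus)

lemma poly_act_hom:
  assumes t: "stab t" and v: "v \<in> D" "w \<in> D"
  shows "poly_act G t F (v \<otimes> w) = poly_act G t F v \<otimes> poly_act G t F w"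
proof (induction F)
  case (pCons a p)
  have vw: "v \<otimes> w \<in> D" using v subgroupD(5)[OF D] by blast
  have c: "poly_act G t p v \<in> D" "poly_act G t p w \<in> D" by (intro poly_act_closed t v)+
  have "poly_act G t (pCons a p) (v \<otimes> w) = (v [^] a \<otimes> w [^] a) \<otimes> (conjg G t (poly_act G t p v) \<otimes> conjg G t (poly_act G t p w))"
    using c v t vw by (simp add: poly_act_pCons pCons.IH int_pow_distrib Dc conjg_mult stabD)
  also have "\<dots> = (v [^] a \<otimes> conjg G t (poly_act G t p v)) \<otimes> (w [^] a \<otimes> conjg G t (poly_act G t p w))"
    by (intro mult4 int_pow_D v stabD(2)[OF t] c)
  finally show ?case by (simp add: poly_act_pCons t v)
qed simp

lemma poly_act_one [simp]: "stab t \<Longrightarrow> poly_act G t F \<one> = \<one>"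
  by (induction F) (auto simp: poly_act_pCons subgroupD(2)[OF D] stabD)

lemma poly_act_inv: "stab t \<Longrightarrow> v \<in> D \<Longrightarrow> poly_act G t F (inv v) = inv (poly_act G t F v)"
proof -
  assume t: "stab t" and v: "v \<in> D"
  have iv: "inv v \<in> D" using v subgroupD(4)[OF D] by blast
  have "poly_act G t F (inv v) \<otimes> poly_act G t F v = \<one>"
    using poly_act_hom[OF t iv v, of F] t v by (simp add: Dc)
  thus ?thesis using poly_act_closed[OF t v, of F] poly_act_closed[OF t iv, of F] by (intro inv_equality[symmetric]) (auto intro: Dc)
qed

lemma poly_act_conj:
  assumes t: "stab t" and h: "stab h" and v: "v \<in> D"
    and com: "\<And>w. w \<in> D \<Longrightarrow> conjg G h (conjg G t w) = conjg G t (conjg G h w)"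
  shows "poly_act G t F (conjg G h v) = conjg G h (poly_act G t F v)"
proof (induction F)
  case (pCons a p)
  have c: "poly_act G t p v \<in> D" by (intro poly_act_closed t v)
  show ?case using c v t h
    by (simp add: poly_act_pCons pCons.IH stabD conjg_mult conjg_int_pow com Dc int_pow_D)
qed (use h in \<open>simp add: stabD\<close>)

lemma poly_act_mult:
  assumes t: "stab t" and v: "v \<in> D"
  shows "poly_act G t (F * F') v = poly_act G t F (poly_act G t F' v)"
proof (induction F)
  case (pCons a p)
  have c: "poly_act G t F' v \<in> D" by (intro poly_act_closed t v)
  have "poly_act G t (pCons a p * F') v = poly_act G t (Polynomial.smult a F' + pCons 0 (p * F')) v"
    by simp
  also have "\<dots> = poly_act G t F' v [^] a \<otimes> (v [^] (0::int) \<otimes> conjg G t (poly_act G t (p * F') v))"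
    by (simp only: poly_act_add[OF t v] poly_act_smult[OF t v] poly_act_pCons[OF t v])
  also have "\<dots> = poly_act G t (pCons a p) (poly_act G t F' v)"
    using c t v by (simp add: poly_act_pCons pCons.IH Dc poly_act_closed stabD)
  finally show ?case .
qed simp

lemma stab_pow: "stab t \<Longrightarrow> stab (t [^] (k::nat))"
proof (induction k)
  case (Suc k)
  have "conjg G (t [^] k \<otimes> t) v \<in> D" if "v \<in> D" for v
    using Suc that by (simp add: conjg_mult_left stabD Dc)
  thus ?case using Suc by (simp add: stab_def)
qed (use Dc in \<open>auto simp: stab_def\<close>)

lemma poly_act_monom: "stab t \<Longrightarrow> v \<in> D \<Longrightarrow> poly_act G t (Polynomial.monom 1 k) v = conjg G (t [^] (k::nat)) v"
proof (induction k)
  case 0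
  thus ?case by (simp add: Polynomial.monom_0 poly_act_pCons stabD Dc)
next
  case (Suc k)
  have "poly_act G t (Polynomial.monom 1 (Suc k)) v = conjg G t (conjg G (t [^] k) v)"
    using Suc by (simp add: Polynomial.monom_Suc poly_act_pCons Dc stabD stab_pow)
  also have "\<dots> = conjg G (t \<otimes> t [^] k) v" using Suc.prems by (simp add: conjg_mult_left Dc stabD)
  finally show ?case unfolding nat_pow_Suc2[OF stabD(1)[OF Suc.prems(1)]] .
qed

text \<open>Turns relations for powers of \<open>t\<close> into members of the annihilator ideal for
  \<open>t\<close> itself.\<close>

lemma poly_act_pcompose_monom:
  assumes t: "stab t" and v: "v \<in> D"
  shows "poly_act G t (F \<circ>\<^sub>p Polynomial.monom 1 k) v = poly_act G (t [^] k) F v"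
proof (induction F)
  case (pCons a p)
  have c: "poly_act G t (p \<circ>\<^sub>p Polynomial.monom 1 k) v \<in> D" by (intro poly_act_closed t v)
  have "poly_act G t [:a:] v = v [^] a" using t v by (simp add: poly_act_pCons stabD Dc)
  thus ?case using t v c
    by (simp add: pcompose_pCons poly_act_add poly_act_mult poly_act_monom poly_act_pCons stab_pow pCons.IH)
qed simp

lemma poly_act_monom_minus_one: "stab t \<Longrightarrow> w \<in> D \<Longrightarrow> poly_act G t (Polynomial.monom 1 N - 1) w = commt G (t [^] (N::nat)) w"
proof -
  assume t: "stab t" and w: "w \<in> D"
  show ?thesis using t w by (simp add: poly_act_1 poly_act_diff poly_act_monom commt_eq Dc stabD)
qed

lemma poly_act_power_monom: "stab t \<Longrightarrow> w \<in> D \<Longrightarrow>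
   poly_act G t ((Polynomial.monom 1 N - 1) ^ d) w = ((\<lambda>w. commt G (t [^] (N::nat)) w) ^^ d) w"
proof (induction d arbitrary: w)
  case 0
  thus ?case by (simp add: poly_act_1)
next
  case (Suc d)
  have "commt G (t [^] N) w \<in> D"
    using poly_act_closed[OF Suc.prems, of "Polynomial.monom 1 N - 1"] by (simp add: poly_act_monom_minus_one Suc.prems)
  hence "poly_act G t ((Polynomial.monom 1 N - 1) ^ Suc d) w = ((\<lambda>w. commt G (t [^] N) w) ^^ d) (commt G (t [^] N) w)"
    using Suc by (simp only: power_Suc2 poly_act_mult poly_act_monom_minus_one)
  thus ?case by (simp only: funpow_Suc_right o_apply)
qed

text \<open>The annihilator of \<open>v\<close> satisfies the closure conditions of
  \<open>quasi_unipotent_poly_ideal\<close>: torsion-freeness allows cancelling integers, and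
  injectivity of conjugation allows cancelling \<open>x\<close>.\<close>

lemma quasi_unipotent:
  assumes t: "stab t" and v: "v \<in> D"
    and tf: "\<And>w (n::int). w \<in> D \<Longrightarrow> n \<noteq> 0 \<Longrightarrow> w [^] n = \<one> \<Longrightarrow> w = \<one>"
    and small: "\<And>k::nat. k > 0 \<Longrightarrow> \<exists>F. small_poly F \<and> poly_act G (t [^] k) F v = \<one>"
  shows "\<exists>N>0. \<exists>d. poly_act G t ((Polynomial.monom 1 N - 1) ^ d) v = \<one>"
proof (rule quasi_unipotent_poly_ideal)
  fix p q assume "poly_act G t p v = \<one>"
  thus "poly_act G t (p * q) v = \<one>"
    by (subst mult.commute) (simp add: poly_act_mult t v)
next
  fix p q assume "poly_act G t p v = \<one>" "poly_act G t q v = \<one>"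
  thus "poly_act G t (p - q) v = \<one>" by (simp add: poly_act_diff t v)
next
  fix c :: int and p assume "c \<noteq> 0" "poly_act G t (Polynomial.smult c p) v = \<one>"
  thus "poly_act G t p v = \<one>" using tf[OF poly_act_closed[OF t v]] by (simp add: poly_act_smult t v)
next
  fix p assume "poly_act G t (pCons 0 p) v = \<one>"
  hence 1: "conjg G t (poly_act G t p v) = \<one>" using poly_act_closed[OF t v, of p] by (simp add: poly_act_pCons t v Dc stabD)
  have "poly_act G t p v = conjg G (inv t) (conjg G t (poly_act G t p v))"
    using poly_act_closed[OF t v, of p] t by (simp add: Dc stabD)
  also have "\<dots> = \<one>" unfolding 1 using t by (simp add: stabD)
  finally show "poly_act G t p v = \<one>" .
next
  fix k :: nat assume "k > 0"
  thus "\<exists>F. small_poly F \<and> poly_act G t (F \<circ>\<^sub>p Polynomial.monom 1 k) v = \<one>"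
    using small by (simp add: poly_act_pcompose_monom t v)
qed

text \<open>Pushing every \<open>u\<close> to the right conjugates the copy of \<open>a\<close> at
  position \<open>i\<close> by \<open>u^i\<close>, which is the action of
  \<open>x^i\<close>.\<close>

lemma bword_eq:
  assumes u: "stab u" and a: "a \<in> D"
  shows "bword G a u cs = poly_act G u (Poly (map of_bool cs)) a \<otimes> u [^] length cs"
proof (induction cs)
  case (Cons c cs)
  define w where "w = poly_act G u (Poly (map of_bool cs)) a"
  have w: "w \<in> D" unfolding w_def by (intro poly_act_closed u a)
  have cc: "w \<in> carrier G" "a \<in> carrier G" "u \<in> carrier G" using w a u by (auto simp: Dc stabD)
  have "bword G a u (c # cs) = (a [^] (of_bool c :: int) \<otimes> conjg G u w) \<otimes> (u \<otimes> u [^] length cs)"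
    using cc by (simp add: Cons w_def[symmetric] grp)
  also have "\<dots> = poly_act G u (Poly (map of_bool (c # cs))) a \<otimes> u [^] length (c # cs)"
    using cc by (simp only: list.map Poly.simps poly_act_pCons[OF u a] w_def[symmetric] list.size(4) add_0_right One_nat_def add_Suc_right nat_pow_Suc2)
  finally show ?case .
qed simp

lemma small_poly_diff_bool:
  assumes "length cs = length cs'" "cs \<noteq> cs'"
  shows "small_poly (Poly (map of_bool cs') - Poly (map of_bool cs))"
proof -
  have cf: "Polynomial.coeff (Poly (map of_bool ds)) i \<in> {0, 1::int}" for ds :: "bool list" and i
    by (auto simp: coeff_Poly_eq nth_default_def)
  have cf2: "Polynomial.coeff (Poly (map of_bool cs') - Poly (map of_bool cs)) i \<in> {- 1, 0, 1::int}" for i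
    using cf[of cs i] cf[of cs' i] by auto
  obtain i where i: "i < length cs" "cs ! i \<noteq> cs' ! i" using assms by (auto simp: list_eq_iff_nth_eq)
  have "Polynomial.coeff (Poly (map of_bool cs') - Poly (map of_bool cs)) i \<noteq> (0::int)"
    using i assms(1) by (auto simp: coeff_Poly_eq nth_default_def)
  hence "Poly (map of_bool cs') - Poly (map of_bool cs) \<noteq> (0 :: int poly)" by (metis Polynomial.coeff_0)
  thus ?thesis using cf2 by (auto simp: small_poly_def)
qed

text \<open>The powers of \<open>u\<close> cancel up to a conjugation, so two distinct words of
  equal length can agree in the group only if a small polynomial annihilates
  \<open>a\<close>.\<close>

lemma inv_bword_mult_bword:
  assumes u: "stab u" and a: "a \<in> D" and l: "length cs = length cs'"
  shows "inv (bword G a u cs) \<otimes> bword G a u cs' =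
     conjg G (inv (u [^] length cs)) (poly_act G u (Poly (map of_bool cs') - Poly (map of_bool cs)) a)"
proof -
  define w where "w = poly_act G u (Poly (map of_bool cs)) a"
  define w' where "w' = poly_act G u (Poly (map of_bool cs')) a"
  have w: "w \<in> D" "w' \<in> D" unfolding w_def w'_def by (intro poly_act_closed u a)+
  have cc: "w \<in> carrier G" "w' \<in> carrier G" "u \<in> carrier G" using w u by (auto simp: Dc stabD)
  have "w' \<otimes> inv w = inv w \<otimes> w'" using w subgroupD(4)[OF D] by (intro ab) auto
  thus ?thesis using cc
    unfolding bword_eq[OF u a] poly_act_diff[OF u a] l w_def[symmetric] w'_def[symmetric]
    by (simp add: inv_mult_group conjg_def m_assoc)
qed

end


section \<open>Commuting actions on an abelian subgroup\<close>

text \<open>Commutators of \<open>H\<close> centralize \<open>D\<close>, so \<open>H\<close> acts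
  through an abelian quotient. Kernels of the operators given by one element are therefore invariant
  under all of \<open>H\<close>.\<close>

locale commuting_action = abelian_action +
  fixes H :: "'a set"
  assumes H: "subgroup H G" and HD: "normalizes G H D"
    and comm: "x \<in> H \<Longrightarrow> y \<in> H \<Longrightarrow> w \<in> D \<Longrightarrow> commt G x y \<otimes> w = w \<otimes> commt G x y"
begin

lemma Hc: "x \<in> H \<Longrightarrow> x \<in> carrier G"
  using subgroupD(3)[OF H] .

lemma stabH: "x \<in> H \<Longrightarrow> stab x"
  using HD by (auto simp: stab_def normalizes_def Hc)

lemma conj_commute:
  assumes "x \<in> H" "y \<in> H" "w \<in> D"
  shows "conjg G x (conjg G y w) = conjg G y (conjg G x w)"
proof -
  have c: "x \<in> carrier G" "y \<in> carrier G" "w \<in> carrier G" using assms by (auto simp: Hc Dc)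
  define v where "v = conjg G y (conjg G x w)"
  have v: "v \<in> D" unfolding v_def using assms by (intro stabD(2)[OF stabH])
  have "conjg G x (conjg G y w) = conjg G (commt G x y) v"
    unfolding v_def using c by (simp add: grp)
  also have "\<dots> = (commt G x y \<otimes> v) \<otimes> inv (commt G x y)" by (simp only: conjg_def)
  also have "commt G x y \<otimes> v = v \<otimes> commt G x y" by (rule comm[OF assms(1,2) v])
  also have "(v \<otimes> commt G x y) \<otimes> inv (commt G x y) = v" using c Dc[OF v] by (simp add: m_assoc)
  finally show ?thesis by (simp add: v_def)
qed

lemma commt_D: "x \<in> H \<Longrightarrow> w \<in> D \<Longrightarrow> commt G x w \<in> D"
  by (simp add: commt_eq Hc Dc subgroupD[OF D] stabD(2)[OF stabH])

lemma conj_commt: "x \<in> H \<Longrightarrow> y \<in> H \<Longrightarrow> w \<in> D \<Longrightarrow> conjg G x (commt G y w) = commt G y (conjg G x w)"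
  by (simp add: commt_eq Hc Dc conjg_mult conjg_inv stabD(2)[OF stabH] conj_commute)

lemma commt_mult_D:
  assumes "x \<in> H" "v \<in> D" "w \<in> D"
  shows "commt G x (v \<otimes> w) = commt G x v \<otimes> commt G x w"
proof -
  have "conjg G v (commt G x w) = commt G x w"
    using ab[OF assms(2) commt_D[OF assms(1,3)]] assms by (simp add: conjg_def m_assoc Hc Dc)
  thus ?thesis using assms by (simp add: commt_mult_right Hc Dc)
qed

lemma commt_inv_D:
  assumes "x \<in> H" "v \<in> D"
  shows "commt G x (inv v) = inv (commt G x v)"
proof -
  have "commt G x v \<otimes> commt G x (inv v) = \<one>"
    using commt_mult_D[OF assms subgroupD(4)[OF D assms(2)]] assms by (simp add: Hc Dc)
  thus ?thesis using assms by (metis Dc Hc commt_closed inv_closed inv_comm inv_equality)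
qed

lemma commt_commute:
  assumes "x \<in> H" "y \<in> H" "w \<in> D"
  shows "commt G x (commt G y w) = commt G y (commt G x w)"
proof -
  have iw: "inv w \<in> D" using assms subgroupD(4)[OF D] by blast
  have cw: "conjg G y w \<in> D" "conjg G x w \<in> D" using assms by (auto intro: stabD(2)[OF stabH])
  have "commt G x (commt G y w) = conjg G y (commt G x w) \<otimes> inv (commt G x w)"
    using assms iw cw by (subst commt_eq[of y]) (simp_all add: Hc Dc commt_mult_D commt_inv_D flip: conj_commt)
  thus ?thesis using assms by (simp add: commt_eq Hc Dc)
qed

context
  fixes E assumes E: "E \<subseteq> H"
begin

lemma hyper_subset: "hyper G E D k \<subseteq> D"
  using subgroupD(2)[OF D] by (cases k) auto

lemma one_in_hyper: "\<one> \<in> hyper G E D k"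
  by (induction k) (use E Hc subgroupD(2)[OF D] in \<open>auto simp: subset_iff\<close>)

lemma hyper_Suc: "hyper G E D k \<subseteq> hyper G E D (Suc k)"
proof (induction k)
  case 0
  show ?case using one_in_hyper[of "Suc 0"] by auto
next
  case (Suc k)
  thus ?case by auto
qed

lemma hyper_mono: "k \<le> l \<Longrightarrow> hyper G E D k \<subseteq> hyper G E D l"
  by (rule lift_Suc_mono_le[of "hyper G E D"]) (use hyper_Suc in auto)

lemma hyper_conj: "h \<in> H \<Longrightarrow> w \<in> hyper G E D k \<Longrightarrow> conjg G h w \<in> hyper G E D k"
proof (induction k arbitrary: w)
  case (Suc k)
  have "commt G e (conjg G h w) \<in> hyper G E D k" if "e \<in> E" for e
    using Suc that E by (auto simp: subset_iff simp flip: conj_commt)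
  thus ?case using Suc.prems by (auto intro: stabD(2)[OF stabH])
qed (auto simp: Hc)

lemma hyper_commt: "h \<in> H \<Longrightarrow> w \<in> hyper G E D k \<Longrightarrow> commt G h w \<in> hyper G E D k"
proof (induction k arbitrary: w)
  case (Suc k)
  have "commt G e (commt G h w) \<in> hyper G E D k" if "e \<in> E" for e
    using Suc that E commt_commute[of e h w] by (auto simp: subset_iff)
  thus ?case using Suc.prems by (auto intro: commt_D)
qed (auto simp: Hc)

lemma hyper_subgroup: "subgroup (hyper G E D k) G"
proof (induction k)
  case (Suc k)
  show ?case
  proof
    show "hyper G E D (Suc k) \<subseteq> carrier G" using Dc by auto
    show "\<one> \<in> hyper G E D (Suc k)" by (rule one_in_hyper)
    fix x assume x: "x \<in> hyper G E D (Suc k)"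
    show "inv x \<in> hyper G E D (Suc k)"
      using x E Suc subgroupD(4)[OF D] by (auto simp: commt_inv_D subset_iff subgroupD(4))
    fix y assume y: "y \<in> hyper G E D (Suc k)"
    show "x \<otimes> y \<in> hyper G E D (Suc k)"
      using x y E Suc subgroupD(5)[OF D] by (auto simp: commt_mult_D subset_iff subgroupD(5))
  qed
qed (simp add: triv_subgroup)

end

text \<open>Each step of the series for \<open>E\<close> is refined into \<open>d\<close> steps, one
  per application of \<open>t\<close>. Since the actions commute, commutation with \<open>t\<close>
  does not leave the terms of the series for \<open>E\<close>.\<close>

lemma hyper_insert:
  assumes E: "E \<subseteq> H" and t: "t \<in> H" and nil: "\<And>w. w \<in> D \<Longrightarrow> ((\<lambda>w. commt G t w) ^^ d) w = \<one>"
  shows "hyper G E D j \<subseteq> hyper G (insert t E) D (j * d)"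
proof (induction j)
  case 0
  show ?case by simp
next
  case (Suc j)
  have E': "insert t E \<subseteq> H" using E t by simp
  have inner: "w \<in> hyper G (insert t E) D (j * d + i)"
    if "w \<in> hyper G E D (Suc j)" "((\<lambda>w. commt G t w) ^^ i) w \<in> hyper G E D j" for w i
    using that
  proof (induction i arbitrary: w)
    case 0
    thus ?case using Suc.IH by auto
  next
    case (Suc i)
    have "commt G t w \<in> hyper G E D (Suc j)" by (rule hyper_commt[OF E t Suc.prems(1)])
    moreover have "((\<lambda>w. commt G t w) ^^ i) (commt G t w) \<in> hyper G E D j"
      using Suc.prems(2) by (simp only: funpow_Suc_right o_apply)
    ultimately have 1: "commt G t w \<in> hyper G (insert t E) D (j * d + i)" by (rule Suc.IH)
    have "commt G e w \<in> hyper G (insert t E) D (j * d + i)" if "e \<in> E" for e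
    proof -
      have "commt G e w \<in> hyper G E D j" using Suc.prems(1) that by simp
      thus ?thesis using \<open>hyper G E D j \<subseteq> _\<close> hyper_mono[OF E', of "j * d" "j * d + i"] by auto
    qed
    thus ?case using 1 Suc.prems(1) by simp
  qed
  show ?case
  proof
    fix w assume w: "w \<in> hyper G E D (Suc j)"
    have "((\<lambda>w. commt G t w) ^^ d) w \<in> hyper G E D j" using nil[of w] w one_in_hyper[OF E] by simp
    from inner[OF w this] show "w \<in> hyper G (insert t E) D (Suc j * d)" by (simp add: add.commute)
  qed
qed

lemma hyper_exhausts:
  assumes "finite E" "E \<subseteq> H" and "\<And>t w. t \<in> E \<Longrightarrow> w \<in> D \<Longrightarrow> ((\<lambda>w. commt G t w) ^^ d) w = \<one>"
  shows "\<exists>L. D \<subseteq> hyper G E D L"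
  using assms
proof (induction E rule: finite_induct)
  case empty
  show ?case by (intro exI[of _ 1]) auto
next
  case (insert t E)
  then obtain L where "D \<subseteq> hyper G E D L" by auto
  also have "hyper G E D L \<subseteq> hyper G (insert t E) D (L * d)"
    using insert.prems by (intro hyper_insert) auto
  finally show ?case by blast
qed

text \<open>\<open>V\<close> consists of the elements of \<open>H\<close> acting trivially on all
  factors of the series \<open>Z\<close>. It contains the commutators of \<open>H\<close> and the
  powers \<open>s^N\<close>, so its index is at most \<open>N ^ card S\<close>. Once the lower
  central series of \<open>V\<close> has entered \<open>D\<close>, every further commutator descends
  one step of \<open>Z\<close>.\<close>

lemma virtually_nilpotent_if_unipotent:
  assumes S: "finite S" "S \<subseteq> carrier G" "generate G S = H" and c: "lcs G H c \<subseteq> D" and N: "N > 0"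
    and nil: "\<And>s w. s \<in> S \<Longrightarrow> w \<in> D \<Longrightarrow> ((\<lambda>w. commt G (s [^] (N::nat)) w) ^^ d) w = \<one>"
  shows "\<exists>V k n. subgroup V G \<and> V \<subseteq> H \<and> covered G H V k \<and> lcs G V n = {\<one>}"
proof -
  have SH: "S \<subseteq> H" using S generate_subset by auto
  define E where "E = (\<lambda>s. s [^] N) ` S"
  have E: "finite E" "E \<subseteq> H" using S SH subgroupD(8)[OF H] by (auto simp: E_def)
  obtain L where L: "D \<subseteq> hyper G E D L"
    using hyper_exhausts[OF E, of d] nil by (auto simp: E_def)
  define Z where "Z = hyper G E D"
  have Z: "subgroup (Z k) G" "Z k \<subseteq> D" "\<one> \<in> Z k" for k
    unfolding Z_def by (intro hyper_subgroup hyper_subset one_in_hyper E)+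
  have Zconj: "conjg G h w \<in> Z k" if "h \<in> H" "w \<in> Z k" for h w k
    using that unfolding Z_def by (intro hyper_conj E)
  define V where "V = {x \<in> H. \<forall>k. \<forall>w\<in>Z (Suc k). commt G x w \<in> Z k}"
  have Zc: "w \<in> carrier G" if "w \<in> Z k" for w k using that Z(2) Dc by blast
  have V: "subgroup V G"
  proof
    show "V \<subseteq> carrier G" using Hc by (auto simp: V_def)
    show "\<one> \<in> V" using Z(3) Zc subgroupD(2)[OF H] by (auto simp: V_def)
    fix x assume x: "x \<in> V"
    show "inv x \<in> V" using x subgroupD(4)[OF H] subgroupD(4)[OF Z(1)]
      by (auto simp: V_def commt_inv_left Hc Zc intro!: Zconj)
    fix y assume y: "y \<in> V"
    show "x \<otimes> y \<in> V" using x y subgroupD(5)[OF H]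
      by (auto simp: V_def commt_mult_left Hc Zc intro!: Zconj subgroupD(5)[OF Z(1)])
  qed
  have VH: "V \<subseteq> H" by (auto simp: V_def)
  have commV: "commt G x y \<in> V" if xy: "x \<in> H" "y \<in> H" for x y
  proof -
    have "commt G (commt G x y) w = \<one>" if w: "w \<in> Z (Suc k)" for w k
    proof -
      have "w \<in> D" using w Z(2) by blast
      from comm[OF xy this] show ?thesis
        using Hc[OF xy(1)] Hc[OF xy(2)] Dc[OF \<open>w \<in> D\<close>]
        by (subst commt_def) (simp add: m_assoc)
    qed
    thus ?thesis using subgroupD(6)[OF H xy] Z(3) by (simp add: V_def)
  qed
  have EV: "s [^] N \<in> V" if "s \<in> S" for s
    using that E by (auto simp: V_def Z_def E_def)
  have lH: "lcs G H (Suc 0) \<subseteq> V" "subgroup (lcs G H (Suc 0)) G" "lcs G H (Suc 0) \<subseteq> H"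
  proof -
    have "{commt G x y | x y. x \<in> H \<and> y \<in> H} \<subseteq> V" using commV by blast
    thus "lcs G H (Suc 0) \<subseteq> V" unfolding lcs.simps by (rule generate_least[OF V])
  qed (rule lcs_subgroup[OF H], rule lcs_subset[OF H])
  have cov: "covered G (generate G (S \<union> lcs G H (Suc 0))) V (N ^ card S)"
    by (rule abelian_factor_covered[OF lH(2) H lH(3) _ V lH(1) N S(1) SH EV])
       (use commt_in_lcs[of _ H _ 0] in auto)
  have "generate G (S \<union> lcs G H (Suc 0)) = H"
  proof
    show "generate G (S \<union> lcs G H (Suc 0)) \<subseteq> H" using SH lH(3) by (intro generate_least[OF H]) auto
    show "H \<subseteq> generate G (S \<union> lcs G H (Suc 0))" unfolding S(3)[symmetric] by (rule mono_generate) auto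
  qed
  hence cov': "covered G H V (N ^ card S)" using cov by simp
  have "lcs G V (c + j) \<subseteq> Z (L - j)" if "j \<le> L" for j
    using that
  proof (induction j)
    case 0
    thus ?case using lcs_mono[OF VH, of c] c L by (auto simp: Z_def)
  next
    case (Suc j)
    have "{commt G x y |x y. x \<in> V \<and> y \<in> lcs G V (c + j)} \<subseteq> Z (L - Suc j)"
    proof clarify
      fix x y assume x: "x \<in> V" and "y \<in> lcs G V (c + j)"
      hence "y \<in> Z (Suc (L - Suc j))" using Suc by (auto simp: Suc_diff_Suc)
      thus "commt G x y \<in> Z (L - Suc j)" using x by (simp add: V_def)
    qed
    thus ?case using generate_least[OF Z(1)] by simp
  qed
  from this[of L] have "lcs G V (c + L) \<subseteq> {\<one>}" by (simp add: Z_def)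
  hence "lcs G V (c + L) = {\<one>}" using subgroupD(2)[OF lcs_subgroup[OF V]] by blast
  thus ?thesis using V VH cov' by blast
qed

text \<open>The kernel of \<open>P\<close> acting through \<open>s\<close> is a subgroup invariant
  under \<open>H\<close>, because the actions commute; so normal generators suffice.\<close>

lemma poly_act_kills_nclosure:
  assumes Y: "Y \<subseteq> D" "D = nclosure G H Y" and s: "s \<in> H" and P: "\<And>y. y \<in> Y \<Longrightarrow> poly_act G s P y = \<one>"
    and w: "w \<in> D"
  shows "poly_act G s P w = \<one>"
proof -
  let ?K = "{w \<in> D. poly_act G s P w = \<one>}"
  have "subgroup ?K G"
    by unfold_locales (auto simp: poly_act_hom poly_act_inv stabH s Dc subgroupD[OF D])
  moreover have "normalizes G H ?K"
    unfolding normalizes_def by (auto simp: poly_act_conj[OF stabH[OF s] stabH] conj_commute s Hc stabD(2)[OF stabH])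
  moreover have "Y \<subseteq> ?K" using Y(1) P by auto
  ultimately have "nclosure G H Y \<subseteq> ?K" by (rule nclosure_least)
  thus ?thesis using w Y(2) by auto
qed

text \<open>Otherwise small relations would hold for all powers of each generator of
  \<open>H\<close> on each normal generator of \<open>D\<close>. All generators would then act
  quasi-unipotently on \<open>D\<close>, making \<open>H\<close> virtually nilpotent.\<close>

lemma exists_free_pair:
  assumes S: "finite S" "S \<subseteq> carrier G" "generate G S = H"
    and Y: "finite Y" "Y \<subseteq> D" "D = nclosure G H Y" and c: "lcs G H c \<subseteq> D"
    and tf: "\<And>w (n::int). w \<in> D \<Longrightarrow> n \<noteq> 0 \<Longrightarrow> w [^] n = \<one> \<Longrightarrow> w = \<one>"
    and not_nil: "\<not> (\<exists>V k n. subgroup V G \<and> V \<subseteq> H \<and> covered G H V k \<and> lcs G V n = {\<one>})"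
  shows "\<exists>a\<in>D. \<exists>u\<in>H. \<forall>F. small_poly F \<longrightarrow> poly_act G u F a \<noteq> \<one>"
proof (rule ccontr)
  assume neg: "\<not> ?thesis"
  have SH: "S \<subseteq> H" using S generate_subset by auto
  have "\<forall>s\<in>S. \<forall>y\<in>Y. \<exists>N>0. \<exists>d. poly_act G s ((Polynomial.monom 1 N - 1) ^ d) y = \<one>"
  proof (intro ballI)
    fix s y assume sy: "s \<in> S" "y \<in> Y"
    have sH: "s \<in> H" and yD: "y \<in> D" using sy SH Y(2) by auto
    show "\<exists>N>0. \<exists>d. poly_act G s ((Polynomial.monom 1 N - 1) ^ d) y = \<one>"
    proof (rule quasi_unipotent[OF stabH[OF sH] yD tf])
      fix k :: nat assume "k > 0"
      show "\<exists>F. small_poly F \<and> poly_act G (s [^] k) F y = \<one>"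
        using neg yD subgroupD(8)[OF H sH, of k] by blast
    qed
  qed
  then obtain N d where Nd: "\<And>s y. s \<in> S \<Longrightarrow> y \<in> Y \<Longrightarrow> N s y > (0::nat)"
    "\<And>s y. s \<in> S \<Longrightarrow> y \<in> Y \<Longrightarrow> poly_act G s ((Polynomial.monom 1 (N s y) - 1) ^ d s y) y = \<one>"
    by metis
  \<comment> \<open>Common exponents for all pairs: the product makes \<open>x^(N s y) - 1\<close>
    divide \<open>x^M - 1\<close>, and the sum dominates every \<open>d s y\<close>.\<close>
  define M where "M = prod (\<lambda>(s, y). N s y) (S \<times> Y)"
  define e where "e = sum (\<lambda>(s, y). d s y) (S \<times> Y)"
  have fin: "finite (S \<times> Y)" using S Y by simp
  have M: "M > 0" unfolding M_def using Nd(1) by (intro prod_pos) auto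
  have kill: "poly_act G s ((Polynomial.monom 1 M - 1) ^ e) y = \<one>" if sy: "s \<in> S" "y \<in> Y" for s y
  proof -
    have "N s y dvd M" unfolding M_def using sy fin dvd_prodI[of "S \<times> Y" "(s, y)" "\<lambda>(s, y). N s y"] by auto
    moreover have "d s y \<le> e" unfolding e_def using sy fin member_le_sum[of "(s, y)" "S \<times> Y" "\<lambda>(s, y). d s y"] by auto
    ultimately have "(Polynomial.monom (1::int) (N s y) - 1) ^ d s y dvd (Polynomial.monom 1 M - 1) ^ e"
      by (meson dvd_power_le monom_minus_one_dvd)
    then obtain Q where "(Polynomial.monom 1 M - 1) ^ e = (Polynomial.monom (1::int) (N s y) - 1) ^ d s y * Q" by blast
    hence "(Polynomial.monom 1 M - 1) ^ e = Q * (Polynomial.monom (1::int) (N s y) - 1) ^ d s y" by (simp only: mult.commute)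
    thus ?thesis using sy SH Y(2) by (simp only: poly_act_mult stabH subsetD Nd(2) poly_act_one)
  qed
  have "((\<lambda>w. commt G (s [^] M) w) ^^ e) w = \<one>" if "s \<in> S" "w \<in> D" for s w
    using poly_act_kills_nclosure[OF Y(2,3) _ kill[OF that(1)] that(2)] that SH
    by (simp add: poly_act_power_monom stabH subset_iff)
  from virtually_nilpotent_if_unipotent[OF S c M this] not_nil show False by blast
qed

end

section \<open>Residual finiteness\<close>

context group_hom
begin

lemma hom_commt: "x \<in> carrier G \<Longrightarrow> y \<in> carrier G \<Longrightarrow> h (commt G x y) = commt H (h x) (h y)"
  by (simp add: commt_def)

lemma lcs_image:
  assumes K: "subgroup K G"
  shows "h ` lcs G K n = lcs H (h ` K) n"
proof (induction n)
  case (Suc n)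
  have Kc: "K \<subseteq> carrier G" "lcs G K n \<subseteq> carrier G"
    using G.subgroupD(1)[OF K] G.lcs_subset[OF K, of n] by auto
  have hc: "h (commt G x y) = commt H (h x) (h y)" if "x \<in> K" "y \<in> lcs G K n" for x y
    by (rule hom_commt) (use that Kc in auto)
  have "h ` {commt G x y | x y. x \<in> K \<and> y \<in> lcs G K n} = {commt H x y | x y. x \<in> h ` K \<and> y \<in> h ` lcs G K n}"
    (is "h ` ?A = ?B")
  proof
    show "h ` ?A \<subseteq> ?B" using hc by blast
    show "?B \<subseteq> h ` ?A"
    proof
      fix z assume "z \<in> ?B"
      then obtain x y where xy: "x \<in> K" "y \<in> lcs G K n" "z = commt H (h x) (h y)" by blast
      hence "z = h (commt G x y)" by (simp only: hc)
      thus "z \<in> h ` ?A" using xy by blast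
    qed
  qed
  moreover have "{commt G x y | x y. x \<in> K \<and> y \<in> lcs G K n} \<subseteq> carrier G"
    using Kc by (auto simp: subset_iff)
  ultimately show ?case using generate_img[of "{commt G x y | x y. x \<in> K \<and> y \<in> lcs G K n}"] by (simp add: Suc)
qed simp

lemma covered_image:
  assumes "covered G U B k" "U \<subseteq> carrier G" "B \<subseteq> carrier G"
  shows "covered H (h ` U) (h ` B) k"
proof -
  obtain T where T: "finite T" "T \<subseteq> U" "card T \<le> k" "\<forall>x\<in>U. \<exists>t\<in>T. \<exists>b\<in>B. x = t \<otimes> b"
    using assms(1) by (rule G.coveredE)
  show ?thesis
  proof (rule H.coveredI[of "h ` T"])
    show "card (h ` T) \<le> k" using T card_image_le[of T h] by linarith
    fix x assume "x \<in> h ` U"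
    then obtain u where u: "u \<in> U" "x = h u" by blast
    then obtain t b where "t \<in> T" "b \<in> B" "u = t \<otimes> b" using T(4) by blast
    moreover from this have "x = h t \<otimes>\<^bsub>H\<^esub> h b" using u T(2) assms(2,3) by (simp add: subset_iff)
    ultimately show "\<exists>t\<in>h ` T. \<exists>b\<in>h ` B. x = t \<otimes>\<^bsub>H\<^esub> b" by blast
  qed (use T in auto)
qed

lemma power_subgroup_image:
  assumes "x \<in> power_subgroup G (carrier G) m"
  shows "h x \<in> power_subgroup H (carrier H) m"
proof -
  have P: "subgroup (power_subgroup H (carrier H) m) H" by (rule H.power_subgroup_subgroup[OF H.subgroup_self])
  let ?V = "{x \<in> carrier G. h x \<in> power_subgroup H (carrier H) m}"
  have "subgroup ?V G"
    by unfold_locales (auto simp: H.subgroupD[OF P])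
  moreover have "y [^] m \<in> ?V" if "y \<in> carrier G" for y
    using that H.power_subgroup_incl[OF H.subgroup_self, of "h y" m] by (simp add: hom_nat_pow)
  ultimately have "power_subgroup G (carrier G) m \<subseteq> ?V" by (intro G.power_subgroup_least)
  thus ?thesis using assms by blast
qed

end

context group
begin

text \<open>For a single element the word length is fixed, so the detection theorem applies with any
  sufficiently large \<open>l\<close>.\<close>

lemma virtually_nilpotent_residually_finite:
  assumes H: "subgroup H G" "covered G (carrier G) H k" "lcs G H c = {\<one>}"
    and S: "finite S" "S \<subseteq> carrier G" "generate G S = carrier G" and g: "g \<in> carrier G" "g \<noteq> \<one>"
  shows "\<exists>m>0. g \<notin> power_subgroup G (carrier G) m"
proof -
  obtain e C D where e: "e > 0" and det: "\<And>n g l. g \<in> sphere G (S \<union> (\<lambda>s. inv s) ` S) n \<Longrightarrow> g \<noteq> \<one> \<Longrightarrow>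
      C * (n + 1) ^ D < 4 ^ l \<Longrightarrow> \<exists>q\<in>{1..2 * l + 1}. g \<notin> power_subgroup G (carrier G) (e * q)"
    using virtually_nilpotent_detection[OF H S] by blast
  obtain n where n: "g \<in> sphere G (S \<union> (\<lambda>s. inv s) ` S) n"
    using generate_eq_spheres[OF S(2)] S(3) g(1) by auto
  obtain l where l: "C * (n + 1) ^ D < 4 ^ l"
    using power_gt_expt[of 4 "C * (n + 1) ^ D"] by auto
  obtain q where "q \<in> {1..2 * l + 1}" "g \<notin> power_subgroup G (carrier G) (e * q)"
    using det[OF n g(2) l] by blast
  thus ?thesis using e by (intro exI[of _ "e * q"]) auto
qed

text \<open>The preceding lemma in the quotient by \<open>N\<close>. Power subgroups map into power
  subgroups, so nonmembership pulls back.\<close>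

lemma residually_finite_mod:
  assumes N: "N \<lhd> G" and H: "subgroup H G" "covered G (carrier G) H k" "lcs G H c \<subseteq> N"
    and S: "finite S" "S \<subseteq> carrier G" "generate G S = carrier G" and g: "g \<in> carrier G" "g \<notin> N"
  shows "\<exists>m>0. g \<notin> power_subgroup G (carrier G) m"
proof -
  define Q where "Q = G Mod N"
  define h where "h = (\<lambda>x. N #> x)"
  interpret Q: group Q unfolding Q_def by (rule normal.factorgroup_is_group[OF N])
  interpret h: group_hom G Q h
    by unfold_locales (use normal.r_coset_hom_Mod[OF N] in \<open>simp add: h_def Q_def\<close>)
  have Nsub: "subgroup N G" using N by (rule normal_imp_subgroup)
  have h1: "h x = \<one>\<^bsub>Q\<^esub> \<longleftrightarrow> x \<in> N" if "x \<in> carrier G" for x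
  proof -
    have "\<one>\<^bsub>Q\<^esub> = N" by (simp add: Q_def FactGroup_def)
    thus ?thesis unfolding h_def using coset_join1[of N x] coset_join2[OF that Nsub] subgroupD(1)[OF Nsub] that Nsub by metis
  qed
  have surj: "h ` carrier G = carrier Q" by (auto simp: h_def Q_def FactGroup_def RCOSETS_def)
  have "lcs Q (h ` H) c = h ` lcs G H c" by (rule h.lcs_image[OF H(1), symmetric])
  also have "\<dots> = {\<one>\<^bsub>Q\<^esub>}"
  proof
    have "h x = \<one>\<^bsub>Q\<^esub>" if "x \<in> lcs G H c" for x
      using that H(3) h1[of x] subgroupD(1)[OF lcs_subgroup[OF H(1)]] by blast
    thus "h ` lcs G H c \<subseteq> {\<one>\<^bsub>Q\<^esub>}" by auto
    have "h \<one> \<in> h ` lcs G H c" using subgroupD(2)[OF lcs_subgroup[OF H(1)]] by blast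
    thus "{\<one>\<^bsub>Q\<^esub>} \<subseteq> h ` lcs G H c" by simp
  qed
  finally have l: "lcs Q (h ` H) c = {\<one>\<^bsub>Q\<^esub>}" .
  have "\<exists>m>0. h g \<notin> power_subgroup Q (carrier Q) m"
  proof (rule Q.virtually_nilpotent_residually_finite[OF _ _ l])
    show "subgroup (h ` H) Q" by (rule h.subgroup_img_is_subgroup[OF H(1)])
    show "covered Q (carrier Q) (h ` H) k"
      using h.covered_image[OF H(2) order_refl subgroupD(1)[OF H(1)]] by (simp add: surj)
    show "finite (h ` S)" "h ` S \<subseteq> carrier Q" using S by auto
    show "generate Q (h ` S) = carrier Q" using h.generate_img[OF S(2)] S(3) surj by simp
    show "h g \<in> carrier Q" "h g \<noteq> \<one>\<^bsub>Q\<^esub>" using g h1 by auto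
  qed
  thus ?thesis using h.power_subgroup_image by blast
qed

end

section \<open>Coordinates on free abelian subgroups of finite rank\<close>

text \<open>An isomorphism of \<open>M\<close> with the free abelian group of rank \<open>k\<close>,
  given by its coordinate functions and a dual basis.\<close>

definition coordinates :: "('a, 'b) monoid_scheme \<Rightarrow> nat \<Rightarrow> (nat \<Rightarrow> 'a \<Rightarrow> int) \<Rightarrow> 'a set \<Rightarrow> bool" where
  "coordinates G k l M \<longleftrightarrow> subgroup M G \<and> (\<exists>F. finite F \<and> F \<subseteq> carrier G \<and> generate G F = M) \<and>
     (\<forall>i<k. \<exists>a\<in>M. \<forall>j<k. l j a = of_bool (i = j)) \<and>
     (\<forall>i<k. \<forall>x\<in>M. \<forall>y\<in>M. l i (x \<otimes>\<^bsub>G\<^esub> y) = l i x + l i y) \<and>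
     (\<forall>x\<in>M. (\<forall>i<k. l i x = 0) \<longrightarrow> x = \<one>\<^bsub>G\<^esub>)"

context abelian_action
begin

lemma coordinates_extend:
  assumes M: "coordinates G k l M" "M \<subseteq> D" and t: "t \<in> D" and inf: "\<And>n::int. t [^] n \<in> M \<Longrightarrow> n = 0"
  shows "\<exists>l' M'. coordinates G (Suc k) l' M' \<and> M' \<subseteq> D"
proof -
  have Ms: "subgroup M G" using M by (simp add: coordinates_def)
  have tc: "t \<in> carrier G" using t Dc by blast
  have cj: "conjg G u v = v" if "u \<in> D" "v \<in> D" for u v
    using that ab[OF that] by (simp add: conjg_def m_assoc Dc)
  have nt: "normalizes G {t, inv t} M"
    using M(2) t subgroupD(4)[OF D t] by (auto simp: normalizes_def cj subset_iff)
  define M' where "M' = generate G (insert t M)"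
  have M's: "subgroup M' G" and M'eq: "M' = {y \<otimes> t [^] n | y (n::int). y \<in> M}"
    unfolding M'_def by (rule cyclic_extension[OF Ms tc nt])+
  have M'D: "M' \<subseteq> D" unfolding M'_def using M(2) t by (intro generate_least[OF D]) auto
  have "\<exists>\<beta> \<kappa>. \<forall>b\<in>M. \<forall>k::int. \<beta> (b \<otimes> t [^] k) = b \<and> \<kappa> (b \<otimes> t [^] k) = k"
    by (rule cyclic_extension_coordinates[OF Ms tc inf])
  then obtain \<beta> and \<kappa> :: "'a \<Rightarrow> int"
    where "\<forall>b\<in>M. \<forall>k. \<beta> (b \<otimes> t [^] k) = b \<and> \<kappa> (b \<otimes> t [^] k) = k" by blast
  hence dec: "\<beta> (b \<otimes> t [^] k) = b" "\<kappa> (b \<otimes> t [^] k) = k" if "b \<in> M" for b k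
    using that by auto
  define l' where "l' i x = (if i < k then l i (\<beta> x) else \<kappa> x)" for i x
  have l1: "l i \<one> = 0" if "i < k" for i
  proof -
    have "l i (\<one> \<otimes> \<one>) = l i \<one> + l i \<one>" using M(1) that subgroupD(2)[OF Ms] by (simp only: coordinates_def)
    thus ?thesis by simp
  qed
  have "coordinates G (Suc k) l' M'" unfolding coordinates_def
  proof (intro conjI allI impI ballI)
    show "subgroup M' G" by (rule M's)
    obtain F where F: "finite F" "F \<subseteq> carrier G" "generate G F = M" using M(1) by (auto simp: coordinates_def)
    have sg: "subgroup (generate G (insert t F)) G" using F tc by (intro generate_subgroup) auto
    have "generate G (insert t F) = M'"
    proof
      show "generate G (insert t F) \<subseteq> M'" unfolding M'_def F(3)[symmetric]
        by (rule mono_generate) (auto intro: generate.incl)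
      have "M \<subseteq> generate G (insert t F)" unfolding F(3)[symmetric] by (rule mono_generate) auto
      thus "M' \<subseteq> generate G (insert t F)" unfolding M'_def
        by (intro generate_least[OF sg]) (auto intro: generate.incl)
    qed
    thus "\<exists>F. finite F \<and> F \<subseteq> carrier G \<and> generate G F = M'" using F tc by (intro exI[of _ "insert t F"]) auto
  next
    fix i assume i: "i < Suc k"
    show "\<exists>a\<in>M'. \<forall>j<Suc k. l' j a = of_bool (i = j)"
    proof (cases "i < k")
      case True
      then obtain a where a: "a \<in> M" "\<forall>j<k. l j a = of_bool (i = j)" using M(1) by (auto simp: coordinates_def)
      have ac: "a \<otimes> t [^] (0::int) = a" using a Ms by (simp add: subgroupD(3))
      have "a \<in> M'" unfolding M'eq using a ac by (metis (mono_tags, lifting) mem_Collect_eq)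
      moreover have "\<beta> a = a" "\<kappa> a = 0" using dec[OF a(1), of 0] by (simp_all only: ac)
      ultimately show ?thesis using a(2) True by (intro bexI[of _ a]) (auto simp: l'_def)
    next
      case False
      have 1: "\<one> \<in> M" by (rule subgroupD(2)[OF Ms])
      have tt: "\<one> \<otimes> t [^] (1::int) = t" using tc by simp
      have "t \<in> M'" unfolding M'_def by (rule generate.incl) simp
      moreover have "\<beta> t = \<one>" "\<kappa> t = 1" using dec[OF 1, of 1] by (simp_all only: tt)
      ultimately show ?thesis using i False l1 by (intro bexI[of _ t]) (auto simp: l'_def)
    qed
  next
    fix i x y assume i: "i < Suc k" and x: "x \<in> M'" and y: "y \<in> M'"
    obtain b m where b: "b \<in> M" "x = b \<otimes> t [^] (m::int)" using x unfolding M'eq by blast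
    obtain c n where c: "c \<in> M" "y = c \<otimes> t [^] (n::int)" using y unfolding M'eq by blast
    have bc: "b \<otimes> c \<in> M" by (rule subgroupD(5)[OF Ms b(1) c(1)])
    have D4: "b \<in> D" "c \<in> D" "t [^] m \<in> D" "t [^] n \<in> D" using b c M(2) t by (auto intro: int_pow_D)
    have "x \<otimes> y = (b \<otimes> c) \<otimes> t [^] (m + n)"
      using mult4[OF D4(1,3,2,4)] tc by (simp add: b c int_pow_mult)
    thus "l' i (x \<otimes> y) = l' i x + l' i y"
      using M(1) b c bc by (simp add: l'_def dec coordinates_def)
  next
    fix x assume x: "x \<in> M'" and z: "\<forall>i<Suc k. l' i x = 0"
    obtain b m where b: "b \<in> M" "x = b \<otimes> t [^] (m::int)" using x unfolding M'eq by blast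
    have "m = 0" using z[rule_format, of k] b by (simp add: l'_def dec)
    moreover have "\<forall>i<k. l i b = 0"
    proof (intro allI impI)
      fix i assume "i < k"
      thus "l i b = 0" using z[rule_format, of i] b by (simp add: l'_def dec)
    qed
    hence "b = \<one>" using M(1) b by (auto simp: coordinates_def)
    ultimately show "x = \<one>" using b by simp
  qed
  thus ?thesis using M'D by blast
qed

text \<open>Counting modulo squares: the parities of the coordinates distinguish \<open>2^k\<close>
  elements, while an abelian group with \<open>r\<close> generators has at most \<open>2^r\<close>
  classes modulo squares.\<close>

lemma coordinates_le_rank:
  assumes M: "coordinates G k l M" "M \<subseteq> D"
    and rank: "\<And>F. finite F \<Longrightarrow> F \<subseteq> D \<Longrightarrow> \<exists>T. finite T \<and> T \<subseteq> D \<and> card T \<le> r \<and> generate G T = generate G F"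
  shows "k \<le> r"
proof (rule ccontr)
  assume "\<not> k \<le> r"
  have Ms: "subgroup M G" using M by (simp add: coordinates_def)
  obtain F where F: "finite F" "F \<subseteq> carrier G" "generate G F = M" using M(1) by (auto simp: coordinates_def)
  have "F \<subseteq> D" using F(3) M(2) generate_subset by blast
  then obtain T where T: "finite T" "T \<subseteq> D" "card T \<le> r" "generate G T = M" using rank[OF F(1)] F(3) by auto
  have TM: "T \<subseteq> M" using T(4) generate_subset by blast
  define B where "B = power_subgroup G M 2"
  have B: "subgroup B G" unfolding B_def by (rule power_subgroup_subgroup[OF Ms])
  have comm1: "commt G x y \<in> {\<one>}" if "x \<in> M" "y \<in> M" for x y
  proof -
    have "x \<in> D" "y \<in> D" using that M(2) by auto
    thus ?thesis using ab[of x y] by (simp add: commt_def m_assoc Dc)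
  qed
  have "covered G (generate G (T \<union> {\<one>})) B (2 ^ card T)"
    by (rule abelian_factor_covered[OF triv_subgroup Ms _ comm1 B _ _ T(1) TM])
       (use subgroupD(2)[OF Ms] subgroupD(2)[OF B] TM power_subgroup_incl[OF Ms] in \<open>auto simp: B_def\<close>)
  moreover have "generate G (T \<union> {\<one>}) = M"
  proof
    show "generate G (T \<union> {\<one>}) \<subseteq> M" using TM subgroupD(2)[OF Ms] by (intro generate_least[OF Ms]) auto
    show "M \<subseteq> generate G (T \<union> {\<one>})" unfolding T(4)[symmetric] by (rule mono_generate) auto
  qed
  ultimately have cov: "covered G M B (2 ^ card T)" by simp
  have add: "l i (x \<otimes> y) = l i x + l i y" if "i < k" "x \<in> M" "y \<in> M" for i x y
    using M(1) that by (simp add: coordinates_def)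
  have l1: "l i \<one> = 0" if "i < k" for i using add[OF that, of \<one> \<one>] subgroupD(2)[OF Ms] by simp
  have linv: "l i (inv x) = - l i x" if "i < k" "x \<in> M" for i x
    using add[OF that(1,2) subgroupD(4)[OF Ms that(2)]] l1[OF that(1)] that(2) subgroupD(3)[OF Ms] by simp
  have ex: "\<exists>e\<in>M. \<forall>i<k. l i e = of_bool (i \<in> J)" if "finite J" "J \<subseteq> {..<k}" for J
    using that
  proof (induction J rule: finite_induct)
    case empty
    show ?case by (intro bexI[of _ \<one>]) (use l1 subgroupD(2)[OF Ms] in auto)
  next
    case (insert j J)
    then obtain e where e: "e \<in> M" "\<forall>i<k. l i e = of_bool (i \<in> J)" by auto
    obtain a where a: "a \<in> M" "\<forall>i<k. l i a = of_bool (j = i)"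
      using M(1) insert.prems by (auto simp: coordinates_def)
    show ?case
      by (intro bexI[of _ "a \<otimes> e"] subgroupD(5)[OF Ms] a e) (use a e insert.hyps in \<open>auto simp: add\<close>)
  qed
  have "\<forall>J\<in>Pow {..<k}. \<exists>e. e \<in> M \<and> (\<forall>i<k. l i e = of_bool (i \<in> J))"
  proof
    fix J assume "J \<in> Pow {..<k}"
    hence J: "J \<subseteq> {..<k}" by simp
    show "\<exists>e. e \<in> M \<and> (\<forall>i<k. l i e = of_bool (i \<in> J))"
      using ex[OF finite_subset[OF J finite_lessThan] J] by blast
  qed
  from bchoice[OF this] obtain e where "\<forall>J\<in>Pow {..<k}. e J \<in> M \<and> (\<forall>i<k. l i (e J) = of_bool (i \<in> J))" ..
  hence e: "e J \<in> M" "i < k \<Longrightarrow> l i (e J) = of_bool (i \<in> J)" if "J \<subseteq> {..<k}" for J i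
    using that by auto
  have lt: "2 ^ card T < card (Pow {..<k})" using T(3) \<open>\<not> k \<le> r\<close> by (simp add: card_Pow)
  obtain J J' where J: "J \<in> Pow {..<k}" "J' \<in> Pow {..<k}" "J \<noteq> J'" "inv (e J) \<otimes> e J' \<in> B"
    using covered_pigeonhole[OF cov B subgroupD(1)[OF Ms] _ lt, of e] e(1) by blast
  have even: "even (l i x)" if "i < k" "x \<in> B" for i x
  proof -
    have "subgroup {x \<in> M. even (l i x)} G"
      by unfold_locales (use that in \<open>auto simp: add l1 linv subgroupD[OF Ms]\<close>)
    moreover have "x [^] (2::nat) \<in> {x \<in> M. even (l i x)}" if "x \<in> M" for x
      using that \<open>i < k\<close> add[of i x x] subgroupD(3,5)[OF Ms] by (simp add: numeral_2_eq_2)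
    ultimately have "B \<subseteq> {x \<in> M. even (l i x)}" unfolding B_def by (rule power_subgroup_least)
    thus ?thesis using that by blast
  qed
  have "i \<in> J \<longleftrightarrow> i \<in> J'" if "i < k" for i
  proof -
    have "even (l i (inv (e J) \<otimes> e J'))" by (rule even[OF that J(4)])
    hence "even (of_bool (i \<in> J') - of_bool (i \<in> J) :: int)"
      using that J by (simp add: add linv e subgroupD(4)[OF Ms])
    thus ?thesis by (auto split: if_splits)
  qed
  hence "J = J'" using J(1,2) by blast
  thus False using J(3) by blast
qed

text \<open>The rank bounds \<open>k\<close>, so a largest \<open>k\<close> exists. An element
  without a positive power in \<open>M\<close> would supply a further coordinate.\<close>

lemma maximal_coordinates:
  assumes rank: "\<And>F. finite F \<Longrightarrow> F \<subseteq> D \<Longrightarrow> \<exists>T. finite T \<and> T \<subseteq> D \<and> card T \<le> r \<and> generate G T = generate G F"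
  shows "\<exists>k l M. coordinates G k l M \<and> M \<subseteq> D \<and> (\<forall>v\<in>D. \<exists>n>0::nat. v [^] n \<in> M)"
proof -
  define P where "P k \<longleftrightarrow> (\<exists>l M. coordinates G k l M \<and> M \<subseteq> D)" for k
  have "coordinates G 0 (\<lambda>_ _. 0) {\<one>}" unfolding coordinates_def
    using triv_subgroup generate_least[OF triv_subgroup, of "{\<one>}"] generate_subset[of "{\<one>}"]
    by (auto intro!: exI[of _ "{\<one>}"])
  hence P0: "P 0" unfolding P_def using subgroupD(2)[OF D] by blast
  have Pr: "k \<le> r" if "P k" for k using that coordinates_le_rank[OF _ _ rank] unfolding P_def by blast
  define k where "k = (GREATEST k. P k)"
  have Pk: "P k" unfolding k_def by (rule GreatestI_nat[of P 0 r]) (use P0 Pr in auto)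
  have max: "\<not> P (Suc k)" using Greatest_le_nat[of P "Suc k" r] Pr by (auto simp: k_def)
  obtain l M where M: "coordinates G k l M" "M \<subseteq> D" using Pk by (auto simp: P_def)
  have Ms: "subgroup M G" using M by (simp add: coordinates_def)
  have "\<exists>n>0::nat. v [^] n \<in> M" if v: "v \<in> D" for v
  proof -
    obtain n :: int where n: "v [^] n \<in> M" "n \<noteq> 0"
      using coordinates_extend[OF M v] max unfolding P_def by blast
    have "v [^] nat \<bar>n\<bar> \<in> M"
    proof (cases "n > 0")
      case True
      thus ?thesis using n by (simp flip: int_pow_int)
    next
      case False
      have "v [^] (- n) \<in> M" using subgroupD(4)[OF Ms n(1)] v by (simp add: int_pow_neg Dc)
      thus ?thesis using False by (simp flip: int_pow_int)
    qed
    thus ?thesis using n(2) by (intro exI[of _ "nat \<bar>n\<bar>"]) auto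
  qed
  thus ?thesis using M by blast
qed

lemma coordinates_nat_pow:
  assumes M: "coordinates G k l M" and i: "i < k" and x: "x \<in> M"
  shows "l i (x [^] (n::nat)) = int n * l i x"
proof -
  have Ms: "subgroup M G" using M by (simp add: coordinates_def)
  have add: "l i (x \<otimes> y) = l i x + l i y" if "x \<in> M" "y \<in> M" for x y
    using M that i by (simp add: coordinates_def)
  have "l i \<one> = 0" using add[of \<one> \<one>] subgroupD(2)[OF Ms] by simp
  thus ?thesis by (induction n) (simp_all add: add x subgroupD(8)[OF Ms x] algebra_simps)
qed

end


section \<open>Reduction modulo large primes\<close>

context commuting_action
begin

text \<open>Some integer \<open>N\<close> has the property that every element of the finitely generated module \<open>D\<close>
  of finite rank lies in the lattice \<open>M\<close> after multiplication by a power of \<open>N\<close>.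
  Hence \<open>p D\<close> misses a given nonzero element as soon as the prime \<open>p\<close> is large.\<close>

lemma exists_prime_not_divisible:
  assumes S: "finite S" "S \<subseteq> carrier G" "generate G S = H"
    and Y: "finite Y" "Y \<subseteq> D" "D = nclosure G H Y"
    and tf: "\<And>w (n::int). w \<in> D \<Longrightarrow> n \<noteq> 0 \<Longrightarrow> w [^] n = \<one> \<Longrightarrow> w = \<one>"
    and rank: "\<And>F. finite F \<Longrightarrow> F \<subseteq> D \<Longrightarrow> \<exists>T. finite T \<and> T \<subseteq> D \<and> card T \<le> r \<and> generate G T = generate G F"
    and w: "w \<in> D" "w \<noteq> \<one>"
  shows "\<exists>p::nat. p > 0 \<and> (\<forall>v\<in>D. w \<noteq> v [^] p)"
proof -
  have SH: "S \<subseteq> H" using S generate_subset by auto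
  have "\<exists>k l M. coordinates G k l M \<and> M \<subseteq> D \<and> (\<forall>v\<in>D. \<exists>n>0::nat. v [^] n \<in> M)"
    by (rule maximal_coordinates[OF rank])
  then obtain k l M where M: "coordinates G k l M" "M \<subseteq> D" "\<forall>v\<in>D. \<exists>n>0::nat. v [^] n \<in> M" by blast
  have Ms: "subgroup M G" using M(1) by (simp add: coordinates_def)
  obtain F where F: "finite F" "F \<subseteq> carrier G" "generate G F = M" using M(1) by (auto simp: coordinates_def)
  have FM: "F \<subseteq> M" using F(3) generate_subset by blast
  from bchoice[OF M(3)] obtain \<nu> where "\<forall>v\<in>D. \<nu> v > (0::nat) \<and> v [^] \<nu> v \<in> M" ..
  hence \<nu>: "\<nu> v > 0" "v [^] \<nu> v \<in> M" if "v \<in> D" for v using that by auto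
  define S1 where "S1 = S \<union> (\<lambda>s. inv s) ` S"
  have S1: "finite S1" "S1 \<subseteq> H" using S(1) SH subgroupD(4)[OF H] by (auto simp: S1_def)
  \<comment> \<open>Only finitely many elements have to be brought into \<open>M\<close> by a common
    exponent: the conjugates of its generators by letters, and the normal generators of
    \<open>D\<close>.\<close>
  define E where "E = (\<lambda>(s, a). conjg G s a) ` (S1 \<times> F) \<union> Y"
  have cD: "conjg G s a \<in> D" if "s \<in> H" "a \<in> D" for s a using that by (intro stabD(2)[OF stabH])
  have E: "finite E" "E \<subseteq> D" using S1 F FM M(2) Y cD by (auto simp: E_def subset_iff)
  define N where "N = prod \<nu> E"
  have N0: "N > 0" unfolding N_def using \<nu>(1) E by (intro prod_pos) auto
  have powM: "v [^] m \<in> M" if "v [^] n \<in> M" "n dvd m" "v \<in> D" for v and n m :: nat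
  proof -
    obtain q where "m = n * q" using \<open>n dvd m\<close> by blast
    hence "v [^] m = (v [^] n) [^] q" using that by (simp add: nat_pow_pow Dc)
    thus ?thesis using subgroupD(8)[OF Ms that(1)] by simp
  qed
  have EN: "v [^] N \<in> M" if "v \<in> E" for v
  proof -
    have "\<nu> v dvd N" unfolding N_def using that E by (intro dvd_prodI)
    thus ?thesis using powM[of v "\<nu> v" N] \<nu>(2) that E by blast
  qed
  have distrib: "(x \<otimes> y) [^] n = x [^] n \<otimes> y [^] n" if "x \<in> D" "y \<in> D" for x y and n :: nat
    using int_pow_distrib[OF that, of "int n"] by (simp add: int_pow_int)
  have MN: "conjg G s m [^] N \<in> M" if s: "s \<in> S1" and m: "m \<in> M" for s m
  proof -
    have sc: "s \<in> carrier G" "s \<in> H" using s S1 Hc by auto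
    let ?K = "{m \<in> D. conjg G s m [^] N \<in> M}"
    have "subgroup ?K G"
    proof
      show "?K \<subseteq> carrier G" using Dc by auto
      show "\<one> \<in> ?K" using sc subgroupD(2)[OF D] subgroupD(2)[OF Ms] by simp
      fix x assume x: "x \<in> ?K"
      have "conjg G s (inv x) [^] N = inv (conjg G s x [^] N)" using x sc by (simp add: conjg_inv Dc nat_pow_inv)
      thus "inv x \<in> ?K" using x subgroupD(4)[OF D] subgroupD(4)[OF Ms] by simp
      fix y assume y: "y \<in> ?K"
      have "conjg G s (x \<otimes> y) [^] N = conjg G s x [^] N \<otimes> conjg G s y [^] N"
        using x y sc by (simp add: conjg_mult Dc distrib cD)
      thus "x \<otimes> y \<in> ?K" using x y subgroupD(5)[OF D] subgroupD(5)[OF Ms] by simp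
    qed
    moreover have "F \<subseteq> ?K"
    proof
      fix a assume a: "a \<in> F"
      hence "conjg G s a \<in> E" using s by (auto simp: E_def)
      thus "a \<in> ?K" using EN a FM M(2) by auto
    qed
    ultimately have "generate G F \<subseteq> ?K" by (rule generate_least)
    thus ?thesis using m F(3) by blast
  qed
  \<comment> \<open>Each conjugation by a letter costs at most one more factor \<open>N\<close>,
    hence the powers \<open>N ^ i\<close>. So \<open>W\<close> is invariant under \<open>H\<close>;
    as it contains \<open>Y\<close>, it is all of \<open>D\<close>.\<close>
  define W where "W = {v \<in> D. \<exists>i. v [^] (N ^ i) \<in> M}"
  have Wmono: "v [^] (N ^ j) \<in> M" if "v [^] (N ^ i) \<in> M" "i \<le> j" "v \<in> D" for v i j
    using powM[OF that(1) _ that(3)] le_imp_power_dvd[OF that(2)] by blast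
  have W: "subgroup W G"
  proof
    show "W \<subseteq> carrier G" using Dc by (auto simp: W_def)
    show "\<one> \<in> W" using subgroupD(2)[OF D] subgroupD(2)[OF Ms] by (auto simp: W_def)
    fix x assume x: "x \<in> W"
    then obtain i where i: "x [^] (N ^ i) \<in> M" "x \<in> D" by (auto simp: W_def)
    have "inv x [^] (N ^ i) \<in> M" using subgroupD(4)[OF Ms i(1)] i by (simp add: nat_pow_inv Dc)
    thus "inv x \<in> W" using i subgroupD(4)[OF D] by (auto simp: W_def)
    fix y assume "y \<in> W"
    then obtain j where j: "y [^] (N ^ j) \<in> M" "y \<in> D" by (auto simp: W_def)
    have "(x \<otimes> y) [^] (N ^ (i + j)) \<in> M"
      unfolding distrib[OF i(2) j(2)] by (intro subgroupD(5)[OF Ms] Wmono[OF i(1)] Wmono[OF j(1)] i j) auto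
    thus "x \<otimes> y \<in> W" using i j subgroupD(5)[OF D] by (auto simp: W_def)
  qed
  have WS: "conjg G s v \<in> W" if "s \<in> S1" "v \<in> W" for s v
  proof -
    obtain i where i: "v [^] (N ^ i) \<in> M" "v \<in> D" using \<open>v \<in> W\<close> by (auto simp: W_def)
    have sc: "s \<in> carrier G" "s \<in> H" using that S1 Hc by auto
    have "conjg G s v [^] (N ^ Suc i) = conjg G s (v [^] (N ^ i)) [^] N"
      using sc i by (simp add: conjg_pow Dc nat_pow_pow mult.commute)
    hence "conjg G s v [^] (N ^ Suc i) \<in> M" using MN[OF that(1) i(1)] by simp
    thus ?thesis unfolding W_def using cD[OF sc(2) i(2)] by blast
  qed
  have nW: "normalizes G H W"
  proof -
    let ?N = "{h \<in> carrier G. \<forall>y\<in>W. conjg G h y \<in> W \<and> conjg G (inv h) y \<in> W}"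
    have "S \<subseteq> ?N" using WS S(2) by (auto simp: S1_def)
    hence "H \<subseteq> ?N" using generate_least[OF normalizer_subgroup[OF subgroupD(1)[OF W]], of S] S(3) by simp
    thus ?thesis by (auto simp: normalizes_def)
  qed
  have YW: "Y \<subseteq> W"
  proof
    fix y assume y: "y \<in> Y"
    have "y [^] (N ^ 1) \<in> M" using EN[of y] y by (simp add: E_def)
    thus "y \<in> W" unfolding W_def using y Y(2) by blast
  qed
  have DW: "D \<subseteq> W" using nclosure_least[OF W nW YW] Y(3) by simp
  have tfn: "v = \<one>" if "v \<in> D" "v [^] n = \<one>" "n > 0" for v and n :: nat
    using tf[of v "int n"] that by (simp add: int_pow_int)
  obtain i0 where i0: "w [^] (N ^ i0) \<in> M" using w(1) DW by (auto simp: W_def)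
  have "w [^] (N ^ i0) \<noteq> \<one>" using tfn[OF w(1), of "N ^ i0"] w(2) N0 by auto
  moreover have "\<forall>x\<in>M. (\<forall>i<k. l i x = 0) \<longrightarrow> x = \<one>" using M(1) unfolding coordinates_def by (elim conjE)
  ultimately obtain i where i: "i < k" "l i (w [^] (N ^ i0)) \<noteq> 0" using i0 by blast
  define z where "z = l i (w [^] (N ^ i0))"
  \<comment> \<open>\<open>p\<close> exceeds both \<open>N\<close> and \<open>|z|\<close>, and
    neither is zero, so it divides neither; but \<open>w = v^p\<close> would make \<open>p\<close>
    divide \<open>N ^ j * z\<close>.\<close>
  obtain p :: nat where p: "Factorial_Ring.prime p" "N + nat \<bar>z\<bar> < p" using bigger_prime by blast
  have "w \<noteq> v [^] p" if v: "v \<in> D" for v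
  proof
    assume wv: "w = v [^] p"
    obtain j where j: "v [^] (N ^ j) \<in> M" using v DW by (auto simp: W_def)
    have "(w [^] (N ^ i0)) [^] (N ^ j) = (v [^] (N ^ j)) [^] (p * N ^ i0)"
      unfolding wv using v by (simp add: nat_pow_pow Dc mult_ac)
    hence "l i ((w [^] (N ^ i0)) [^] (N ^ j)) = l i ((v [^] (N ^ j)) [^] (p * N ^ i0))" by simp
    hence "int (N ^ j) * z = int (p * N ^ i0) * l i (v [^] (N ^ j))"
      unfolding coordinates_nat_pow[OF M(1) i(1) i0] coordinates_nat_pow[OF M(1) i(1) j] z_def .
    hence "int p dvd int N ^ j * z" by simp
    moreover have pp: "Factorial_Ring.prime (int p)" using p(1) by simp
    ultimately have "int p dvd int N \<or> int p dvd z" by (metis prime_dvd_mult_iff prime_dvd_power)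
    thus False
    proof
      assume "int p dvd int N"
      hence "p \<le> N" using N0 by (simp add: dvd_imp_le)
      thus False using p(2) by simp
    next
      assume "int p dvd z"
      hence "int p \<le> \<bar>z\<bar>" using i(2) by (intro zdvd_imp_le) (auto simp: z_def)
      thus False using p(2) by linarith
    qed
  qed
  thus ?thesis using p(1) by (intro exI[of _ p]) (auto simp: prime_gt_0_nat)
qed

text \<open>The conjugates of \<open>d\<close> by powers of \<open>x\<close> repeat modulo
  \<open>M\<close>, so some \<open>x^n\<close> with \<open>1 <= n <= k\<close> fixes
  \<open>d\<close> modulo \<open>M\<close>. The factorial makes the exponent independent of
  \<open>d\<close>.\<close>

lemma commt_power_in_finite_quotient:
  assumes M: "subgroup M G" "M \<subseteq> D" "normalizes G H M" and cov: "covered G D M k"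
    and x: "x \<in> H" and d: "d \<in> D"
  shows "commt G (x [^] (fact k :: nat)) d \<in> M"
proof -
  have xc: "x \<in> carrier G" "d \<in> carrier G" using x d by (auto simp: Hc Dc)
  have xH: "x [^] (i::nat) \<in> H" for i by (rule subgroupD(8)[OF H x])
  have fD: "conjg G (x [^] i) d \<in> D" for i :: nat by (rule stabD(2)[OF stabH[OF xH] d])
  obtain i j where ij: "i < j" "j \<le> k" "inv (conjg G (x [^] i) d) \<otimes> conjg G (x [^] j) d \<in> M"
    using covered_pigeonhole_less[OF cov M(1) subgroupD(1)[OF D], of "\<lambda>i. conjg G (x [^] i) d"] fD by blast
  define n where "n = j - i"
  have xj: "x [^] j = x [^] i \<otimes> x [^] n" using ij xc by (simp add: n_def nat_pow_mult)
  have "inv d \<otimes> conjg G (x [^] n) d = conjg G (inv (x [^] i)) (inv (conjg G (x [^] i) d) \<otimes> conjg G (x [^] j) d)"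
    unfolding xj using xc by (simp add: grp)
  also have "\<dots> \<in> M" by (rule normalizesD[OF M(3) subgroupD(4)[OF H xH] ij(3)])
  finally have "inv d \<otimes> conjg G (x [^] n) d \<in> M" .
  moreover have "inv d \<otimes> conjg G (x [^] n) d = commt G (x [^] n) d"
    using ab[OF subgroupD(4)[OF D d] fD[of n]] xc by (simp add: commt_eq)
  ultimately have 1: "commt G (x [^] n) d \<in> M" by simp
  have sg: "subgroup {y \<in> H. \<forall>z\<in>{d}. commt G y z \<in> M} G"
    by (rule subgroup_commt_left[OF M(1,3) H]) (use xc in simp)
  have "n dvd fact k" using ij by (intro dvd_fact) (auto simp: n_def)
  then obtain q where "fact k = n * q" by blast
  hence "x [^] (fact k :: nat) = (x [^] n) [^] q" using xc by (simp add: nat_pow_pow)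
  moreover have "(x [^] n) [^] q \<in> {y \<in> H. \<forall>z\<in>{d}. commt G y z \<in> M}"
    by (rule subgroupD(8)[OF sg]) (use 1 xH in auto)
  ultimately show ?thesis by auto
qed

end

context group
begin

text \<open>\<open>Hf\<close> is replaced by a power subgroup \<open>H\<close> inside it, and
  \<open>A\<close> by the lower central term \<open>D\<close> of \<open>H\<close>. Both are normal
  in \<open>G\<close>, and \<open>D\<close> is the normal closure in \<open>H\<close> of finitely
  many elements, as the free pair and the choice of a prime require; neither property is known for
  \<open>A\<close>.\<close>

theorem exists_residually_free_words:
  assumes S: "finite S" "S \<subseteq> carrier G" "generate G S = carrier G"
    and pb: "power_bounded G (carrier G) {\<one>}"
    and Hf: "subgroup Hf G" "covered G (carrier G) Hf kf" "lcs G Hf c \<subseteq> A"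
    and comm0: "\<And>x y w. x \<in> Hf \<Longrightarrow> y \<in> Hf \<Longrightarrow> w \<in> A \<Longrightarrow> commt G x y \<otimes> w = w \<otimes> commt G x y"
    and A: "subgroup A G" "\<And>x y. x \<in> A \<Longrightarrow> y \<in> A \<Longrightarrow> x \<otimes> y = y \<otimes> x"
    and tf: "\<And>w (n::int). w \<in> A \<Longrightarrow> n \<noteq> 0 \<Longrightarrow> w [^] n = \<one> \<Longrightarrow> w = \<one>"
    and rank: "\<And>F. finite F \<Longrightarrow> F \<subseteq> A \<Longrightarrow> \<exists>T. finite T \<and> T \<subseteq> A \<and> card T \<le> r \<and> generate G T = generate G F"
    and not_nil: "\<not> (\<exists>V k n. subgroup V G \<and> covered G (carrier G) V k \<and> lcs G V n = {\<one>})"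
  shows "\<exists>a\<in>carrier G. \<exists>u\<in>carrier G. \<forall>cs cs'. length cs = length cs' \<longrightarrow> cs \<noteq> cs' \<longrightarrow>
     (\<exists>m>0. inv (bword G a u cs) \<otimes> bword G a u cs' \<notin> power_subgroup G (carrier G) m)"
proof -
  obtain cc dd where ccdd: "\<forall>m>0. covered G (carrier G) (power_subgroup G (carrier G) m) (cc * m ^ dd)"
    using power_boundedD[OF pb subgroup_self] by blast
  define H where "H = power_subgroup G (carrier G) (fact kf)"
  have H: "subgroup H G" unfolding H_def by (rule power_subgroup_subgroup[OF subgroup_self])
  have HHf: "H \<subseteq> Hf" unfolding H_def
    by (rule power_subgroup_least[OF Hf(1) covered_power[OF Hf(2,1) subgroup_self]])
  obtain k where covH: "covered G (carrier G) H k" unfolding H_def using ccdd by (meson fact_gt_zero)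
  have nH: "normalizes G (carrier G) H"
    unfolding H_def using power_subgroup_normal normal_iff_normalizes power_subgroup_subgroup[OF subgroup_self] by blast
  define D where "D = lcs G H c"
  have Dsub: "subgroup D G" "D \<subseteq> H" "normalizes G H D" unfolding D_def by (rule lcs_props[OF H])+
  have DA: "D \<subseteq> A" using lcs_mono[OF HHf, of c] Hf(3) by (auto simp: D_def)
  have nD: "normalizes G (carrier G) D"
  proof -
    have "normalizes G (carrier G) (lcs G H n)" for n
    proof (induction n)
      case (Suc n)
      have "lcs G H n \<subseteq> carrier G" using subgroupD(1)[OF lcs_subgroup[OF H]] .
      hence c: "x \<in> carrier G" if "x \<in> H \<or> x \<in> lcs G H n" for x using that subgroupD(3)[OF H] by blast
      show ?case unfolding lcs.simps
      proof (rule normalizes_generate[OF subgroup_self])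
        show "{commt G x y |x y. x \<in> H \<and> y \<in> lcs G H n} \<subseteq> carrier G" using c by auto
        fix h s assume h: "h \<in> carrier G" and "s \<in> {commt G x y |x y. x \<in> H \<and> y \<in> lcs G H n}"
        then obtain x y where s: "s = commt G x y" "x \<in> H" "y \<in> lcs G H n" by blast
        have "conjg G h s = commt G (conjg G h x) (conjg G h y)"
          unfolding s(1) using s h c by (intro conjg_commt) auto
        moreover have "conjg G h x \<in> H" "conjg G h y \<in> lcs G H n"
          using s h normalizesD[OF nH] normalizesD[OF Suc] by auto
        ultimately have "conjg G h s \<in> {commt G x y |x y. x \<in> H \<and> y \<in> lcs G H n}" by blast
        thus "conjg G h s \<in> generate G {commt G x y |x y. x \<in> H \<and> y \<in> lcs G H n}" by (rule generate.incl)
      qed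
    qed (simp add: nH)
    thus ?thesis by (simp add: D_def)
  qed
  interpret commuting_action G D H
  proof (intro commuting_action.intro abelian_action.intro abelian_action_axioms.intro commuting_action_axioms.intro)
    show "group G" by (rule is_group)
  qed (use Dsub H A(2) DA comm0 HHf in \<open>auto simp: subset_iff\<close>)
  obtain S' where S': "finite S'" "S' \<subseteq> H" "generate G S' = H"
    using schreier_generate[OF covH H S] by blast
  have S'c: "S' \<subseteq> carrier G" using S'(2) Hc by blast
  define Y where "Y = left_comms G S' c"
  have Y: "finite Y" "D = nclosure G H Y" "Y \<subseteq> D"
    unfolding Y_def D_def
    by (rule finite_left_comms[OF S'(1)], rule lcs_eq_nclosure[OF H S'(3) S'c], rule left_comms_subset[OF S'(2)])
  have tfD: "v = \<one>" if "v \<in> D" "n \<noteq> 0" "v [^] (n::int) = \<one>" for v n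
    using tf that DA by blast
  have rankD: "\<exists>T. finite T \<and> T \<subseteq> D \<and> card T \<le> r \<and> generate G T = generate G F"
    if F: "finite F" "F \<subseteq> D" for F
  proof -
    obtain T where T: "finite T" "card T \<le> r" "generate G T = generate G F"
      using rank[OF F(1)] F(2) DA by blast
    have "generate G F \<subseteq> D" by (rule generate_least[OF D F(2)])
    hence "T \<subseteq> D" using T(3) generate_subset[of T] by blast
    thus ?thesis using T by blast
  qed
  have "\<exists>a\<in>D. \<exists>u\<in>H. \<forall>F. small_poly F \<longrightarrow> poly_act G u F a \<noteq> \<one>"
  proof (rule exists_free_pair[OF S'(1) S'c S'(3) Y(1,3,2) _ tfD])
    show "lcs G H c \<subseteq> D" by (simp add: D_def)
    show "\<not> (\<exists>V k n. subgroup V G \<and> V \<subseteq> H \<and> covered G H V k \<and> lcs G V n = {\<one>})"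
    proof clarify
      fix V k' n assume V: "subgroup V G" "V \<subseteq> H" "covered G H V k'" "lcs G V n = {\<one>}"
      have "covered G (carrier G) V (k * k')"
        by (rule covered_trans[OF covH V(3) order_refl subgroup_self subgroupD(1)[OF H] subgroupD(1)[OF V(1)]])
      thus False using V not_nil by blast
    qed
  qed
  then obtain a u where au: "a \<in> D" "u \<in> H" "\<forall>F. small_poly F \<longrightarrow> poly_act G u F a \<noteq> \<one>" by blast
  have resid: "\<exists>m>0. g \<notin> power_subgroup G (carrier G) m" if g: "g \<in> D" "g \<noteq> \<one>" for g
  proof -
    have "\<exists>p::nat. p > 0 \<and> (\<forall>v\<in>D. g \<noteq> v [^] p)"
      by (rule exists_prime_not_divisible[OF S'(1) S'c S'(3) Y(1,3,2) tfD rankD g])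
    then obtain p :: nat where p: "p > 0" "\<forall>v\<in>D. g \<noteq> v [^] p" by blast
    \<comment> \<open>The \<open>p\<close>-th powers form a normal subgroup that misses
      \<open>g\<close>; finite rank makes its index in \<open>D\<close> finite.\<close>
    define M where "M = (\<lambda>v. v [^] p) ` D"
    have distrib: "(x \<otimes> y) [^] n = x [^] n \<otimes> y [^] n" if "x \<in> D" "y \<in> D" for x y and n :: nat
      using int_pow_distrib[OF that, of "int n"] by (simp add: int_pow_int)
    have M: "subgroup M G"
    proof
      show "M \<subseteq> carrier G" using Dc by (auto simp: M_def)
      have "\<one> = \<one> [^] p" by simp
      thus "\<one> \<in> M" unfolding M_def using subgroupD(2)[OF D] by blast
      fix x assume "x \<in> M"
      then obtain v where v: "v \<in> D" "x = v [^] p" by (auto simp: M_def)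
      have "inv x = (inv v) [^] p" using v by (simp add: nat_pow_inv Dc)
      thus "inv x \<in> M" unfolding M_def using subgroupD(4)[OF D v(1)] by blast
      fix y assume "y \<in> M"
      then obtain v' where v': "v' \<in> D" "y = v' [^] p" by (auto simp: M_def)
      have "x \<otimes> y = (v \<otimes> v') [^] p" using v v' by (simp add: distrib)
      thus "x \<otimes> y \<in> M" unfolding M_def using subgroupD(5)[OF D v(1) v'(1)] by blast
    qed
    have MD: "M \<subseteq> D" using subgroupD(8)[OF D] by (auto simp: M_def)
    have nM: "normalizes G (carrier G) M"
      unfolding normalizes_def M_def using normalizesD[OF nD] by (auto simp: conjg_pow Dc)
    hence Mnormal: "M \<lhd> G" using normal_iff_normalizes[OF M] by blast
    have "power_bounded G D {\<one>}"
    proof (rule power_bounded_abelian[OF triv_subgroup D, of r])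
      show "{\<one>} \<subseteq> D" using subgroupD(2)[OF D] by simp
      fix x y assume "x \<in> D" "y \<in> D"
      thus "commt G x y \<in> {\<one>}" using ab[of x y] by (simp add: commt_def m_assoc Dc)
    next
      fix F assume F: "finite F" "F \<subseteq> D"
      obtain T where T: "finite T" "T \<subseteq> D" "card T \<le> r" "generate G T = generate G F"
        using rankD[OF F] by (elim exE conjE)
      have "F \<subseteq> generate G T" unfolding T(4) by (rule generate_subset)
      moreover have "generate G T \<subseteq> generate G (T \<union> {\<one>})" by (rule mono_generate) auto
      ultimately have "F \<subseteq> generate G (T \<union> {\<one>})" by (rule order.trans)
      thus "\<exists>T\<subseteq>D. finite T \<and> card T \<le> r \<and> F \<subseteq> generate G (T \<union> {\<one>})"
        using T by (intro exI[of _ T] conjI)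
    qed
    then obtain c1 d1 where "\<forall>m>0. \<forall>B. subgroup B G \<and> {\<one>} \<subseteq> B \<and> (\<forall>x\<in>D. x [^] m \<in> B) \<longrightarrow> covered G D B (c1 * m ^ d1)"
      unfolding power_bounded_def by blast
    moreover have "\<forall>x\<in>D. x [^] p \<in> M" by (simp add: M_def)
    ultimately obtain k1 where k1: "covered G D M k1" using p(1) M subgroupD(2)[OF M] by blast
    define e :: nat where "e = fact k * fact k1"
    \<comment> \<open>The centralizer in \<open>H\<close> of \<open>D\<close> modulo
      \<open>M\<close>. It contains all \<open>e\<close>-th powers, hence has finite index. Its
      lower central term at \<open>c\<close> lies in \<open>D\<close>, and one more commutator falls
      into \<open>M\<close>, so the quotient by \<open>M\<close> is virtually nilpotent.\<close>
    define C where "C = {x \<in> H. \<forall>d\<in>D. commt G x d \<in> M}"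
    have nHM: "normalizes G H M" using nM Hc by (auto simp: normalizes_def)
    have C: "subgroup C G" unfolding C_def by (rule subgroup_commt_left[OF M nHM H subgroupD(1)[OF D]])
    have "power_subgroup G (carrier G) e \<subseteq> C"
    proof (rule power_subgroup_least[OF C])
      fix x assume x: "x \<in> carrier G"
      have xH: "x [^] (fact k :: nat) \<in> H" by (rule covered_power[OF covH H subgroup_self x])
      have "x [^] e = (x [^] (fact k :: nat)) [^] (fact k1 :: nat)" using x by (simp add: nat_pow_pow e_def)
      thus "x [^] e \<in> C" unfolding C_def
        using subgroupD(8)[OF H xH] commt_power_in_finite_quotient[OF M MD nHM k1 xH] by auto
    qed
    moreover have "e > 0" by (simp add: e_def)
    ultimately obtain k2 where covC: "covered G (carrier G) C k2" using ccdd covered_mono by blast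
    have CH: "C \<subseteq> H" by (auto simp: C_def)
    have "{commt G x y |x y. x \<in> C \<and> y \<in> lcs G C c} \<subseteq> M"
      using lcs_mono[OF CH, of c] by (auto simp: C_def D_def)
    hence "lcs G C (Suc c) \<subseteq> M" unfolding lcs.simps by (rule generate_least[OF M])
    moreover have "g \<notin> M" using p(2) by (auto simp: M_def)
    ultimately show ?thesis
      using residually_finite_mod[OF Mnormal C covC _ S Dc[OF g(1)]] by blast
  qed
  have uc: "u \<in> carrier G" by (rule Hc[OF au(2)])
  have "\<exists>m>0. inv (bword G a u cs) \<otimes> bword G a u cs' \<notin> power_subgroup G (carrier G) m"
    if cs: "length cs = length cs'" "cs \<noteq> cs'" for cs cs'
  proof -
    define v where "v = poly_act G u (Poly (map of_bool cs') - Poly (map of_bool cs)) a"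
    have v: "v \<in> D" unfolding v_def by (rule poly_act_closed[OF stabH[OF au(2)] au(1)])
    have v1: "v \<noteq> \<one>" unfolding v_def using au(3) small_poly_diff_bool[OF cs] by blast
    define x where "x = inv (u [^] length cs)"
    have x: "x \<in> carrier G" using uc by (simp add: x_def)
    have eq: "inv (bword G a u cs) \<otimes> bword G a u cs' = conjg G x v"
      unfolding x_def v_def by (rule inv_bword_mult_bword[OF stabH[OF au(2)] au(1) cs(1)])
    have "conjg G x v \<noteq> \<one>"
    proof
      assume "conjg G x v = \<one>"
      hence "conjg G (inv x) (conjg G x v) = \<one>" using x by simp
      thus False using x v v1 by (simp add: Dc)
    qed
    thus ?thesis unfolding eq using resid normalizesD[OF nD x v] by blast
  qed
  thus ?thesis using Dc[OF au(1)] uc by blast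
qed

end

section \<open>The structure of the given group\<close>

context group_hom
begin

lemma preimage_subgroup: "subgroup V H \<Longrightarrow> subgroup {x \<in> carrier G. h x \<in> V} G"
  by unfold_locales (auto simp: H.subgroupD)

lemma covered_preimage:
  assumes cov: "covered H (carrier H) V k" and V: "subgroup V H" and surj: "h ` carrier G = carrier H"
  shows "covered G (carrier G) {x \<in> carrier G. h x \<in> V} k"
proof -
  obtain T where T: "finite T" "T \<subseteq> carrier H" "card T \<le> k" "\<forall>x\<in>carrier H. \<exists>t\<in>T. \<exists>b\<in>V. x = t \<otimes>\<^bsub>H\<^esub> b"
    using cov by (rule H.coveredE)
  have "\<forall>t\<in>T. \<exists>s. s \<in> carrier G \<and> h s = t" using T(2) surj by (metis imageE subsetD)
  from bchoice[OF this] obtain \<sigma> where "\<forall>t\<in>T. \<sigma> t \<in> carrier G \<and> h (\<sigma> t) = t" ..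
  hence \<sigma>: "\<sigma> t \<in> carrier G" "h (\<sigma> t) = t" if "t \<in> T" for t using that by auto
  show ?thesis
  proof (rule G.coveredI[of "\<sigma> ` T"])
    show "card (\<sigma> ` T) \<le> k" using T card_image_le[of T \<sigma>] by linarith
    fix x assume x: "x \<in> carrier G"
    obtain t b where tb: "t \<in> T" "b \<in> V" "h x = t \<otimes>\<^bsub>H\<^esub> b"
      using bspec[OF T(4) hom_closed[OF x]] by (elim bexE)
    have c: "b \<in> carrier H" "t \<in> carrier H" using tb T(2) H.subgroupD(3)[OF V] by auto
    have "h (inv \<sigma> t \<otimes> x) = b" using tb x \<sigma>[OF tb(1)] c by simp
    hence "inv \<sigma> t \<otimes> x \<in> {x \<in> carrier G. h x \<in> V}" using x \<sigma>(1)[OF tb(1)] tb(2) by simp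
    moreover have "x = \<sigma> t \<otimes> (inv \<sigma> t \<otimes> x)" using x \<sigma>(1)[OF tb(1)] by simp
    ultimately show "\<exists>t\<in>\<sigma> ` T. \<exists>b\<in>{x \<in> carrier G. h x \<in> V}. x = t \<otimes> b" using tb(1) by blast
  qed (use T \<sigma> in auto)
qed

lemma power_bounded_image:
  assumes pb: "power_bounded G (carrier G) {\<one>}" and surj: "h ` carrier G = carrier H"
  shows "power_bounded H (carrier H) {\<one>\<^bsub>H\<^esub>}"
proof -
  obtain c d where cd: "\<forall>m>0. \<forall>B. subgroup B G \<and> {\<one>} \<subseteq> B \<and> (\<forall>x\<in>carrier G. x [^] m \<in> B) \<longrightarrow> covered G (carrier G) B (c * m ^ d)"
    using pb unfolding power_bounded_def by blast
  show ?thesis unfolding power_bounded_def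
  proof (intro exI allI impI, elim conjE)
    fix m :: nat and B assume m: "m > 0" and B: "subgroup B H" "\<forall>x\<in>carrier H. x [^]\<^bsub>H\<^esub> m \<in> B"
    let ?B = "{x \<in> carrier G. h x \<in> B}"
    have B': "subgroup ?B G" by (rule preimage_subgroup[OF B(1)])
    have "\<forall>x\<in>carrier G. x [^] m \<in> ?B" using B(2) by (simp add: hom_nat_pow)
    moreover have "{\<one>} \<subseteq> ?B" using G.subgroupD(2)[OF B'] by simp
    ultimately have "covered G (carrier G) ?B (c * m ^ d)" using cd m B' by blast
    hence "covered H (h ` carrier G) (h ` ?B) (c * m ^ d)" by (rule covered_image) auto
    thus "covered H (carrier H) B (c * m ^ d)" unfolding surj by (rule H.covered_mono) auto
  qed
qed

lemma hom_bword: "a \<in> carrier G \<Longrightarrow> u \<in> carrier G \<Longrightarrow> bword G a u cs \<in> carrier G \<and> h (bword G a u cs) = bword H (h a) (h u) cs"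
  by (induction cs) auto

end

context group
begin

lemma bword_closed: "a \<in> carrier G \<Longrightarrow> u \<in> carrier G \<Longrightarrow> bword G a u cs \<in> carrier G"
  by (induction cs) auto

text \<open>Unlike \<open>power_bounded_trans\<close> it makes no normality assumption, which suits
  a finite index subgroup such as \<open>H0\<close>.\<close>

lemma power_bounded_trans_finite:
  assumes cov: "covered G U Y k" and pb: "power_bounded G Y Z" and U: "subgroup U G" and Y: "subgroup Y G" "Y \<subseteq> U"
  shows "power_bounded G U Z"
proof -
  obtain c d where cd: "\<forall>m>0. \<forall>B. subgroup B G \<and> Z \<subseteq> B \<and> (\<forall>x\<in>Y. x [^] m \<in> B) \<longrightarrow> covered G Y B (c * m ^ d)"
    using pb unfolding power_bounded_def by blast
  show ?thesis unfolding power_bounded_def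
  proof (intro exI allI impI, elim conjE)
    fix m :: nat and B assume m: "m > 0" and B: "subgroup B G" "Z \<subseteq> B" "\<forall>x\<in>U. x [^] m \<in> B"
    have "covered G Y B (c * m ^ d)" using cd m B Y(2) by blast
    from covered_trans[OF cov this subgroupD(1)[OF U] U Y(2) subgroupD(1)[OF B(1)]]
    show "covered G U B ((k * c) * m ^ d)" by (simp add: mult.assoc)
  qed
qed

section \<open>Upper central series, rank and quotients\<close>

lemma upper_central_props:
  assumes K: "subgroup K G" "normalizes G (carrier G) K"
  shows upper_central_subgroup: "subgroup (hyper G K K i) G"
    and upper_central_subset: "hyper G K K i \<subseteq> K"
    and upper_central_normal: "normalizes G (carrier G) (hyper G K K i)"
    and upper_central_Suc: "hyper G K K i \<subseteq> hyper G K K (Suc i)"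
proof -
  have Kc: "K \<subseteq> carrier G" by (rule subgroupD(1)[OF K(1)])
  have main: "subgroup (hyper G K K i) G \<and> hyper G K K i \<subseteq> K \<and> normalizes G (carrier G) (hyper G K K i)" for i
  proof (induction i)
    case 0
    show ?case using subgroupD(2)[OF K(1)] triv_subgroup by (auto simp: normalizes_def)
  next
    case (Suc i)
    let ?Z = "hyper G K K i"
    have nK: "normalizes G K ?Z" using Suc Kc by (auto simp: normalizes_def)
    have "subgroup (hyper G K K (Suc i)) G"
      unfolding hyper.simps by (rule subgroup_commt_right[OF _ nK K(1) Kc]) (use Suc in blast)
    moreover have "normalizes G (carrier G) (hyper G K K (Suc i))" unfolding normalizes_def
    proof (intro ballI)
      fix h w assume h: "h \<in> carrier G" and w: "w \<in> hyper G K K (Suc i)"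
      have wK: "w \<in> K" "w \<in> carrier G" using w Kc by auto
      have "commt G e (conjg G h w) \<in> ?Z" if e: "e \<in> K" for e
      proof -
        have ec: "e \<in> carrier G" using e Kc by auto
        have e': "conjg G (inv h) e \<in> K" using h e by (intro normalizesD[OF K(2)]) auto
        have "commt G e (conjg G h w) = conjg G h (commt G (conjg G (inv h) e) w)"
          using h ec wK by (simp add: conjg_commt)
        also have "\<dots> \<in> ?Z" using w e' Suc h by (auto intro: normalizesD)
        finally show ?thesis .
      qed
      thus "conjg G h w \<in> hyper G K K (Suc i)" using normalizesD[OF K(2) h wK(1)] by simp
    qed
    ultimately show ?case by auto
  qed
  thus "subgroup (hyper G K K i) G" "hyper G K K i \<subseteq> K" "normalizes G (carrier G) (hyper G K K i)" by auto
  have "commt G e w \<in> hyper G K K i" if "e \<in> K" "w \<in> hyper G K K i" for e w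
  proof -
    have c: "e \<in> carrier G" "w \<in> carrier G" using that main[of i] Kc by auto
    have "conjg G e w \<in> hyper G K K i" using main[of i] that c by (intro normalizesD[of "carrier G"]) auto
    thus ?thesis unfolding commt_eq[OF c] using that main[of i] by (auto intro: subgroupD(4,5))
  qed
  thus "hyper G K K i \<subseteq> hyper G K K (Suc i)" using main[of i] by auto
qed

lemma upper_central_exhausts:
  assumes K: "subgroup K G" "lcs G K n = {\<one>}"
  shows "hyper G K K n = K"
proof -
  have "i \<le> n \<Longrightarrow> lcs G K (n - i) \<subseteq> hyper G K K i" for i
  proof (induction i)
    case (Suc i)
    have n: "n - i = Suc (n - Suc i)" using Suc.prems by simp
    show ?case
    proof
      fix y assume y: "y \<in> lcs G K (n - Suc i)"
      have "commt G e y \<in> hyper G K K i" if "e \<in> K" for e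
        using commt_in_lcs[OF that y] Suc n by auto
      thus "y \<in> hyper G K K (Suc i)" using y lcs_subset[OF K(1)] by auto
    qed
  qed (simp add: K(2))
  from this[of n] have "K \<subseteq> hyper G K K n" by simp
  moreover have "hyper G K K n \<subseteq> K" using subgroupD(2)[OF K(1)] by (cases n) auto
  ultimately show ?thesis by blast
qed

text \<open>Modulo a term two steps below \<open>x\<close>, the element \<open>[g, x]\<close>
  commutes with \<open>x\<close>, so \<open>[g, x^j]\<close> agrees with \<open>[g, x]^j\<close>
  there. Hence a power of \<open>[g, x]\<close> lies in that term, and by induction so does
  \<open>[g, x]\<close> itself.\<close>

lemma upper_central_torsion_free:
  assumes K: "subgroup K G" "normalizes G (carrier G) K"
    and tf: "\<And>x n::nat. x \<in> K \<Longrightarrow> n > 0 \<Longrightarrow> x [^] n = \<one> \<Longrightarrow> x = \<one>"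
  shows "x \<in> hyper G K K (Suc i) \<Longrightarrow> n > 0 \<Longrightarrow> x [^] (n::nat) \<in> hyper G K K i \<Longrightarrow> x \<in> hyper G K K i"
proof (induction i arbitrary: x)
  case 0
  thus ?case using tf[of x n] by auto
next
  case (Suc i)
  let ?Z = "hyper G K K"
  have Z: "subgroup (?Z j) G" "?Z j \<subseteq> K" "normalizes G (carrier G) (?Z j)" for j
    by (intro upper_central_props K)+
  have x: "x \<in> K" "x \<in> carrier G" using Suc.prems(1) subgroupD(3)[OF K(1)] by auto
  have "commt G g x \<in> ?Z i" if g: "g \<in> K" for g
  proof -
    define c where "c = commt G g x"
    have c: "c \<in> ?Z (Suc i)" using Suc.prems(1) g by (simp add: c_def)
    have gc: "g \<in> carrier G" "c \<in> carrier G" using g c subgroupD(3)[OF K(1)] subgroupD(3)[OF Z(1)] by blast+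
    have "\<exists>z\<in>?Z i. commt G g (x [^] j) = z \<otimes> c [^] j" for j :: nat
    proof (induction j)
      case 0
      show ?case by (rule bexI[OF _ subgroupD(2)[OF Z(1)[of i]]]) (use gc in simp)
    next
      case (Suc j)
      then obtain z where z: "z \<in> ?Z i" "commt G g (x [^] j) = z \<otimes> c [^] j" by blast
      define z' where "z' = commt G (x [^] j) c"
      have z': "z' \<in> ?Z i" using c subgroupD(8)[OF K(1) x(1)] by (simp add: z'_def)
      have zc: "z \<in> carrier G" "z' \<in> carrier G" using z z' subgroupD(3)[OF Z(1)] by blast+
      have "commt G g (x [^] Suc j) = commt G g (x [^] j) \<otimes> conjg G (x [^] j) c"
        using x gc by (simp add: commt_mult_right c_def)
      also have "\<dots> = (z \<otimes> c [^] j) \<otimes> (z' \<otimes> c)"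
        using x gc by (simp add: z conjg_eq z'_def)
      also have "\<dots> = (z \<otimes> conjg G (c [^] j) z') \<otimes> c [^] Suc j"
        using zc gc by (simp add: grp)
      finally have "commt G g (x [^] Suc j) = (z \<otimes> conjg G (c [^] j) z') \<otimes> c [^] Suc j" .
      moreover have "z \<otimes> conjg G (c [^] j) z' \<in> ?Z i"
        using gc by (intro subgroupD(5)[OF Z(1)] normalizesD[OF Z(3)] z z') auto
      ultimately show ?case by blast
    qed
    then obtain z where z: "z \<in> ?Z i" "commt G g (x [^] n) = z \<otimes> c [^] n" by blast
    have "commt G g (x [^] n) \<in> ?Z i" using Suc.prems(3) g by simp
    hence "c [^] n \<in> ?Z i" using subgroup_mult_cancel_left[OF Z(1) z(1)] z(2) gc by simp
    hence "c \<in> ?Z i" using Suc.IH[OF c Suc.prems(2)] by simp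
    thus ?thesis by (simp add: c_def)
  qed
  thus ?case using x by simp
qed

lemma prufer_rank_generate:
  assumes K: "subgroup K G" and r: "prufer_rank (G\<lparr>carrier := K\<rparr>) < \<infinity>"
  shows "\<exists>r. \<forall>F. finite F \<longrightarrow> F \<subseteq> K \<longrightarrow> (\<exists>T. finite T \<and> T \<subseteq> K \<and> card T \<le> r \<and> generate G T = generate G F)"
proof -
  let ?K = "G\<lparr>carrier := K\<rparr>"
  define P where "P \<rho> \<longleftrightarrow> (\<forall>H. subgroup H ?K \<and> finitely_generated (?K\<lparr>carrier := H\<rparr>) \<longrightarrow>
     (\<exists>T. finite T \<and> enat (card T) \<le> \<rho> \<and> generating_set (?K\<lparr>carrier := H\<rparr>) T))" for \<rho>
  \<comment> \<open>The value infinity always satisfies the condition, so the least value satisfies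
    it too; being finite, it is the number sought.\<close>
  have "P \<infinity>" unfolding P_def finitely_generated_def by auto
  hence P: "P (prufer_rank ?K)" unfolding prufer_rank_def P_def[symmetric] by (rule LeastI)
  obtain n where n: "prufer_rank ?K = enat n" using r by auto
  show ?thesis
  proof (intro exI[of _ n] allI impI)
    fix F assume F: "finite F" "F \<subseteq> K"
    have Kc: "K \<subseteq> carrier G" by (rule subgroupD(1)[OF K])
    define V where "V = generate G F"
    have V: "subgroup V G" unfolding V_def using F Kc by (intro generate_subgroup) auto
    have VK: "V \<subseteq> K" unfolding V_def by (rule generate_least[OF K F(2)])
    have FV: "F \<subseteq> V" unfolding V_def by (rule generate_subset)
    have 1: "subgroup V ?K" using subgroup_incl[OF V K VK] .
    have "generate (G\<lparr>carrier := V\<rparr>) F = V" using generate_consistent[OF FV V] by (simp add: V_def)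
    hence 2: "finitely_generated (?K\<lparr>carrier := V\<rparr>)"
      unfolding finitely_generated_def generating_set_def using F(1) FV subgroup_imp_group[OF V] by auto
    obtain T where T: "finite T" "card T \<le> n" "generating_set (?K\<lparr>carrier := V\<rparr>) T"
      using P 1 2 unfolding P_def n by auto
    have TV: "T \<subseteq> V" "generate (G\<lparr>carrier := V\<rparr>) T = V" using T(3) by (auto simp: generating_set_def)
    have "generate G T = V" using generate_consistent[OF TV(1) V] TV(2) by simp
    thus "\<exists>T. finite T \<and> T \<subseteq> K \<and> card T \<le> n \<and> generate G T = generate G F"
      using T TV VK unfolding V_def by blast
  qed
qed

lemma mod_hom:
  assumes N: "N \<lhd> G"
  shows "group_hom G (G Mod N) (\<lambda>x. N #> x)"
    and "(\<lambda>x. N #> x) ` carrier G = carrier (G Mod N)"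
    and "x \<in> carrier G \<Longrightarrow> N #> x = \<one>\<^bsub>G Mod N\<^esub> \<longleftrightarrow> x \<in> N"
proof -
  interpret Q: group "G Mod N" by (rule normal.factorgroup_is_group[OF N])
  show "group_hom G (G Mod N) (\<lambda>x. N #> x)"
    by unfold_locales (rule normal.r_coset_hom_Mod[OF N])
  show "(\<lambda>x. N #> x) ` carrier G = carrier (G Mod N)" by (auto simp: FactGroup_def RCOSETS_def)
  have Nsub: "subgroup N G" using N by (rule normal_imp_subgroup)
  have "\<one>\<^bsub>G Mod N\<^esub> = N" by (simp add: FactGroup_def)
  thus "x \<in> carrier G \<Longrightarrow> N #> x = \<one>\<^bsub>G Mod N\<^esub> \<longleftrightarrow> x \<in> N"
    using coset_join1[of N x] coset_join2[of x N] subgroupD(1)[OF Nsub] Nsub by metis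
qed

end

section \<open>Data extracted from an M-group\<close>

text \<open>\<open>H0\<close> is the preimage of an abelian finite index subgroup of the quotient by
  \<open>K\<close>. Index, rank and nilpotency enter as the numbers \<open>k0\<close>,
  \<open>r\<close> and \<open>c\<close>.\<close>

locale M_group_data = group +
  fixes K H0 :: "'a set" and S0 :: "'a set" and k0 r c :: nat
  assumes S0: "finite S0" "S0 \<subseteq> carrier G" "generate G S0 = carrier G"
    and K: "subgroup K G" "normalizes G (carrier G) K" "lcs G K c = {\<one>}"
    and tf: "x \<in> K \<Longrightarrow> n > 0 \<Longrightarrow> x [^] (n::nat) = \<one> \<Longrightarrow> x = \<one>"
    and rank: "finite F \<Longrightarrow> F \<subseteq> K \<Longrightarrow> \<exists>T. finite T \<and> T \<subseteq> K \<and> card T \<le> r \<and> generate G T = generate G F"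
    and H0: "subgroup H0 G" "K \<subseteq> H0" "covered G (carrier G) H0 k0"
    and H0K: "x \<in> H0 \<Longrightarrow> y \<in> H0 \<Longrightarrow> commt G x y \<in> K"
begin

abbreviation "Z \<equiv> hyper G K K"

lemma Z: "subgroup (Z i) G" "Z i \<subseteq> K" "normalizes G (carrier G) (Z i)" "Z i \<subseteq> Z (Suc i)" "Z c = K"
  using upper_central_props[OF K(1,2)] upper_central_exhausts[OF K(1,3)] by auto

lemma Z_torsion_free: "y \<in> Z (Suc j) \<Longrightarrow> m > 0 \<Longrightarrow> y [^] (m::nat) \<in> Z j \<Longrightarrow> y \<in> Z j"
  by (rule upper_central_torsion_free[OF K(1,2)]) (rule tf)

lemma rank_subgroup:
  assumes "subgroup A G" "A \<subseteq> K" "finite F" "F \<subseteq> A"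
  shows "\<exists>T. finite T \<and> T \<subseteq> A \<and> card T \<le> r \<and> generate G T = generate G F"
proof -
  obtain T where T: "finite T" "card T \<le> r" "generate G T = generate G F"
    using rank[OF assms(3) order.trans[OF assms(4,2)]] by (elim exE conjE)
  have "generate G F \<subseteq> A" by (rule generate_least[OF assms(1,4)])
  hence "T \<subseteq> A" using T(3) generate_subset[of T] by simp
  thus ?thesis using T by blast
qed

text \<open>Three layers: the upper central factors of \<open>K\<close> are abelian of bounded rank,
  \<open>H0\<close> modulo \<open>K\<close> is abelian and finitely generated by Schreier's lemma,
  and \<open>H0\<close> has finite index.\<close>

lemma power_bounded_carrier: "power_bounded G (carrier G) {\<one>}"
proof -
  have "power_bounded G (Z i) {\<one>}" for i
  proof (induction i)
    case 0
    have "covered G {\<one>} {\<one>} 1" by (rule coveredI[of "{\<one>}"]) auto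
    thus ?case using power_bounded_finite by simp
  next
    case (Suc i)
    have "power_bounded G (Z (Suc i)) (Z i)"
    proof (rule power_bounded_abelian[OF Z(1) Z(1) Z(4), of _ r])
      fix x y assume "x \<in> Z (Suc i)" "y \<in> Z (Suc i)"
      thus "commt G x y \<in> Z i" by auto
    next
      fix F assume F: "finite F" "F \<subseteq> Z (Suc i)"
      obtain T where T: "finite T" "T \<subseteq> Z (Suc i)" "card T \<le> r" "generate G T = generate G F"
        using rank_subgroup[OF Z(1) Z(2) F] by (elim exE conjE)
      have "F \<subseteq> generate G T" unfolding T(4) by (rule generate_subset)
      moreover have "generate G T \<subseteq> generate G (T \<union> Z i)" by (rule mono_generate) auto
      ultimately have "F \<subseteq> generate G (T \<union> Z i)" by (rule order.trans)
      thus "\<exists>T\<subseteq>Z (Suc i). finite T \<and> card T \<le> r \<and> F \<subseteq> generate G (T \<union> Z i)"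
        using T by (intro exI[of _ T] conjI)
    qed
    moreover have "normalizes G (Z (Suc i)) (Z i)"
      using Z(3)[of i] subgroupD(1)[OF Z(1)[of "Suc i"]] by (auto simp: normalizes_def simp del: hyper.simps)
    ultimately show ?case using subgroupD(2)[OF Z(1)[of i]]
      by (intro power_bounded_trans[OF Z(1) Z(1) Z(4) _ _ _ Suc]) auto
  qed
  hence pbK: "power_bounded G K {\<one>}" using Z(5) by metis
  obtain S' where S': "finite S'" "S' \<subseteq> H0" "generate G S' = H0"
    using schreier_generate[OF H0(3,1) S0] by blast
  have "power_bounded G H0 K"
  proof (rule power_bounded_abelian[OF K(1) H0(1,2) H0K, of "card S'"])
    fix F assume F: "finite F" "F \<subseteq> H0"
    have "H0 \<subseteq> generate G (S' \<union> K)" unfolding S'(3)[symmetric] by (rule mono_generate) auto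
    thus "\<exists>T\<subseteq>H0. finite T \<and> card T \<le> card S' \<and> F \<subseteq> generate G (T \<union> K)"
      using S' F by (intro exI[of _ S']) auto
  qed
  moreover have "normalizes G H0 K" using K(2) subgroupD(1)[OF H0(1)] by (auto simp: normalizes_def)
  ultimately have "power_bounded G H0 {\<one>}"
    using subgroupD(2)[OF K(1)] by (intro power_bounded_trans[OF K(1) H0(1,2) _ _ _ pbK]) auto
  thus ?thesis by (rule power_bounded_trans_finite[OF H0(3) _ subgroup_self H0(1) subgroupD(1)[OF H0(1)]])
qed

text \<open>Virtual nilpotency holds modulo \<open>Z (Suc i)\<close> but fails modulo
  \<open>Z i\<close>. Intersecting a witness for the former with \<open>H0\<close> puts its
  commutators into \<open>K\<close>, and \<open>K\<close> centralizes \<open>Z (Suc i)\<close>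
  modulo \<open>Z i\<close>. This gives the commuting action in the quotient.\<close>

lemma exists_residually_free_words_M_group:
  assumes not_nil: "\<not> (\<exists>V k n. subgroup V G \<and> covered G (carrier G) V k \<and> lcs G V n = {\<one>})"
  shows "\<exists>a\<in>carrier G. \<exists>u\<in>carrier G. \<forall>cs cs'. length cs = length cs' \<longrightarrow> cs \<noteq> cs' \<longrightarrow>
     (\<exists>m>0. inv (bword G a u cs) \<otimes> bword G a u cs' \<notin> power_subgroup G (carrier G) m)"
proof -
  define VN where "VN i \<longleftrightarrow> (\<exists>V k n. subgroup V G \<and> covered G (carrier G) V k \<and> lcs G V n \<subseteq> Z i)" for i
  have "lcs G H0 (Suc 0) \<subseteq> K" unfolding lcs.simps using H0K by (intro generate_least[OF K(1)]) auto
  hence "VN c" unfolding VN_def Z(5) using H0 by blast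
  moreover have "\<not> VN 0"
  proof
    assume "VN 0"
    then obtain V k n where V: "subgroup V G" "covered G (carrier G) V k" "lcs G V n \<subseteq> {\<one>}" by (auto simp: VN_def)
    hence "lcs G V n = {\<one>}" using subgroupD(2)[OF lcs_subgroup[OF V(1)]] by blast
    thus False using V not_nil by blast
  qed
  ultimately obtain i where i: "\<not> VN i" "VN (Suc i)"
    using ex_least_nat_less[of VN c] by blast
  obtain V1 k1 n1 where V1: "subgroup V1 G" "covered G (carrier G) V1 k1" "lcs G V1 n1 \<subseteq> Z (Suc i)"
    using i(2) unfolding VN_def by blast
  define N where "N = Z i"
  have N: "N \<lhd> G" using normal_iff_normalizes[OF Z(1)] Z(3) by (simp add: N_def)
  define Q where "Q = G Mod N"
  define h where "h = (\<lambda>x. N #> x)"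
  interpret h: group_hom G Q h unfolding Q_def h_def by (rule mod_hom(1)[OF N])
  have surj: "h ` carrier G = carrier Q" unfolding Q_def h_def by (rule mod_hom(2)[OF N])
  have h1: "h x = \<one>\<^bsub>Q\<^esub> \<longleftrightarrow> x \<in> N" if "x \<in> carrier G" for x
    unfolding Q_def h_def by (rule mod_hom(3)[OF N that])
  have hcomm: "h x \<otimes>\<^bsub>Q\<^esub> h y = h y \<otimes>\<^bsub>Q\<^esub> h x" if "x \<in> carrier G" "y \<in> carrier G" "commt G x y \<in> N" for x y
  proof -
    have "x \<otimes> y = commt G x y \<otimes> (y \<otimes> x)" using that by (simp add: grp)
    hence "h (x \<otimes> y) = h (commt G x y) \<otimes>\<^bsub>Q\<^esub> h (y \<otimes> x)" using that by (metis commt_closed h.hom_mult m_closed)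
    thus ?thesis using that h1[of "commt G x y"] by simp
  qed
  define A where "A = Z (Suc i)"
  have A: "subgroup A G" "A \<subseteq> K" unfolding A_def by (rule Z)+
  have Kc: "K \<subseteq> carrier G" by (rule subgroupD(1)[OF K(1)])
  define H1 where "H1 = V1 \<inter> H0"
  have H1: "subgroup H1 G" unfolding H1_def using V1(1) H0(1) by (rule subgroups_Inter_pair)
  have covH1: "covered G (carrier G) H1 (k1 * k0)" unfolding H1_def
    by (rule covered_Int[OF V1(2) H0(3) V1(1) H0(1)]) simp
  have H1c: "H1 \<subseteq> carrier G" by (rule subgroupD(1)[OF H1])
  have "\<exists>a\<in>carrier Q. \<exists>u\<in>carrier Q. \<forall>cs cs'. length cs = length cs' \<longrightarrow> cs \<noteq> cs' \<longrightarrow>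
     (\<exists>m>0. inv\<^bsub>Q\<^esub> (bword Q a u cs) \<otimes>\<^bsub>Q\<^esub> bword Q a u cs' \<notin> power_subgroup Q (carrier Q) m)"
  proof (rule h.H.exists_residually_free_words[where S = "h ` S0" and Hf = "h ` H1" and A = "h ` A" and r = r])
    show "finite (h ` S0)" "h ` S0 \<subseteq> carrier Q" using S0 by auto
    show "generate Q (h ` S0) = carrier Q" using h.generate_img[OF S0(2)] S0(3) surj by simp
    show "power_bounded Q (carrier Q) {\<one>\<^bsub>Q\<^esub>}" by (rule h.power_bounded_image[OF power_bounded_carrier surj])
    show "subgroup (h ` H1) Q" "subgroup (h ` A) Q" by (intro h.subgroup_img_is_subgroup H1 A)+
    show "covered Q (carrier Q) (h ` H1) (k1 * k0)" using h.covered_image[OF covH1 order_refl H1c] by (simp add: surj)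
    have "lcs G H1 n1 \<subseteq> A" using lcs_mono[of H1 V1 n1] V1(3) by (auto simp: H1_def A_def simp del: hyper.simps)
    thus "lcs Q (h ` H1) n1 \<subseteq> h ` A" unfolding h.lcs_image[OF H1, symmetric] by blast
  next
    fix x y w assume "x \<in> h ` H1" "y \<in> h ` H1" "w \<in> h ` A"
    then obtain x' y' w' where xyw: "x = h x'" "y = h y'" "w = h w'" "x' \<in> H1" "y' \<in> H1" "w' \<in> A" by blast
    have c: "x' \<in> carrier G" "y' \<in> carrier G" "w' \<in> carrier G" using xyw H1c A Kc by auto
    have "commt G x' y' \<in> K" using xyw by (intro H0K) (auto simp: H1_def)
    hence "commt G (commt G x' y') w' \<in> N" using xyw(6) by (simp add: A_def N_def)
    from hcomm[OF _ c(3) this] show "commt Q x y \<otimes>\<^bsub>Q\<^esub> w = w \<otimes>\<^bsub>Q\<^esub> commt Q x y"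
      using c by (simp add: xyw flip: h.hom_commt)
  next
    fix x y assume "x \<in> h ` A" "y \<in> h ` A"
    then obtain x' y' where xy: "x = h x'" "y = h y'" "x' \<in> A" "y' \<in> A" by blast
    have "commt G x' y' \<in> N" using xy A(2) by (auto simp: A_def N_def)
    thus "x \<otimes>\<^bsub>Q\<^esub> y = y \<otimes>\<^bsub>Q\<^esub> x" unfolding xy using xy A Kc by (intro hcomm) auto
  next
    fix w and n :: int assume "w \<in> h ` A" and n: "n \<noteq> 0" "w [^]\<^bsub>Q\<^esub> n = \<one>\<^bsub>Q\<^esub>"
    then obtain x where x: "w = h x" "x \<in> A" by blast
    have xc: "x \<in> carrier G" using x A Kc by auto
    have "h (x [^] n) = \<one>\<^bsub>Q\<^esub>" using n x xc by (simp add: h.hom_int_pow)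
    hence xn: "x [^] n \<in> N" using h1[of "x [^] n"] xc by simp
    have Ns: "subgroup N G" using Z(1) by (simp add: N_def)
    have "x [^] nat \<bar>n\<bar> \<in> N"
    proof (cases "n > 0")
      case True
      thus ?thesis using xn by (simp flip: int_pow_int)
    next
      case False
      have "x [^] (- n) \<in> N" using subgroupD(4)[OF Ns xn] xc by (simp add: int_pow_neg)
      thus ?thesis using False by (simp flip: int_pow_int)
    qed
    hence xi: "x [^] nat \<bar>n\<bar> \<in> Z i" by (simp only: N_def)
    have xS: "x \<in> Z (Suc i)" using x(2) by (simp only: A_def)
    have "nat \<bar>n\<bar> > 0" using n(1) by simp
    from Z_torsion_free[OF xS this xi] have "x \<in> Z i" .
    hence "x \<in> N" by (simp only: N_def)
    thus "w = \<one>\<^bsub>Q\<^esub>" using h1 xc x by simp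
  next
    fix F assume F: "finite F" "F \<subseteq> h ` A"
    obtain F' where F': "F' \<subseteq> A" "finite F'" "F = h ` F'" using finite_subset_image[OF F] by blast
    obtain T where T: "finite T" "T \<subseteq> A" "card T \<le> r" "generate G T = generate G F'"
      using rank_subgroup[OF A F'(2,1)] by (elim exE conjE)
    have c: "T \<subseteq> carrier G" "F' \<subseteq> carrier G" using T F' A Kc by auto
    have "generate Q (h ` T) = generate Q F"
      using h.generate_img[OF c(1)] h.generate_img[OF c(2)] T(4) F'(3) by simp
    moreover have "card (h ` T) \<le> r" using card_image_le[OF T(1), of h] T(3) by linarith
    ultimately show "\<exists>T. finite T \<and> T \<subseteq> h ` A \<and> card T \<le> r \<and> generate Q T = generate Q F"
      using T by (intro exI[of _ "h ` T"]) auto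
  next
    show "\<not> (\<exists>V k n. subgroup V Q \<and> covered Q (carrier Q) V k \<and> lcs Q V n = {\<one>\<^bsub>Q\<^esub>})"
    proof clarify
      fix V k n assume V: "subgroup V Q" "covered Q (carrier Q) V k" "lcs Q V n = {\<one>\<^bsub>Q\<^esub>}"
      define V' where "V' = {x \<in> carrier G. h x \<in> V}"
      have V': "subgroup V' G" unfolding V'_def by (rule h.preimage_subgroup[OF V(1)])
      have cV': "covered G (carrier G) V' k" unfolding V'_def by (rule h.covered_preimage[OF V(2,1) surj])
      have "h ` V' \<subseteq> V" by (auto simp: V'_def)
      hence "h ` lcs G V' n \<subseteq> {\<one>\<^bsub>Q\<^esub>}"
        using h.H.lcs_mono[of "h ` V'" V n] V(3) h.lcs_image[OF V'] by simp
      have "lcs G V' n \<subseteq> N"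
      proof
        fix x assume x: "x \<in> lcs G V' n"
        have "x \<in> carrier G" by (rule subgroupD(3)[OF lcs_subgroup[OF V'] x])
        moreover have "h x = \<one>\<^bsub>Q\<^esub>" using \<open>h ` lcs G V' n \<subseteq> _\<close> x by auto
        ultimately show "x \<in> N" using h1 by simp
      qed
      hence "VN i" unfolding VN_def N_def using V' cV' by blast
      thus False using i(1) by blast
    qed
  qed
  then obtain a' u' where au': "a' \<in> carrier Q" "u' \<in> carrier Q"
    "\<forall>cs cs'. length cs = length cs' \<longrightarrow> cs \<noteq> cs' \<longrightarrow>
     (\<exists>m>0. inv\<^bsub>Q\<^esub> (bword Q a' u' cs) \<otimes>\<^bsub>Q\<^esub> bword Q a' u' cs' \<notin> power_subgroup Q (carrier Q) m)" by blast
  obtain a u where au: "a \<in> carrier G" "u \<in> carrier G" "h a = a'" "h u = u'" using au'(1,2) surj by (metis imageE)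
  have "\<exists>m>0. inv (bword G a u cs) \<otimes> bword G a u cs' \<notin> power_subgroup G (carrier G) m"
    if cs: "length cs = length cs'" "cs \<noteq> cs'" for cs cs'
  proof -
    obtain m where m: "m > 0" "inv\<^bsub>Q\<^esub> (bword Q a' u' cs) \<otimes>\<^bsub>Q\<^esub> bword Q a' u' cs' \<notin> power_subgroup Q (carrier Q) m"
      using au'(3) cs by blast
    have "h (inv (bword G a u cs) \<otimes> bword G a u cs') = inv\<^bsub>Q\<^esub> (bword Q a' u' cs) \<otimes>\<^bsub>Q\<^esub> bword Q a' u' cs'"
      using h.hom_bword[OF au(1,2), of cs] h.hom_bword[OF au(1,2), of cs'] au(3,4) by simp
    thus ?thesis using m h.power_subgroup_image by metis
  qed
  thus ?thesis using au(1,2) by blast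
qed

end

section \<open>Residual finiteness growth\<close>

context group
begin

lemma sphere_iff_word:
  "g \<in> sphere G S n \<longleftrightarrow> (\<exists>ws. length ws = n \<and> set ws \<subseteq> S \<and> foldr (\<lambda>x y. x \<otimes> y) ws \<one> = g)"
proof (induction n arbitrary: g)
  case (Suc n)
  have "g \<in> sphere G S (Suc n) \<longleftrightarrow> (\<exists>s\<in>S. \<exists>ws. length ws = n \<and> set ws \<subseteq> S \<and> g = s \<otimes> foldr (\<lambda>x y. x \<otimes> y) ws \<one>)"
    using Suc by auto
  also have "\<dots> \<longleftrightarrow> (\<exists>ws. length ws = Suc n \<and> set ws \<subseteq> S \<and> foldr (\<lambda>x y. x \<otimes> y) ws \<one> = g)"
  proof
    assume "\<exists>s\<in>S. \<exists>ws. length ws = n \<and> set ws \<subseteq> S \<and> g = s \<otimes> foldr (\<lambda>x y. x \<otimes> y) ws \<one>"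
    then obtain s ws where "s \<in> S" "length ws = n" "set ws \<subseteq> S" "g = s \<otimes> foldr (\<lambda>x y. x \<otimes> y) ws \<one>" by blast
    thus "\<exists>ws. length ws = Suc n \<and> set ws \<subseteq> S \<and> foldr (\<lambda>x y. x \<otimes> y) ws \<one> = g"
      by (intro exI[of _ "s # ws"]) auto
  next
    assume "\<exists>ws. length ws = Suc n \<and> set ws \<subseteq> S \<and> foldr (\<lambda>x y. x \<otimes> y) ws \<one> = g"
    then obtain ws where ws: "length ws = Suc n" "set ws \<subseteq> S" "foldr (\<lambda>x y. x \<otimes> y) ws \<one> = g" by blast
    then obtain s ws' where "ws = s # ws'" by (cases ws) auto
    thus "\<exists>s\<in>S. \<exists>ws. length ws = n \<and> set ws \<subseteq> S \<and> g = s \<otimes> foldr (\<lambda>x y. x \<otimes> y) ws \<one>"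
      using ws by auto
  qed
  finally show ?case .
qed auto

lemma word_norm_sphere: "word_norm G S g = (LEAST n. g \<in> sphere G (S \<union> (\<lambda>s. inv s) ` S) n)"
  unfolding word_norm_def sphere_iff_word ..

lemma word_norm_le: "g \<in> sphere G (S \<union> (\<lambda>s. inv s) ` S) n \<Longrightarrow> word_norm G S g \<le> n"
  unfolding word_norm_sphere by (rule Least_le)

lemma in_sphere_word_norm:
  assumes "S \<subseteq> carrier G" "generate G S = carrier G" "g \<in> carrier G"
  shows "g \<in> sphere G (S \<union> (\<lambda>s. inv s) ` S) (word_norm G S g)"
proof -
  have "\<exists>n. g \<in> sphere G (S \<union> (\<lambda>s. inv s) ` S) n" using generate_eq_spheres[OF assms(1)] assms(2,3) by auto
  thus ?thesis unfolding word_norm_sphere by (rule LeastI_ex)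
qed

lemma finite_sphere: "finite S \<Longrightarrow> finite (sphere G S n)"
proof (induction n)
  case (Suc n)
  have "sphere G S (Suc n) = (\<lambda>(s, g). s \<otimes> g) ` (S \<times> sphere G S n)" by auto
  thus ?case using Suc by simp
qed simp

lemma finite_word_ball:
  assumes S: "finite S" "S \<subseteq> carrier G" "generate G S = carrier G"
  shows "finite (word_ball G S r)"
proof (rule finite_subset)
  show "finite (\<Union>n\<le>nat \<lfloor>r\<rfloor>. sphere G (S \<union> (\<lambda>s. inv s) ` S) n)"
    using S(1) by (intro finite_UN_I finite_sphere) auto
  show "word_ball G S r \<subseteq> (\<Union>n\<le>nat \<lfloor>r\<rfloor>. sphere G (S \<union> (\<lambda>s. inv s) ` S) n)"
  proof
    fix g assume g: "g \<in> word_ball G S r"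
    hence "real (word_norm G S g) \<le> r" "g \<in> carrier G" by (auto simp: word_ball_def)
    hence "word_norm G S g \<le> nat \<lfloor>r\<rfloor>" "g \<in> sphere G (S \<union> (\<lambda>s. inv s) ` S) (word_norm G S g)"
      using in_sphere_word_norm[OF S(2,3)] by (auto simp: le_nat_floor)
    thus "g \<in> (\<Union>n\<le>nat \<lfloor>r\<rfloor>. sphere G (S \<union> (\<lambda>s. inv s) ` S) n)" by blast
  qed
qed

lemma RF_ge:
  assumes S: "finite S" "S \<subseteq> carrier G" "generate G S = carrier G"
    and g: "g \<in> carrier G" "g \<noteq> \<one>" "real (word_norm G S g) \<le> r"
  shows "real (div_index G g) \<le> RF G S r"
  unfolding RF_def of_nat_le_iff
  using finite_word_ball[OF S, of r] g by (intro Max_ge) (auto simp: word_ball_def)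

lemma RF_le:
  assumes S: "finite S" "S \<subseteq> carrier G" "generate G S = carrier G"
    and b: "0 \<le> b" "\<And>g. g \<in> carrier G \<Longrightarrow> g \<noteq> \<one> \<Longrightarrow> real (word_norm G S g) \<le> r \<Longrightarrow> real (div_index G g) \<le> b"
  shows "RF G S r \<le> b"
proof -
  let ?A = "insert 0 (div_index G ` (word_ball G S r - {\<one>}))"
  have "finite ?A" using finite_word_ball[OF S] by simp
  hence "Max ?A \<in> ?A" by (rule Max_in) simp
  moreover define \<mu> where "\<mu> = Max ?A"
  ultimately have "\<mu> \<in> ?A" by (simp only:)
  then consider "\<mu> = 0" | g where "g \<in> word_ball G S r" "g \<noteq> \<one>" "\<mu> = div_index G g" by blast
  thus ?thesis
  proof cases
    case (2 g)
    thus ?thesis unfolding RF_def \<mu>_def[symmetric] using b(2)[of g] by (simp add: word_ball_def)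
  qed (simp add: RF_def b(1) flip: \<mu>_def)
qed

lemma div_index_le:
  assumes "power_subgroup G (carrier G) m = N" "g \<notin> N" "covered G (carrier G) N k"
  shows "div_index G g \<le> k"
proof -
  have N: "N \<lhd> G" "subgroup N G"
    using power_subgroup_normal power_subgroup_subgroup[OF subgroup_self] assms(1) by blast+
  have "div_index G g \<le> card (rcosets N)" unfolding div_index_def
    using N finite_index_if_covered(1)[OF assms(3) N(2)] assms(2) by (intro Least_le) blast
  thus ?thesis using finite_index_if_covered(2)[OF assms(3) N(2)] by linarith
qed

lemma power_card_in_normal:
  assumes N: "N \<lhd> G" and x: "x \<in> carrier G"
  shows "x [^] card (rcosets N) \<in> N"
proof -
  interpret Q: group "G Mod N" by (rule normal.factorgroup_is_group[OF N])
  interpret h: group_hom G "G Mod N" "\<lambda>x. N #> x" by (rule mod_hom(1)[OF N])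
  have "Coset.order (G Mod N) = card (rcosets N)" by (simp add: Coset.order_def FactGroup_def)
  hence "(N #> x) [^]\<^bsub>G Mod N\<^esub> card (rcosets N) = \<one>\<^bsub>G Mod N\<^esub>"
    using Q.pow_order_eq_1[OF h.hom_closed[OF x]] by simp
  hence "N #> (x [^] card (rcosets N)) = \<one>\<^bsub>G Mod N\<^esub>" using h.hom_nat_pow[OF x] by simp
  thus ?thesis using mod_hom(3)[OF N] x by simp
qed

text \<open>The power subgroup for \<open>m\<close> shows that some normal subgroup of finite index
  misses \<open>g\<close>, so the minimum defining \<open>div_index\<close> is attained. A subgroup
  attaining it with index at most \<open>s\<close> would contain all powers with exponent
  \<open>Lcm {1..s}\<close>, hence \<open>g\<close>.\<close>

lemma div_index_gt:
  assumes m: "m > 0" "g \<notin> power_subgroup G (carrier G) m" "covered G (carrier G) (power_subgroup G (carrier G) m) k"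
    and g: "g \<in> power_subgroup G (carrier G) (Lcm {1..s})"
  shows "s < div_index G g"
proof (rule ccontr)
  assume "\<not> s < div_index G g"
  define P where "P d \<longleftrightarrow> (\<exists>N. N \<lhd> G \<and> finite_index G N \<and> g \<notin> N \<and> d = card (rcosets N))" for d
  have "\<exists>d. P d" unfolding P_def
    using power_subgroup_normal m finite_index_if_covered(1)[OF m(3) power_subgroup_subgroup[OF subgroup_self]] by blast
  hence "P (div_index G g)" unfolding div_index_def P_def[symmetric] by (rule LeastI_ex)
  then obtain N where N: "N \<lhd> G" "finite_index G N" "g \<notin> N" "div_index G g = card (rcosets N)" by (auto simp: P_def)
  have sN: "subgroup N G" by (rule normal_imp_subgroup[OF N(1)])
  have "N \<in> rcosets N" using coset_join2[OF one_closed sN subgroupD(2)[OF sN]] by (auto simp: RCOSETS_def)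
  hence "card (rcosets N) > 0" using N(2) by (auto simp: finite_index_def card_gt_0_iff)
  hence "card (rcosets N) dvd Lcm {1..s}" using \<open>\<not> s < div_index G g\<close> N(4) by (intro dvd_Lcm) auto
  then obtain q where q: "Lcm {1..s} = card (rcosets N) * q" by blast
  have "power_subgroup G (carrier G) (Lcm {1..s}) \<subseteq> N"
  proof (rule power_subgroup_least[OF sN])
    fix x assume x: "x \<in> carrier G"
    have "x [^] Lcm {1..s} = (x [^] card (rcosets N)) [^] q" unfolding q using x by (simp add: nat_pow_pow)
    thus "x [^] Lcm {1..s} \<in> N" using subgroupD(8)[OF sN power_card_in_normal[OF N(1) x]] by simp
  qed
  thus False using g N(3) by blast
qed

text \<open>The two letters have different lengths and spheres are not nested, so the radius is only
  bounded.\<close>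

lemma bword_sphere:
  assumes S: "S \<subseteq> carrier G" and a: "a \<in> sphere G S la" and u: "u \<in> sphere G S lu"
  shows "\<exists>n \<le> length cs * (la + lu). bword G a u cs \<in> sphere G S n"
proof (induction cs)
  case (Cons c cs)
  then obtain n where n: "n \<le> length cs * (la + lu)" "bword G a u cs \<in> sphere G S n" by blast
  show ?case
  proof (cases c)
    case True
    have "bword G a u (c # cs) \<in> sphere G S ((la + lu) + n)"
      using sphere_add[OF S sphere_add[OF S a u] n(2)] True by simp
    thus ?thesis using n(1) by (intro exI[of _ "(la + lu) + n"]) auto
  next
    case False
    have "bword G a u (c # cs) \<in> sphere G S (lu + n)" using sphere_add[OF S u n(2)] False by simp
    thus ?thesis using n(1) by (intro exI[of _ "lu + n"]) auto
  qed
qed auto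

section \<open>The two growth estimates\<close>

lemma nilpotent_RF_upper:
  assumes H: "subgroup H G" "covered G (carrier G) H k" "lcs G H c = {\<one>}"
    and S: "finite S" "S \<subseteq> carrier G" "generate G S = carrier G"
    and cov: "\<forall>m>0. covered G (carrier G) (power_subgroup G (carrier G) m) (b * m ^ d)"
  shows "RF G S \<preceq> (\<lambda>r. ln r ^ d)"
proof -
  obtain e C D where e: "e > 0" and det: "\<And>n g l. g \<in> sphere G (S \<union> (\<lambda>s. inv s) ` S) n \<Longrightarrow> g \<noteq> \<one> \<Longrightarrow>
      C * (n + 1) ^ D < 4 ^ l \<Longrightarrow> \<exists>q\<in>{1..2 * l + 1}. g \<notin> power_subgroup G (carrier G) (e * q)"
    using virtually_nilpotent_detection[OF H S] by blast
  \<comment> \<open>Chosen so that \<open>2 * l + 1 <= E * (1 + t)\<close> for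
    \<open>l = C + D * t\<close> below.\<close>
  define E where "E = 2 * C + 2 * D + 1"
  define M where "M = real b * (real e * real E) ^ d"
  \<comment> \<open>18 comes from \<open>exp 2 * (r + 1) <= 9 * (2 * r)\<close>, which lets
    \<open>ln (A * r)\<close> absorb \<open>1 + t\<close>; adding \<open>M\<close> makes
    \<open>A\<close> dominate the multiplicative constant.\<close>
  define A where "A = M + 18"
  have M: "M \<ge> 0" by (simp add: M_def)
  have "RF G S r \<le> A * ln (A * r) ^ d" if r: "r \<ge> max 1 (1 / A)" for r
  proof -
    have r1: "r \<ge> 1" using r by simp
    define t where "t = nat \<lceil>ln (r + 1)\<rceil>"
    have t: "ln (r + 1) \<le> real t" "real t \<le> ln (r + 1) + 1"
      using r1 by (auto simp: t_def)
    have lnA: "1 + real t \<le> ln (A * r)"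
    proof -
      have "1 + real t \<le> 2 + ln (r + 1)" using t(2) by linarith
      also have "\<dots> = ln (exp 2 * (r + 1))" using r1 by (subst ln_mult) auto
      also have "\<dots> \<le> ln (A * r)"
      proof (rule ln_mono)
        have "exp (2::real) = exp 1 * exp 1" by (simp flip: exp_add)
        also have "\<dots> \<le> 3 * 3" using exp_le by (intro mult_mono) auto
        finally have "exp (2::real) \<le> 9" by simp
        hence "exp 2 * (r + 1) \<le> 9 * (2 * r)" using r1 by (intro mult_mono) auto
        also have "\<dots> \<le> A * r" using M r1 by (simp add: A_def algebra_simps)
        finally show "exp 2 * (r + 1) \<le> A * r" .
      qed (use r1 M in \<open>auto simp: A_def\<close>)
      finally show ?thesis .
    qed
    have bound: "M * (1 + real t) ^ d \<le> A * ln (A * r) ^ d"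
      using lnA M by (intro mult_mono power_mono) (auto simp: A_def)
    have "RF G S r \<le> M * (1 + real t) ^ d"
    proof (rule RF_le[OF S])
      show "0 \<le> M * (1 + real t) ^ d" using M by simp
      fix g assume g: "g \<in> carrier G" "g \<noteq> \<one>" "real (word_norm G S g) \<le> r"
      define n where "n = word_norm G S g"
      \<comment> \<open>\<open>4 ^ C\<close> exceeds the constant \<open>C\<close>, and
        \<open>4 ^ t\<close> is at least \<open>n + 1\<close>, so \<open>4 ^ l\<close> exceeds
        \<open>C * (n + 1) ^ D\<close>.\<close>
      define l where "l = C + D * t"
      have "real (n + 1) \<le> exp (real t)"
      proof -
        have "real (n + 1) \<le> r + 1" using g(3) by (simp add: n_def)
        also have "\<dots> = exp (ln (r + 1))" using r1 by simp
        also have "\<dots> \<le> exp (real t)" using t(1) by simp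
        finally show ?thesis .
      qed
      also have "exp (real t) = exp 1 ^ t" by (simp add: exp_of_nat_mult[of t 1, simplified])
      also have "\<dots> \<le> 4 ^ t" using exp_le by (intro power_mono) auto
      finally have "real (n + 1) \<le> real (4 ^ t)" by simp
      hence nt: "n + 1 \<le> 4 ^ t" by (simp only: of_nat_le_iff)
      have "C < 2 ^ C" by (rule less_exp)
      also have "(2::nat) ^ C \<le> 4 ^ C" by (rule power_mono) auto
      finally have "C * (n + 1) ^ D < 4 ^ C * (4 ^ t) ^ D"
        using nt by (intro mult_less_le_imp_less power_mono) auto
      also have "\<dots> = 4 ^ l" by (simp add: l_def power_add mult.commute flip: power_mult)
      finally have "C * (n + 1) ^ D < 4 ^ l" .
      then obtain q where q: "q \<in> {1..2 * l + 1}" "g \<notin> power_subgroup G (carrier G) (e * q)"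
        using det[OF in_sphere_word_norm[OF S(2,3) g(1)] g(2)] unfolding n_def by blast
      have "div_index G g \<le> b * (e * q) ^ d"
        using q cov e by (intro div_index_le[OF refl q(2)]) auto
      also have "\<dots> \<le> b * (e * (E * (1 + t))) ^ d"
      proof -
        have "q \<le> 2 * l + 1" using q by simp
        also have "\<dots> \<le> E * (1 + t)" by (simp add: l_def E_def algebra_simps)
        finally show ?thesis by (intro mult_left_mono power_mono) auto
      qed
      finally have "real (div_index G g) \<le> real (b * (e * (E * (1 + t))) ^ d)" by (simp only: of_nat_le_iff)
      also have "\<dots> = M * (1 + real t) ^ d" by (simp only: M_def of_nat_mult of_nat_power of_nat_add of_nat_1 power_mult_distrib mult.assoc)
      finally show "real (div_index G g) \<le> M * (1 + real t) ^ d" .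
    qed
    thus ?thesis using bound by linarith
  qed
  moreover have "A > 0" using M by (simp add: A_def)
  ultimately show ?thesis unfolding growth_le_def by blast
qed

end

context M_group_data
begin

lemma RF_lower:
  assumes not_nil: "\<not> (\<exists>V k n. subgroup V G \<and> covered G (carrier G) V k \<and> lcs G V n = {\<one>})"
    and S: "finite S" "S \<subseteq> carrier G" "generate G S = carrier G"
  shows "(\<lambda>r. r) \<preceq> RF G S"
proof -
  obtain a u where au: "a \<in> carrier G" "u \<in> carrier G"
    "\<forall>cs cs'. length cs = length cs' \<longrightarrow> cs \<noteq> cs' \<longrightarrow>
       (\<exists>m>0. inv (bword G a u cs) \<otimes> bword G a u cs' \<notin> power_subgroup G (carrier G) m)"
    using exists_residually_free_words_M_group[OF not_nil] by blast
  obtain b d where bd: "\<forall>m>0. covered G (carrier G) (power_subgroup G (carrier G) m) (b * m ^ d)"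
    using power_boundedD[OF power_bounded_carrier subgroup_self] by blast
  define S1 where "S1 = S \<union> (\<lambda>s. inv s) ` S"
  have S1: "S1 \<subseteq> carrier G" using S by (auto simp: S1_def)
  define L where "L = word_norm G S a + word_norm G S u"
  have sph: "a \<in> sphere G S1 (word_norm G S a)" "u \<in> sphere G S1 (word_norm G S u)"
    unfolding S1_def by (intro in_sphere_word_norm S au)+
  have key: "\<exists>g\<in>carrier G. g \<noteq> \<one> \<and> word_norm G S g \<le> 2 * (4 * s * d + b) * L \<and> s < div_index G g" for s
  proof -
    \<comment> \<open>There must be more words, \<open>2 ^ n\<close>, than cosets, at most
      \<open>b * m ^ d\<close> with \<open>m <= 16 ^ s\<close>: the summand \<open>4 * s * d\<close>
      outweighs \<open>m ^ d\<close>, and the summand \<open>b\<close> outweighs the constant by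
      \<open>b < 2 ^ b\<close>.\<close>
    define n where "n = 4 * s * d + b"
    define m where "m = (Lcm {1..s} :: nat)"
    define P where "P = power_subgroup G (carrier G) m"
    have m: "m > 0" "m \<le> 16 ^ s" unfolding m_def by (rule Lcm_upto_pos, rule Lcm_upto_le)
    have P: "subgroup P G" unfolding P_def by (rule power_subgroup_subgroup[OF subgroup_self])
    have cov: "covered G (carrier G) P (b * m ^ d)" using bd m by (simp add: P_def)
    define I where "I = {cs :: bool list. set cs \<subseteq> UNIV \<and> length cs = n}"
    have "card I = 2 ^ n" unfolding I_def by (subst card_lists_length_eq) auto
    moreover have "b * m ^ d < 2 ^ n"
    proof -
      have "m ^ d \<le> (16 ^ s) ^ d" using m(2) by (rule power_mono) simp
      also have "\<dots> = (2::nat) ^ (4 * s * d)" by (simp add: power_mult)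
      finally have "b * m ^ d \<le> b * 2 ^ (4 * s * d)" by (rule mult_left_mono) simp
      also have "\<dots> < 2 ^ b * 2 ^ (4 * s * d)" using less_exp[of b] by (intro mult_strict_right_mono) auto
      also have "\<dots> = 2 ^ n" by (simp add: n_def power_add)
      finally show ?thesis .
    qed
    ultimately have I: "b * m ^ d < card I" by simp
    obtain cs cs' where cs: "cs \<in> I" "cs' \<in> I" "cs \<noteq> cs'" "inv (bword G a u cs) \<otimes> bword G a u cs' \<in> P"
      using covered_pigeonhole[OF cov P order_refl _ I, of "bword G a u"] bword_closed[OF au(1,2)] by blast
    define g where "g = inv (bword G a u cs) \<otimes> bword G a u cs'"
    have len: "length cs = n" "length cs' = n" using cs by (auto simp: I_def)
    obtain m' where m': "m' > 0" "g \<notin> power_subgroup G (carrier G) m'"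
      using au(3) cs len unfolding g_def by metis
    have gc: "g \<in> carrier G" using bword_closed[OF au(1,2)] by (simp add: g_def)
    have "g \<noteq> \<one>" using m'(2) subgroupD(2)[OF power_subgroup_subgroup[OF subgroup_self]] by metis
    moreover have "s < div_index G g"
      using m' bd cs(4) by (intro div_index_gt[of m']) (auto simp: P_def m_def g_def)
    moreover have "word_norm G S g \<le> 2 * n * L"
    proof -
      obtain i where i: "i \<le> n * L" "bword G a u cs \<in> sphere G S1 i"
        using bword_sphere[OF S1 sph, of cs] len by (auto simp: L_def)
      obtain j where j: "j \<le> n * L" "bword G a u cs' \<in> sphere G S1 j"
        using bword_sphere[OF S1 sph, of cs'] len by (auto simp: L_def)
      have "inv (bword G a u cs) \<in> sphere G S1 i" using i(2) unfolding S1_def by (rule sphere_inv[OF S(2)])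
      hence "g \<in> sphere G S1 (i + j)" unfolding g_def by (rule sphere_add[OF S1 _ j(2)])
      hence "word_norm G S g \<le> i + j" unfolding S1_def by (rule word_norm_le)
      thus ?thesis using i j by simp
    qed
    ultimately show ?thesis using gc by (auto simp: n_def)
  qed
  \<comment> \<open>The product arises from the bound on the norm with \<open>s <= 2 r\<close> and
    \<open>b <= b r\<close>. Adding 1 makes \<open>C\<close> at least 1, so that it may also stand
    in front of \<open>RF\<close>.\<close>
  define C where "C = real ((16 * d + 2 * b) * L) + 1"
  have "r \<le> C * RF G S (C * r)" if r: "r \<ge> max 1 (1 / C)" for r
  proof -
    have r1: "r \<ge> 1" using r by simp
    define s where "s = nat \<lceil>r\<rceil>"
    have s: "r \<le> real s" "real s \<le> 2 * r" using r1 by (auto simp: s_def) linarith+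
    obtain g where g: "g \<in> carrier G" "g \<noteq> \<one>" "word_norm G S g \<le> 2 * (4 * s * d + b) * L" "s < div_index G g"
      using key[of s] by blast
    have "real (word_norm G S g) \<le> real (2 * (4 * s * d + b) * L)" using g(3) by (simp only: of_nat_le_iff)
    also have "\<dots> = 2 * (4 * real s * real d + real b * 1) * real L" by simp
    also have "\<dots> \<le> 2 * (4 * (2 * r) * real d + real b * r) * real L"
      using s r1 by (intro mult_right_mono mult_left_mono add_mono) auto
    also have "\<dots> = real ((16 * d + 2 * b) * L) * r" by (simp add: algebra_simps)
    also have "\<dots> \<le> C * r" using r1 by (intro mult_right_mono) (auto simp: C_def)
    finally have "real (div_index G g) \<le> RF G S (C * r)" by (intro RF_ge[OF S] g)
    moreover have "r \<le> real (div_index G g)" using s(1) g(4) by linarith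
    ultimately have 1: "r \<le> RF G S (C * r)" by linarith
    also have "1 * RF G S (C * r) \<le> C * RF G S (C * r)"
      using 1 r1 by (intro mult_right_mono) (auto simp: C_def)
    finally show ?thesis by simp
  qed
  moreover have "C > 0" by (simp add: C_def add_nonneg_pos)
  ultimately show ?thesis unfolding growth_le_def by blast
qed

end

lemma M_group_data_exists:
  fixes G :: "('a, 'b) monoid_scheme"
  assumes "M_group G"
  shows "\<exists>K H0 S0 k0 r c. M_group_data G K H0 S0 k0 r c"
proof -
  interpret group G using assms by (simp add: M_group_def finitely_generated_def)
  obtain S0 where S0: "finite S0" "S0 \<subseteq> carrier G" "generate G S0 = carrier G"
    using assms by (auto simp: M_group_def finitely_generated_def generating_set_def)
  obtain K where K: "K \<lhd> G" "torsion_free (G\<lparr>carrier := K\<rparr>)" "nilpotent_group (G\<lparr>carrier := K\<rparr>)"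
    "prufer_rank (G\<lparr>carrier := K\<rparr>) < \<infinity>" "virtually comm_group (G Mod K)"
    using assms by (auto simp: M_group_def)
  have sK: "subgroup K G" by (rule normal_imp_subgroup[OF K(1)])
  have nK: "normalizes G (carrier G) K" using normal_iff_normalizes[OF sK] K(1) by blast
  obtain c where c: "lcs G K c = {\<one>\<^bsub>G\<^esub>}"
    using K(3) lower_central_eq_lcs[OF sK] by (auto simp: nilpotent_group_def)
  have tf: "x = \<one>\<^bsub>G\<^esub>" if "x \<in> K" "n > 0" "x [^]\<^bsub>G\<^esub> n = \<one>\<^bsub>G\<^esub>" for x and n :: nat
    using K(2) that by (auto simp: torsion_free_def simp flip: nat_pow_consistent)
  obtain r where r: "\<forall>F. finite F \<longrightarrow> F \<subseteq> K \<longrightarrow> (\<exists>T. finite T \<and> T \<subseteq> K \<and> card T \<le> r \<and> generate G T = generate G F)"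
    using prufer_rank_generate[OF sK K(4)] by blast
  define Q where "Q = G Mod K"
  define h where "h = (\<lambda>x. K #>\<^bsub>G\<^esub> x)"
  interpret h: group_hom G Q h unfolding Q_def h_def by (rule mod_hom(1)[OF K(1)])
  have surj: "h ` carrier G = carrier Q" unfolding Q_def h_def by (rule mod_hom(2)[OF K(1)])
  have h1: "h x = \<one>\<^bsub>Q\<^esub> \<longleftrightarrow> x \<in> K" if "x \<in> carrier G" for x
    unfolding Q_def h_def by (rule mod_hom(3)[OF K(1) that])
  obtain V where V: "subgroup V Q" "finite_index Q V" "comm_group (Q\<lparr>carrier := V\<rparr>)"
    using K(5) by (auto simp: virtually_def Q_def)
  obtain k0 where k0: "covered Q (carrier Q) V k0" using h.H.covered_if_finite_index[OF V(2,1)] by blast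
  define H0 where "H0 = {x \<in> carrier G. h x \<in> V}"
  have H0: "subgroup H0 G" "covered G (carrier G) H0 k0"
    unfolding H0_def by (rule h.preimage_subgroup[OF V(1)], rule h.covered_preimage[OF k0 V(1) surj])
  have KH0: "K \<subseteq> H0"
  proof
    fix x assume x: "x \<in> K"
    have "x \<in> carrier G" by (rule subgroupD(3)[OF sK x])
    thus "x \<in> H0" using h1[of x] x h.H.subgroupD(2)[OF V(1)] by (simp add: H0_def)
  qed
  have comm: "commt G x y \<in> K" if "x \<in> H0" "y \<in> H0" for x y
  proof -
    have xy: "x \<in> carrier G" "y \<in> carrier G" "h x \<in> V" "h y \<in> V" using that by (auto simp: H0_def)
    have "h x \<otimes>\<^bsub>Q\<^esub> h y = h y \<otimes>\<^bsub>Q\<^esub> h x"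
      using comm_monoid.m_comm[OF comm_group.axioms(1)[OF V(3)], of "h x" "h y"] xy by simp
    hence "h (commt G x y) = \<one>\<^bsub>Q\<^esub>" using xy by (simp add: h.hom_commt commt_def h.H.m_assoc)
    thus ?thesis using h1 xy by simp
  qed
  have "M_group_data G K H0 S0 k0 r c"
  proof (intro M_group_data.intro M_group_data_axioms.intro)
    show "group G" by (rule is_group)
    show "\<exists>T. finite T \<and> T \<subseteq> K \<and> card T \<le> r \<and> generate G T = generate G F"
      if "finite F" "F \<subseteq> K" for F
      using r that by blast
  qed (rule S0 sK nK c H0 KH0 | (rule tf comm; assumption))+
  thus ?thesis by blast
qed

lemma (in group) virtually_nilpotent_iff:
  "virtually nilpotent_group G \<longleftrightarrow> (\<exists>V k n. subgroup V G \<and> covered G (carrier G) V k \<and> lcs G V n = {\<one>})"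
proof
  assume "virtually nilpotent_group G"
  then obtain V where V: "subgroup V G" "finite_index G V" "nilpotent_group (G\<lparr>carrier := V\<rparr>)"
    by (auto simp: virtually_def)
  obtain n where "lcs G V n = {\<one>}" using V(3) lower_central_eq_lcs[OF V(1)] by (auto simp: nilpotent_group_def)
  thus "\<exists>V k n. subgroup V G \<and> covered G (carrier G) V k \<and> lcs G V n = {\<one>}"
    using V(1) covered_if_finite_index[OF V(2,1)] by blast
next
  assume "\<exists>V k n. subgroup V G \<and> covered G (carrier G) V k \<and> lcs G V n = {\<one>}"
  then obtain V k n where V: "subgroup V G" "covered G (carrier G) V k" "lcs G V n = {\<one>}" by blast
  have "nilpotent_group (G\<lparr>carrier := V\<rparr>)"
    unfolding nilpotent_group_def using subgroup_imp_group[OF V(1)] lower_central_eq_lcs[OF V(1)] V(3) by auto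
  thus "virtually nilpotent_group G"
    unfolding virtually_def using V(1) finite_index_if_covered(1)[OF V(2,1)] is_group by blast
qed

theorem theorem3:
  fixes G :: "('a, 'b) monoid_scheme"
  assumes "M_group G"
  shows "(virtually nilpotent_group G \<longrightarrow>
            (\<exists>k::nat. \<forall>S. finite S \<and> generating_set G S \<longrightarrow> RF G S \<preceq> (\<lambda>r. (ln r) ^ k)))
       \<and> (\<not> virtually nilpotent_group G \<longrightarrow>
            (\<forall>S. finite S \<and> generating_set G S \<longrightarrow> (\<lambda>r. r) \<preceq> RF G S))"
proof -
  obtain K H0 S0 k0 r c where "M_group_data G K H0 S0 k0 r c" using M_group_data_exists[OF assms] by blast
  then interpret M_group_data G K H0 S0 k0 r c .
  \<comment> \<open>Chosen before \<open>S\<close>, so the exponent \<open>k = d\<close> is the same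
    for all finite generating sets.\<close>
  obtain b d where bd: "\<forall>m>0. covered G (carrier G) (power_subgroup G (carrier G) m) (b * m ^ d)"
    using power_boundedD[OF power_bounded_carrier subgroup_self] by blast
  show ?thesis unfolding virtually_nilpotent_iff generating_set_def
    using nilpotent_RF_upper[OF _ _ _ _ _ _ bd] RF_lower by blast
qed

end
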